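(* Let $(\Omega,\Sigma,\mu)$ be a complete $\sigma$-finite measure space and let $p:\Omega\to[1,+\infty]$ be a measurable function such that $L^{p(\cdot)}(\Omega)$ is nonreflexive. Assume that at least one of the following conditions holds: a) $L^{p(\cdot)}(\Omega)$ contains an isometric copy of $\ell_\infty$; b) $p^{-1}(\{1\})$ is essentially formed by at most finitely many atoms; c) $L^{p(\cdot)}(\Omega)$ does not contain an isometric copy of $\ell_1$. Then $L^{p(\cdot)}(\Omega)$ contains a nonreflexive closed subspace with the fixed point property (FPP).
   Context: Variable Lebesgue space: for a measurable $p:\Omega\to[1,+\infty]$ put $\Omega_f=\{t: p(t)<+\infty\}$ and, for measurable $g:\Omega\to\mathbb{R}$ (functions equal a.e. are identified), define the modular $\rho(g)=\int_{\Omega_f}|g(t)|^{p(t)}\,d\mu+\operatorname{ess\,sup}_{t\in p^{-1}(\{+\infty\})}|g(t)|$ (the last term is $0$ if $p^{-1}(\{+\infty\})$ is null). $L^{p(\cdot)}(\Omega)$ is the space of those $g$ with $\rho(g/\lambda)<\infty$ for some $\lambda>0$, with the Luxemburg norm $\|g\|=\inf\{\alpha>0:\rho(g/\alpha)\le 1\}$; it is a real Banach space. Subspaces carry the Luxemburg norm. An atom is a measurable set $A$ with $\mu(A)>0$ such that each measurable subset of $A$ has measure $0$ or $\mu(A)$. A set is essentially formed by at most finitely many atoms if, up to a null set, it is a union of finitely many (possibly zero) atoms. $X$ contains an isometric copy of $Y$ if there is a linear isometric embedding $Y\to X$. A Banach space $X$ has the FPP if for every nonempty closed convex bounded $C\subset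 X$, every nonexpansive $T:C\to C$ (i.e. $\|Tx-Ty\|\le\|x-y\|$ for all $x,y\in C$) has a fixed point. *)

theory Defs
  imports "HOL-Analysis.Analysis" "HOL-Probability.Essential_Supremum"
begin

section \<open>Real normed spaces on an explicit carrier\<close>

text \<open>The space \<open>L\<^sup>p\<^sup>(\<^sup>\<cdot>\<^sup>)\<close> depends on a measure and on an exponent function, so it cannot be a type;
  normed spaces are therefore represented by records. The notions below are meant for records
  that satisfy the axioms of a real normed space on \<open>pts\<close>, as the instances below do.\<close>

record 'v nspace =
  pts :: "'v set"
  nadd :: "'v \<Rightarrow> 'v \<Rightarrow> 'v"
  nzero :: "'v"
  nscale :: "real \<Rightarrow> 'v \<Rightarrow> 'v"
  nnorm :: "'v \<Rightarrow> real"

text \<open>The value outside the carrier is irrelevant; it is set to 0 because the locale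
  \<open>Metric_space\<close> requires nonnegativity and symmetry everywhere.\<close>

definition ndist :: "'v nspace \<Rightarrow> 'v \<Rightarrow> 'v \<Rightarrow> real" where
  "ndist X x y =
    (if x \<in> pts X \<and> y \<in> pts X then nnorm X (nadd X x (nscale X (- 1) y)) else 0)"

definition ntopology :: "'v nspace \<Rightarrow> 'v topology" where
  "ntopology X = Metric_space.mtopology (pts X) (ndist X)"

definition nbounded :: "'v nspace \<Rightarrow> 'v set \<Rightarrow> bool" where
  "nbounded X S \<longleftrightarrow> (\<exists>B. \<forall>x\<in>S. nnorm X x \<le> B)"

definition nconvex :: "'v nspace \<Rightarrow> 'v set \<Rightarrow> bool" where
  "nconvex X S \<longleftrightarrow> (\<forall>x\<in>S. \<forall>y\<in>S. \<forall>u\<in>{0..1}. nadd X (nscale X (1 - u) x) (nscale X u y) \<in> S)"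

definition closed_subspace :: "'v nspace \<Rightarrow> 'v set \<Rightarrow> bool" where
  "closed_subspace X S \<longleftrightarrow> nzero X \<in> S \<and> (\<forall>x\<in>S. \<forall>y\<in>S. nadd X x y \<in> S) \<and>
    (\<forall>c. \<forall>x\<in>S. nscale X c x \<in> S) \<and> closedin (ntopology X) S"

definition restrict_nspace :: "'v nspace \<Rightarrow> 'v set \<Rightarrow> 'v nspace" where
  "restrict_nspace X S = X\<lparr>pts := S\<rparr>"

definition nlinear :: "'v nspace \<Rightarrow> 'w nspace \<Rightarrow> ('v \<Rightarrow> 'w) \<Rightarrow> bool" where
  "nlinear X Y T \<longleftrightarrow> T \<in> pts X \<rightarrow> pts Y \<and>
    (\<forall>x\<in>pts X. \<forall>y\<in>pts X. T (nadd X x y) = nadd Y (T x) (T y)) \<and>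
    (\<forall>c. \<forall>x\<in>pts X. T (nscale X c x) = nscale Y c (T x))"

definition contains_isometric_copy :: "'v nspace \<Rightarrow> 'w nspace \<Rightarrow> bool" where
  "contains_isometric_copy X Y \<longleftrightarrow>
    (\<exists>T. nlinear Y X T \<and> (\<forall>y\<in>pts Y. nnorm X (T y) = nnorm Y y))"

definition real_line :: "real nspace" where
  "real_line = \<lparr>pts = UNIV, nadd = (+), nzero = 0, nscale = (*), nnorm = abs\<rparr>"

text \<open>Functionals are taken in \<open>extensional (pts X)\<close>, so that two functionals agreeing on
  the carrier are equal.\<close>

definition dual :: "'v nspace \<Rightarrow> ('v \<Rightarrow> real) nspace" where
  "dual X = \<lparr>
    pts = {f \<in> extensional (pts X). nlinear X real_line f \<and>
      (\<exists>B. \<forall>x\<in>pts X. \<bar>f x\<bar> \<le> B * nnorm X x)},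
    nadd = (\<lambda>f g. \<lambda>x\<in>pts X. f x + g x),
    nzero = (\<lambda>x\<in>pts X. 0),
    nscale = (\<lambda>c f. \<lambda>x\<in>pts X. c * f x),
    nnorm = (\<lambda>f. SUP x\<in>{x \<in> pts X. nnorm X x \<le> 1}. \<bar>f x\<bar>)\<rparr>"

definition canonical_embedding :: "'v nspace \<Rightarrow> 'v \<Rightarrow> ('v \<Rightarrow> real) \<Rightarrow> real" where
  "canonical_embedding X x = (\<lambda>f\<in>pts (dual X). f x)"

definition reflexive :: "'v nspace \<Rightarrow> bool" where
  "reflexive X \<longleftrightarrow> canonical_embedding X ` pts X = pts (dual (dual X))"

definition nonexpansive_on :: "'v nspace \<Rightarrow> 'v set \<Rightarrow> ('v \<Rightarrow> 'v) \<Rightarrow> bool" where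
  "nonexpansive_on X C T \<longleftrightarrow> (\<forall>x\<in>C. \<forall>y\<in>C. ndist X (T x) (T y) \<le> ndist X x y)"

definition FPP :: "'v nspace \<Rightarrow> bool" where
  "FPP X \<longleftrightarrow>
    (\<forall>C. C \<noteq> {} \<and> closedin (ntopology X) C \<and> nconvex X C \<and> nbounded X C \<longrightarrow>
      (\<forall>T. T \<in> C \<rightarrow> C \<and> nonexpansive_on X C T \<longrightarrow> (\<exists>x\<in>C. T x = x)))"

definition ell1 :: "(nat \<Rightarrow> real) nspace" where
  "ell1 = \<lparr>pts = {x. summable (\<lambda>n. \<bar>x n\<bar>)},
    nadd = (\<lambda>x y n. x n + y n), nzero = (\<lambda>n. 0), nscale = (\<lambda>c x n. c * x n),
    nnorm = (\<lambda>x. \<Sum>n. \<bar>x n\<bar>)\<rparr>"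

definition ell_infty :: "(nat \<Rightarrow> real) nspace" where
  "ell_infty = \<lparr>pts = {x. bounded (range x)},
    nadd = (\<lambda>x y n. x n + y n), nzero = (\<lambda>n. 0), nscale = (\<lambda>c x n. c * x n),
    nnorm = (\<lambda>x. SUP n. \<bar>x n\<bar>)\<rparr>"


section \<open>Variable Lebesgue spaces\<close>

text \<open>The essential supremum is taken in \<open>ennreal\<close>, where it equals 0 if \<open>p = \<infinity>\<close> holds only on
  a null set.\<close>

definition modular :: "'a measure \<Rightarrow> ('a \<Rightarrow> ennreal) \<Rightarrow> ('a \<Rightarrow> real) \<Rightarrow> ennreal" where
  "modular M p g =
    (\<integral>\<^sup>+ t \<in> {t \<in> space M. p t < \<infinity>}. ennreal (\<bar>g t\<bar> powr enn2real (p t)) \<partial>M) +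
    esssup (restrict_space M {t \<in> space M. p t = \<infinity>}) (\<lambda>t. ennreal \<bar>g t\<bar>)"

definition Lvar_fun :: "'a measure \<Rightarrow> ('a \<Rightarrow> ennreal) \<Rightarrow> ('a \<Rightarrow> real) set" where
  "Lvar_fun M p =
    {g \<in> borel_measurable M. \<exists>c>0. modular M p (\<lambda>t. g t / c) < \<infinity>}"

definition luxemburg :: "'a measure \<Rightarrow> ('a \<Rightarrow> ennreal) \<Rightarrow> ('a \<Rightarrow> real) \<Rightarrow> real" where
  "luxemburg M p g = Inf {\<alpha>. 0 < \<alpha> \<and> modular M p (\<lambda>t. g t / \<alpha>) \<le> 1}"

definition ae_eq :: "'a measure \<Rightarrow> (('a \<Rightarrow> real) \<times> ('a \<Rightarrow> real)) set" where
  "ae_eq M = {(f, g). f \<in> borel_measurable M \<and> g \<in> borel_measurable M \<and> (AE t in M. f t = g t)}"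

text \<open>Points are almost-everywhere classes. The operations are lifted to classes
  as in \<open>HOL.Equiv_Relations\<close>; the norm of a class is the common Luxemburg norm of its members.\<close>

definition Lvar :: "'a measure \<Rightarrow> ('a \<Rightarrow> ennreal) \<Rightarrow> ('a \<Rightarrow> real) set nspace" where
  "Lvar M p = \<lparr>
    pts = Lvar_fun M p // ae_eq M,
    nadd = (\<lambda>F G. \<Union>f\<in>F. \<Union>g\<in>G. ae_eq M `` {\<lambda>t. f t + g t}),
    nzero = ae_eq M `` {\<lambda>t. 0},
    nscale = (\<lambda>c F. \<Union>f\<in>F. ae_eq M `` {\<lambda>t. c * f t}),
    nnorm = (\<lambda>F. the_elem (luxemburg M p ` F))\<rparr>"

definition atom :: "'a measure \<Rightarrow> 'a set \<Rightarrow> bool" where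
  "atom M A \<longleftrightarrow> A \<in> sets M \<and> 0 < emeasure M A \<and>
    (\<forall>B\<in>sets M. B \<subseteq> A \<longrightarrow> emeasure M B = 0 \<or> emeasure M B = emeasure M A)"

definition ess_finitely_many_atoms :: "'a measure \<Rightarrow> 'a set \<Rightarrow> bool" where
  "ess_finitely_many_atoms M S \<longleftrightarrow>
    (\<exists>\<A>. finite \<A> \<and> (\<forall>A\<in>\<A>. atom M A) \<and> sym_diff S (\<Union>\<A>) \<in> null_sets M)"

end

theory Submission
  imports Defs
begin

text \<open>
  The subspace is always a copy of the sequence space \<open>l1\<close> under an equivalent norm \<open>N\<close> that is
  close to the usual norm on vectors supported far out, and for which a small perturbation of
  finitely many coordinates of a vector supported far out costs less than its own length (locale
  \<open>l1_renorming\<close>). Such a space is not reflexive, since it is isomorphic to \<open>l1\<close>, and it has the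
  fixed point property (\<open>invariant_fixed_point\<close>). A copy of it is complete, hence closed, and
  inherits both properties (\<open>nonreflexive_FPP_subspace_if_copy\<close>).

  The fixed point property holds for the following reason. Approximate fixed point sequences can
  be taken to converge coordinatewise; call the limit of the distances to the coordinatewise
  limit the radius of the sequence. In \<open>l1\<close> radii add up: if all terms of a second sequence stay
  asymptotically within \<open>d\<close> of a first one, then the two radii have sum at most \<open>d\<close>. Let \<open>c\<close> be the
  infimum of the radii in an invariant set and suppose that \<open>c > 0\<close>. Take a sequence \<open>y\<^sub>n\<close> of radius
  close to \<open>c\<close> and a point \<open>z\<^sub>0\<close> of the set that was chosen before, and move \<open>y\<^sub>m\<close> slightly towards \<open>z\<^sub>0\<close>, to
  \<open>(1 - t) y\<^sub>m + t z\<^sub>0\<close>. The smaller weight of \<open>y\<^sub>m\<close> gains about \<open>t c\<close>; the tail of \<open>z\<^sub>0\<close> and the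
  first coordinates of \<open>z\<^sub>0\<close>, to which \<open>N\<close> is insensitive, lose less. So the points that are
  asymptotically within \<open>2 c - t c / 8\<close> of the sequence form a nonempty invariant set, and any
  sequence in it has radius below \<open>c\<close>, a contradiction (\<open>radius_eq_0\<close>). Radius zero gives
  invariant sets of arbitrarily small diameter, which shrink to a fixed point.

  It remains to find a copy. If the space contains \<open>ell_infty\<close>, it contains \<open>l1\<close> under the norm
  \<open>sup\<^sub>k \<gamma>\<^sub>k \<Sum>\<^sub>i\<^sub>\<ge>\<^sub>k \<bar>x\<^sub>i\<bar>\<close> with \<open>\<gamma>\<^sub>k\<close> increasing to 1, because this norm is the supremum of countably
  many functionals (\<open>ell_infty_contains_renormed_l1\<close>). This covers the cases that \<open>p\<close> is infinite
  on more than finitely many atoms or essentially unbounded where it is finite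
  (\<open>contains_ell_infty_inf_part\<close>, \<open>contains_ell_infty_unbounded\<close>). Otherwise each of the remaining two
  hypotheses makes the set where \<open>p\<close> is 1 essentially a union of finitely many atoms, since infinitely
  many disjoint sets of positive measure in it would span \<open>ell1\<close> (\<open>contains_ell1\<close>). If \<open>p\<close> takes values above but arbitrarily near 1 on sets of
  positive measure, choose disjoint sets with \<open>\<delta>\<^sub>n \<le> p - 1 < 2\<^sup>-\<^sup>n\<close> on the \<open>n\<close>-th one: the upper
  bounds make the norm of the spanned sequence space nearly that of \<open>l1\<close> far out, and the lower
  bounds make small coordinates contribute to the modular to higher order
  (\<open>contains_renormed_l1_if_expo_near_1\<close>). If there are no such values, then \<open>p\<close> lies between two
  bounds in \<open>]1, \<infinity>[\<close> off finitely many atoms, on which changing \<open>p\<close> gives an equivalent norm. Then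
  functionals are represented by densities from the space with the conjugate exponent, and
  functionals on that space in the same way, so that the space is reflexive
  (\<open>reflexive_if_exponent_bounded\<close>), contrary to the hypothesis.
\<close>

section \<open>The Banach space of absolutely summable sequences\<close>

typedef l1 = "{x::nat \<Rightarrow> real. summable (\<lambda>n. \<bar>x n\<bar>)}"
  morphisms coord Abs_l1
  by (rule exI[of _ "\<lambda>_. 0"]) simp

setup_lifting type_definition_l1

lemma summable_coord: "summable (\<lambda>n. \<bar>coord x n\<bar>)"
  using coord[of x] by simp

lemma coord_Abs_l1: "summable (\<lambda>n. \<bar>f n\<bar>) \<Longrightarrow> coord (Abs_l1 f) = f"
  by (simp add: Abs_l1_inverse)

lemma l1_eqI: "(\<And>i. coord x i = coord y i) \<Longrightarrow> x = y"
  by (meson coord_inject ext)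

lemma summable_abs_comb:
  fixes f g :: "nat \<Rightarrow> real"
  assumes "summable (\<lambda>n. \<bar>f n\<bar>)" "summable (\<lambda>n. \<bar>g n\<bar>)"
  shows "summable (\<lambda>n. \<bar>f n + g n\<bar>)" "summable (\<lambda>n. \<bar>f n - g n\<bar>)"
  by (rule summable_comparison_test'[OF summable_add[OF assms], of 0]; simp)+

instantiation l1 :: real_normed_vector
begin

lift_definition zero_l1 :: l1 is "\<lambda>_. 0" by simp
lift_definition plus_l1 :: "l1 \<Rightarrow> l1 \<Rightarrow> l1" is "\<lambda>x y n. x n + y n"
  by (rule summable_abs_comb(1))
lift_definition minus_l1 :: "l1 \<Rightarrow> l1 \<Rightarrow> l1" is "\<lambda>x y n. x n - y n"
  by (rule summable_abs_comb(2))
lift_definition uminus_l1 :: "l1 \<Rightarrow> l1" is "\<lambda>x n. - x n" by simp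
lift_definition scaleR_l1 :: "real \<Rightarrow> l1 \<Rightarrow> l1" is "\<lambda>c x n. c * x n"
  by (simp add: abs_mult summable_mult)
lift_definition norm_l1 :: "l1 \<Rightarrow> real" is "\<lambda>x. \<Sum>n. \<bar>x n\<bar>" .

definition dist_l1 :: "l1 \<Rightarrow> l1 \<Rightarrow> real" where "dist_l1 x y = norm (x - y)"
definition sgn_l1 :: "l1 \<Rightarrow> l1" where "sgn_l1 x = scaleR (inverse (norm x)) x"
definition uniformity_l1 :: "(l1 \<times> l1) filter" where
  "uniformity_l1 = (INF e\<in>{0 <..}. principal {(x, y). dist x y < e})"
definition open_l1 :: "l1 set \<Rightarrow> bool" where
  "open_l1 U \<longleftrightarrow> (\<forall>x\<in>U. eventually (\<lambda>(x', y). x' = x \<longrightarrow> y \<in> U) uniformity)"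

lemma coord_simps [simp]:
  "coord 0 i = 0" "coord (x + y) i = coord x i + coord y i" "coord (x - y) i = coord x i - coord y i"
  "coord (- x) i = - coord x i" "coord (c *\<^sub>R x) i = c * coord x i"
  by (transfer, simp)+

instance
proof
  fix x y :: l1 and a b :: real
  show "norm x = 0 \<longleftrightarrow> x = 0"
    by transfer (auto simp: suminf_eq_zero_iff)
  show "norm (x + y) \<le> norm x + norm y"
  proof transfer
    fix x y :: "nat \<Rightarrow> real"
    assume s: "summable (\<lambda>n. \<bar>x n\<bar>)" "summable (\<lambda>n. \<bar>y n\<bar>)"
    have "(\<Sum>n. \<bar>x n + y n\<bar>) \<le> (\<Sum>n. \<bar>x n\<bar> + \<bar>y n\<bar>)"
      by (intro suminf_le summable_add s summable_comparison_test'[OF summable_add[OF s], of 0]) auto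
    then show "(\<Sum>n. \<bar>x n + y n\<bar>) \<le> (\<Sum>n. \<bar>x n\<bar>) + (\<Sum>n. \<bar>y n\<bar>)"
      by (simp add: suminf_add[OF s])
  qed
  show "norm (a *\<^sub>R x) = \<bar>a\<bar> * norm x"
    by transfer (simp add: abs_mult suminf_mult)
qed (simp_all add: dist_l1_def sgn_l1_def uniformity_l1_def open_l1_def,
     (rule l1_eqI, simp add: coord_simps algebra_simps)+)

end

lemma norm_l1_eq: "norm x = (\<Sum>n. \<bar>coord x n\<bar>)"
  by transfer simp

lemma sum_coord_le_norm: "finite I \<Longrightarrow> (\<Sum>i\<in>I. \<bar>coord x i\<bar>) \<le> norm x"
  unfolding norm_l1_eq by (rule sum_le_suminf[OF summable_coord]) auto

lemma coord_le_norm: "\<bar>coord x i\<bar> \<le> norm x"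
  using sum_coord_le_norm[of "{i}" x] by simp

lemma norm_l1_leI:
  assumes "\<And>m. (\<Sum>i<m. \<bar>coord x i\<bar>) \<le> B"
  shows "norm x \<le> B"
  unfolding norm_l1_eq by (rule suminf_le_const[OF summable_coord assms])

lemma summable_abs_bounded:
  fixes f :: "nat \<Rightarrow> real"
  assumes "\<And>m. (\<Sum>i<m. \<bar>f i\<bar>) \<le> B"
  shows "summable (\<lambda>i. \<bar>f i\<bar>)"
  by (rule bounded_imp_summable[where B=B]) (use assms[of "Suc _"] in \<open>auto simp: lessThan_Suc_atMost\<close>)

text \<open>Partial sums of the norm involve only finitely many coordinates, so bounds pass to
  coordinatewise limits.\<close>

lemma coordinatewise_limit_in_ball:
  assumes lim: "\<And>i. (\<lambda>n. coord (xs n) i) \<longlonglongrightarrow> f i"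
    and bnd: "\<forall>\<^sub>F n in sequentially. norm (xs n - z) \<le> B"
  obtains x where "coord x = f" "norm (x - z) \<le> B"
proof -
  have part: "(\<Sum>i<m. \<bar>f i - coord z i\<bar>) \<le> B" for m
  proof (rule tendsto_upperbound)
    show "(\<lambda>n. \<Sum>i<m. \<bar>coord (xs n) i - coord z i\<bar>) \<longlonglongrightarrow> (\<Sum>i<m. \<bar>f i - coord z i\<bar>)"
      by (intro tendsto_sum tendsto_rabs tendsto_diff lim tendsto_const)
    show "\<forall>\<^sub>F n in sequentially. (\<Sum>i<m. \<bar>coord (xs n) i - coord z i\<bar>) \<le> B"
      using bnd
    proof eventually_elim
      case (elim n)
      then show ?case using sum_coord_le_norm[of "{..<m}" "xs n - z"] by simp
    qed
  qed simp
  define y where "y = Abs_l1 (\<lambda>i. f i - coord z i)"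
  have y: "coord y = (\<lambda>i. f i - coord z i)"
    unfolding y_def by (intro coord_Abs_l1 summable_abs_bounded[OF part])
  show thesis
  proof
    show "coord (y + z) = f" by (simp add: fun_eq_iff y)
    show "norm (y + z - z) \<le> B"
      by (rule norm_l1_leI) (use part in \<open>simp add: y\<close>)
  qed
qed

instance l1 :: banach
proof
  fix X :: "nat \<Rightarrow> l1" assume X: "Cauchy X"
  have "Cauchy (\<lambda>n. coord (X n) i)" for i
  proof (rule metric_CauchyI)
    fix e :: real assume "0 < e"
    then obtain M where M: "\<forall>m\<ge>M. \<forall>n\<ge>M. dist (X m) (X n) < e"
      using X unfolding Cauchy_def by blast
    show "\<exists>M. \<forall>m\<ge>M. \<forall>n\<ge>M. dist (coord (X m) i) (coord (X n) i) < e"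
    proof (intro exI[of _ M] allI impI)
      fix m n assume "M \<le> m" "M \<le> n"
      then show "dist (coord (X m) i) (coord (X n) i) < e"
        using M coord_le_norm[of "X m - X n" i] by (force simp: dist_norm)
    qed
  qed
  then obtain f where f: "\<And>i. (\<lambda>n. coord (X n) i) \<longlonglongrightarrow> f i"
    unfolding Cauchy_convergent_iff convergent_def by metis
  have *: "\<exists>x. coord x = f \<and> (\<forall>n\<ge>M. norm (x - X n) \<le> e)"
    if M: "\<forall>m\<ge>M. \<forall>n\<ge>M. dist (X m) (X n) < e" for M e
  proof -
    have "\<exists>x. coord x = f \<and> norm (x - X n) \<le> e" if "n \<ge> M" for n
    proof (rule coordinatewise_limit_in_ball[OF f])
      show "\<forall>\<^sub>F m in sequentially. norm (X m - X n) \<le> e"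
        using eventually_ge_at_top[of M] by eventually_elim (use M that in \<open>force simp: dist_norm\<close>)
    qed blast
    then show ?thesis by (metis coord_inject order_refl)
  qed
  obtain x where x: "coord x = f"
    using *[of _ 1] X unfolding Cauchy_def by (metis zero_less_one)
  have "X \<longlonglongrightarrow> x"
  proof (rule metric_LIMSEQ_I)
    fix e :: real assume "0 < e"
    then obtain M where M: "\<forall>m\<ge>M. \<forall>n\<ge>M. dist (X m) (X n) < e/2"
      using X unfolding Cauchy_def by (metis half_gt_zero)
    obtain x' where x': "coord x' = f" "\<forall>n\<ge>M. norm (x' - X n) \<le> e/2" using *[OF M] by blast
    have "x' = x" using x x' by (metis coord_inject)
    then show "\<exists>no. \<forall>n\<ge>no. dist (X n) x < e"
      using x' \<open>0 < e\<close> by (intro exI[of _ M]) (auto simp: dist_norm norm_minus_commute intro: le_less_trans)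
  qed
  then show "convergent X" by (auto simp: convergent_def)
qed

subsection \<open>Heads and tails\<close>

lift_definition tail :: "nat \<Rightarrow> l1 \<Rightarrow> l1" is "\<lambda>k x n. if k \<le> n then x n else 0"
  by (rule summable_comparison_test') auto

lift_definition head :: "nat \<Rightarrow> l1 \<Rightarrow> l1" is "\<lambda>k x n. if n < k then x n else 0"
  by (rule summable_comparison_test') auto

lemma coord_tail [simp]: "coord (tail k x) i = (if k \<le> i then coord x i else 0)"
  by transfer simp

lemma coord_head [simp]: "coord (head k x) i = (if i < k then coord x i else 0)"
  by transfer simp

lemma tail_linear: "tail k (x + y) = tail k x + tail k y" "tail k (x - y) = tail k x - tail k y"
  "tail k (c *\<^sub>R x) = c *\<^sub>R tail k x"
  by (rule l1_eqI; simp)+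

lemma tail_0 [simp]: "tail 0 x = x" 
  by (rule l1_eqI) auto

lemma norm_l1_mono: "(\<And>i. \<bar>coord x i\<bar> \<le> \<bar>coord y i\<bar>) \<Longrightarrow> norm x \<le> norm y"
  unfolding norm_l1_eq by (rule suminf_le[OF _ summable_coord summable_coord])

lemma norm_tail_le: "norm (tail k x) \<le> norm x"
  by (rule norm_l1_mono) auto

lemma norm_head_le: "norm (head k x) \<le> norm x"
  by (rule norm_l1_mono) auto

lemma norm_head: "norm (head k x) = (\<Sum>i<k. \<bar>coord x i\<bar>)"
proof -
  have "norm (head k x) = (\<Sum>n. if n \<in> {..<k} then \<bar>coord x n\<bar> else 0)"
    unfolding norm_l1_eq by (intro arg_cong[where f=suminf] ext) auto
  also have "\<dots> = (\<Sum>i<k. \<bar>coord x i\<bar>)"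
    by (rule sums_unique[symmetric], rule sums_If_finite_set) simp
  finally show ?thesis .
qed

lemma norm_head_tail: "norm x = norm (head k x) + norm (tail k x)"
proof -
  have "norm (head k x) + norm (tail k x) = (\<Sum>n. \<bar>coord (head k x) n\<bar> + \<bar>coord (tail k x) n\<bar>)"
    unfolding norm_l1_eq by (rule suminf_add[OF summable_coord summable_coord])
  also have "\<dots> = norm x" unfolding norm_l1_eq by (intro arg_cong[where f=suminf] ext) auto
  finally show ?thesis ..
qed

lemma tail_tendsto_0: "(\<lambda>k. norm (tail k x)) \<longlonglongrightarrow> 0"
proof -
  have "(\<lambda>k. norm x - norm (head k x)) \<longlonglongrightarrow> norm x - norm x"
    unfolding norm_head by (intro tendsto_diff tendsto_const)
      (use summable_LIMSEQ[OF summable_coord, of x] in \<open>simp add: norm_l1_eq\<close>)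
  moreover have "norm x - norm (head k x) = norm (tail k x)" for k
    using norm_head_tail[of x k] by simp
  ultimately show ?thesis by simp
qed

lemma head_tendsto_0:
  assumes "\<And>i. (\<lambda>n. coord (u n) i) \<longlonglongrightarrow> 0"
  shows "(\<lambda>n. norm (head k (u n))) \<longlonglongrightarrow> 0"
  unfolding norm_head using tendsto_sum[of "{..<k}" "\<lambda>i n. \<bar>coord (u n) i\<bar>" "\<lambda>_. 0"] assms
  by (simp add: tendsto_rabs_zero)

text \<open>The sequential form of the weak-star compactness of balls, with \<open>l1\<close> as the dual of \<open>c\<^sub>0\<close>.\<close>

lemma bounded_l1_subsequence:
  assumes "\<And>n. norm (xs n) \<le> B"
  obtains x r where "strict_mono (r::nat \<Rightarrow> nat)" "\<And>i. (\<lambda>n. coord (xs (r n)) i) \<longlonglongrightarrow> coord x i"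
proof -
  have "compactin (product_topology (\<lambda>i::nat. euclidean) UNIV) (PiE UNIV (\<lambda>i. {-B..B}))"
    by (subst compactin_PiE) auto
  then have "compact (PiE UNIV (\<lambda>i::nat. {-B..B}))"
    by (simp add: euclidean_product_topology)
  then have "seq_compact (PiE UNIV (\<lambda>i::nat. {-B..B}))"
    using compact_eq_seq_compact_metric by blast
  moreover have "\<forall>n. coord (xs n) \<in> PiE UNIV (\<lambda>i::nat. {-B..B})"
    using coord_le_norm assms by (auto simp: abs_le_iff) (smt (verit))+
  ultimately obtain f r where r: "strict_mono (r::nat \<Rightarrow> nat)" and f: "((\<lambda>n. coord (xs n)) \<circ> r) \<longlonglongrightarrow> f"
    unfolding seq_compact_def by metis
  have *: "(\<lambda>n. coord (xs (r n)) i) \<longlonglongrightarrow> f i" for i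
    using continuous_on_tendsto_compose[OF _ f, of UNIV "\<lambda>g. g i"]
    by (simp add: o_def continuous_on_product_then_coordinatewise continuous_on_id)
  obtain x where "coord x = f"
    by (rule coordinatewise_limit_in_ball[OF *, of 0 B]) (use assms in auto)
  with r * that show thesis by blast
qed

text \<open>Coordinatewise null sequences are asymptotically disjoint from every fixed vector, so the
  norms add up in the limit.\<close>

lemma norm_add_coordinatewise_null:
  assumes u: "\<And>i. (\<lambda>n. coord (u n) i) \<longlonglongrightarrow> 0" and r: "(\<lambda>n. norm (u n)) \<longlonglongrightarrow> r" and e: "0 < e"
  shows "\<forall>\<^sub>F n in sequentially. r + norm (tail k v) - e \<le> norm (tail k (u n + v))"
proof -
  have "\<forall>\<^sub>F j in sequentially. norm (tail j v) < e/8 \<and> j \<ge> k"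
    by (intro eventually_conj order_tendstoD(2)[OF tail_tendsto_0] eventually_ge_at_top) (use e in auto)
  then obtain j where j: "norm (tail j v) < e/8" "j \<ge> k"
    by (metis (lifting) eventually_happens trivial_limit_sequentially)
  have "\<forall>\<^sub>F n in sequentially. norm (head j (u n)) < e/8"
    by (rule order_tendstoD(2)[OF head_tendsto_0[OF u]]) (use e in auto)
  moreover have "\<forall>\<^sub>F n in sequentially. r - e/2 < norm (u n)"
    by (rule order_tendstoD(1)[OF r]) (use e in auto)
  ultimately show ?thesis
  proof eventually_elim
    case (elim n)
    let ?w = "tail k (u n + v)"
    have "norm (u n) \<le> norm (head j (u n)) + norm (tail j (u n))"
      using norm_head_tail[of "u n" j] by simp
    moreover have "norm (tail j (u n)) - norm (tail j v) \<le> norm (tail j ?w)"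
    proof -
      have "tail j ?w = tail j (u n) - (- tail j v)" by (rule l1_eqI) (use j in auto)
      then show ?thesis using norm_triangle_ineq2[of "tail j (u n)" "- tail j v"] by simp
    qed
    moreover have "norm (head j (tail k v)) - norm (head j (u n)) \<le> norm (head j ?w)"
    proof -
      have "head j ?w = head j (tail k v) - (- head j (tail k (u n)))" by (rule l1_eqI) auto
      moreover have "norm (head j (tail k (u n))) \<le> norm (head j (u n))" by (rule norm_l1_mono) auto
      ultimately show ?thesis
        using norm_triangle_ineq2[of "head j (tail k v)" "- head j (tail k (u n))"] by simp
    qed
    moreover have "norm (tail k v) \<le> norm (head j (tail k v)) + norm (tail j v)"
      using norm_head_tail[of "tail k v" j] norm_l1_mono[of "tail j (tail k v)" "tail j v"] by force
    moreover have "norm ?w = norm (head j ?w) + norm (tail j ?w)" by (rule norm_head_tail)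
    ultimately show ?case using elim j by linarith
  qed
qed

section \<open>A fixed point theorem for renormings of \<open>l1\<close>\<close>

text \<open>The assumption \<open>flat\<close> says that \<open>N (w + t z) \<le> a + o(t)\<close> for \<open>w\<close> far out of length at most \<open>a\<close>
  and \<open>z\<close> in the first \<open>k\<close> coordinates, uniformly over bounded \<open>z\<close> and over \<open>a\<close> bounded away from 0. The
  usual norm of \<open>l1\<close> lacks this property; it satisfies the other assumptions, but fails the fixed
  point property.\<close>

locale l1_renorming =
  fixes N :: "l1 \<Rightarrow> real" and \<tau> :: "nat \<Rightarrow> real"
  assumes N_triangle: "N (x + y) \<le> N x + N y"
    and N_scaleR: "N (c *\<^sub>R x) = \<bar>c\<bar> * N x"
    and N_le_norm: "N x \<le> norm x"
    and N_tail_le: "N (tail k x) \<le> N x"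
    and norm_tail_le_N: "norm (tail k x) \<le> (1 + \<tau> k) * N (tail k x)"
    and \<tau>_nonneg: "0 \<le> \<tau> k"
    and \<tau>_lim: "\<tau> \<longlonglongrightarrow> 0"
    and flat: "\<lbrakk>0 < c; 0 < \<theta>\<rbrakk> \<Longrightarrow> \<exists>t>0. t \<le> 1 \<and> (\<forall>w z a. c \<le> a \<longrightarrow> norm (tail k w) \<le> a \<longrightarrow>
      norm (head k z) \<le> B \<longrightarrow> N (tail k w + t *\<^sub>R head k z) \<le> a + \<theta> * t)"
begin

lemma norm_le_N: "norm x \<le> (1 + \<tau> 0) * N x"
  using norm_tail_le_N[of 0 x] by simp

lemma N_nonneg: "0 \<le> N x"
proof -
  have "0 \<le> (1 + \<tau> 0) * N x" using norm_le_N[of x] norm_ge_zero[of x] by linarith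
  then show ?thesis using \<tau>_nonneg[of 0] by (simp add: zero_le_mult_iff)
qed

lemma N_uminus: "N (- x) = N x"
  using N_scaleR[of "-1" x] by simp

lemma N_minus_commute: "N (x - y) = N (y - x)"
  using N_uminus[of "x - y"] by simp

lemma N_diff_triangle: "N (x - z) \<le> N (x - y) + N (y - z)"
  using N_triangle[of "x - y" "y - z"] by simp

lemma N_eq_0: "N x = 0 \<Longrightarrow> x = 0"
  using norm_le_N[of x] by simp

definition invariant :: "(l1 \<Rightarrow> l1) \<Rightarrow> l1 set \<Rightarrow> bool" where
  "invariant T K \<longleftrightarrow> K \<noteq> {} \<and> closed K \<and> convex K \<and> bounded K \<and> T \<in> K \<rightarrow> K \<and>
    (\<forall>x\<in>K. \<forall>y\<in>K. N (T x - T y) \<le> N (x - y))"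

text \<open>Coordinatewise convergence with limit \<open>x\<close> and convergence of the distances to the radius \<open>r\<close> are part
  of the notion because every approximate fixed point sequence in a bounded set has a subsequence
  with both.\<close>

definition approx_fixed :: "(l1 \<Rightarrow> l1) \<Rightarrow> l1 set \<Rightarrow> (nat \<Rightarrow> l1) \<Rightarrow> l1 \<Rightarrow> real \<Rightarrow> bool" where
  "approx_fixed T K xs x r \<longleftrightarrow> (\<forall>n. xs n \<in> K) \<and> (\<lambda>n. N (T (xs n) - xs n)) \<longlonglongrightarrow> 0 \<and>
    (\<forall>i. (\<lambda>n. coord (xs n) i) \<longlonglongrightarrow> coord x i) \<and> (\<lambda>n. norm (xs n - x)) \<longlonglongrightarrow> r"

lemma approx_fixed_mono: "approx_fixed T K xs x r \<Longrightarrow> K \<subseteq> K' \<Longrightarrow> approx_fixed T K' xs x r"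
  unfolding approx_fixed_def by blast

lemma approx_fixed_nonneg: "approx_fixed T K xs x r \<Longrightarrow> 0 \<le> r"
  unfolding approx_fixed_def by (metis LIMSEQ_le_const norm_ge_zero)

text \<open>Averaging \<open>T\<close> with a constant map gives a contraction, whose iterates are almost fixed by the
  contraction and hence almost fixed by \<open>T\<close>.\<close>

lemma approx_fixed_points_exist:
  assumes "invariant T K" and "0 < e"
  obtains y where "y \<in> K" "N (T y - y) \<le> e"
proof -
  have K: "K \<noteq> {}" "convex K" "bounded K" "\<And>x. x \<in> K \<Longrightarrow> T x \<in> K"
    "\<And>x y. x \<in> K \<Longrightarrow> y \<in> K \<Longrightarrow> N (T x - T y) \<le> N (x - y)"
    using assms by (auto simp: invariant_def)
  obtain B where B: "\<And>x. x \<in> K \<Longrightarrow> norm x \<le> B" and B0: "0 < B"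
    using \<open>bounded K\<close> unfolding bounded_pos by blast
  have diam: "N (x - y) \<le> 2 * B" if "x \<in> K" "y \<in> K" for x y
    using N_le_norm[of "x - y"] norm_triangle_ineq4[of x y] B[OF that(1)] B[OF that(2)] by linarith
  obtain x0 where x0: "x0 \<in> K" using K by blast
  define s where "s = min (1/2) (e / (4 * B))"
  have s: "0 < s" "s < 1" "s * (2 * B) \<le> e / 2"
    using \<open>0 < e\<close> B0 by (auto simp: s_def min_def field_simps)
  define S where "S x = (1 - s) *\<^sub>R T x + s *\<^sub>R x0" for x
  have SK: "S x \<in> K" if "x \<in> K" for x
    unfolding S_def using K(2) K(4)[OF that] x0 s by (intro convexD) auto
  have S_contr: "N (S x - S y) \<le> (1 - s) * N (x - y)" if "x \<in> K" "y \<in> K" for x y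
  proof -
    have "S x - S y = (1 - s) *\<^sub>R (T x - T y)" by (simp add: S_def algebra_simps)
    then show ?thesis using N_scaleR s K(5)[OF that] by (simp add: mult_left_mono)
  qed
  have it: "(S ^^ n) x0 \<in> K" for n by (induction n) (use x0 SK in auto)
  have dec: "N ((S ^^ Suc n) x0 - (S ^^ n) x0) \<le> (1 - s) ^ n * (2 * B)" for n
  proof (induction n)
    case 0
    then show ?case using diam[OF SK[OF x0] x0] by simp
  next
    case (Suc n)
    have "N ((S ^^ Suc (Suc n)) x0 - (S ^^ Suc n) x0) \<le> (1 - s) * N ((S ^^ Suc n) x0 - (S ^^ n) x0)"
      using S_contr[OF it[of "Suc n"] it[of n]] by simp
    also have "\<dots> \<le> (1 - s) * ((1 - s) ^ n * (2 * B))" using Suc s by (intro mult_left_mono) auto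
    finally show ?case by (simp add: mult.assoc)
  qed
  have "(\<lambda>n. (1 - s) ^ n * (2 * B)) \<longlonglongrightarrow> 0 * (2 * B)"
    by (intro tendsto_mult tendsto_const LIMSEQ_realpow_zero) (use s in auto)
  then have "\<forall>\<^sub>F n in sequentially. (1 - s) ^ n * (2 * B) < e / 2"
    using \<open>0 < e\<close> by (intro order_tendstoD(2)) auto
  then obtain n where n: "(1 - s) ^ n * (2 * B) < e / 2"
    by (metis (lifting) eventually_happens trivial_limit_sequentially)
  define y where "y = (S ^^ n) x0"
  have "y \<in> K" using it by (simp add: y_def)
  have "T y - S y = s *\<^sub>R (T y - x0)" by (simp add: S_def algebra_simps)
  then have "N (T y - S y) \<le> s * (2 * B)"
    using N_scaleR s diam[OF K(4)[OF \<open>y \<in> K\<close>] x0] by (simp add: mult_left_mono)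
  moreover have "N (S y - y) \<le> e / 2" using dec[of n] n by (simp add: y_def)
  ultimately have "N (T y - y) \<le> e" using N_diff_triangle[of "T y" y "S y"] s by linarith
  with \<open>y \<in> K\<close> show thesis using that by blast
qed

lemma approx_fixed_exists:
  assumes "invariant T K"
  shows "\<exists>xs x r. approx_fixed T K xs x r"
proof -
  have "\<exists>y\<in>K. N (T y - y) \<le> inverse (real (Suc n))" for n
    using approx_fixed_points_exist[OF assms, of "inverse (real (Suc n))"] by auto
  then obtain ys where ys: "\<And>n. ys n \<in> K" "\<And>n. N (T (ys n) - ys n) \<le> inverse (real (Suc n))"
    by metis
  have lim0: "(\<lambda>n. N (T (ys n) - ys n)) \<longlonglongrightarrow> 0"
    by (rule tendsto_sandwich[OF _ _ tendsto_const LIMSEQ_inverse_real_of_nat]) (use ys N_nonneg in auto)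
  obtain B where B: "\<And>x. x \<in> K \<Longrightarrow> norm x \<le> B" using assms unfolding invariant_def bounded_iff by blast
  obtain x r where r: "strict_mono (r::nat \<Rightarrow> nat)" "\<And>i. (\<lambda>n. coord (ys (r n)) i) \<longlonglongrightarrow> coord x i"
    using bounded_l1_subsequence[of ys B] B[OF ys(1)] by blast
  have "bounded (range (\<lambda>n. norm (ys (r n) - x)))"
    unfolding bounded_iff using B[OF ys(1)]
    by (intro exI[of _ "B + norm x"]) (auto intro: order_trans[OF norm_triangle_ineq4])
  then obtain l q where q: "strict_mono (q::nat \<Rightarrow> nat)" "((\<lambda>n. norm (ys (r n) - x)) \<circ> q) \<longlonglongrightarrow> l"
    using bounded_imp_convergent_subsequence by blast
  have "approx_fixed T K (ys \<circ> (r \<circ> q)) x l"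
    unfolding approx_fixed_def
    using ys(1) q(2) LIMSEQ_subseq_LIMSEQ[OF lim0 strict_mono_o[OF r(1) q(1)]]
      LIMSEQ_subseq_LIMSEQ[OF r(2) q(1)] by (auto simp: o_def)
  then show ?thesis by blast
qed

definition asym_ball :: "l1 set \<Rightarrow> (nat \<Rightarrow> l1) \<Rightarrow> real \<Rightarrow> l1 set" where
  "asym_ball K xs d = {z \<in> K. \<forall>e>0. \<forall>\<^sub>F n in sequentially. N (xs n - z) \<le> d + e}"

text \<open>A nonexpansive map does not increase the asymptotic distance to an approximate fixed point
  sequence.\<close>

lemma asym_ball_invariant:
  assumes inv: "invariant T K" and af: "approx_fixed T K xs x r" and ne: "asym_ball K xs d \<noteq> {}"
  shows "invariant T (asym_ball K xs d)"
  unfolding invariant_def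
proof (intro conjI ballI)
  have K: "closed K" "convex K" "bounded K" "\<And>x. x \<in> K \<Longrightarrow> T x \<in> K"
    "\<And>x y. x \<in> K \<Longrightarrow> y \<in> K \<Longrightarrow> N (T x - T y) \<le> N (x - y)"
    using inv by (auto simp: invariant_def)
  have xs: "\<And>n. xs n \<in> K" "(\<lambda>n. N (T (xs n) - xs n)) \<longlonglongrightarrow> 0"
    using af by (auto simp: approx_fixed_def)
  let ?D = "asym_ball K xs d"
  show "?D \<noteq> {}" by fact
  show "closed ?D"
    unfolding closed_sequential_limits
  proof (intro allI impI, elim conjE)
    fix zs z assume zs: "\<forall>n. zs n \<in> ?D" and lim: "zs \<longlonglongrightarrow> z"
    have "z \<in> K" using K(1) zs lim unfolding closed_sequential_limits asym_ball_def by blast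
    moreover have "\<forall>\<^sub>F n in sequentially. N (xs n - z) \<le> d + e" if "0 < e" for e
    proof -
      obtain j where j: "norm (zs j - z) < e/2"
        using LIMSEQ_D[OF lim, of "e/2"] \<open>0 < e\<close> by auto
      have "\<forall>\<^sub>F n in sequentially. N (xs n - zs j) \<le> d + e/2"
        using zs \<open>0 < e\<close> by (auto simp: asym_ball_def)
      then show ?thesis
      proof eventually_elim
        case (elim n)
        then show ?case using N_diff_triangle[of "xs n" z "zs j"] N_le_norm[of "zs j - z"] j by linarith
      qed
    qed
    ultimately show "z \<in> ?D" by (simp add: asym_ball_def)
  qed
  show "convex ?D"
  proof (rule convexI)
    fix z z' u v assume z: "z \<in> ?D" "z' \<in> ?D" and uv: "(0::real) \<le> u" "0 \<le> v" "u + v = 1"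
    have "u *\<^sub>R z + v *\<^sub>R z' \<in> K"
      using z uv K(2) by (auto simp: asym_ball_def convex_def)
    moreover have "\<forall>\<^sub>F n in sequentially. N (xs n - (u *\<^sub>R z + v *\<^sub>R z')) \<le> d + e" if "0 < e" for e
    proof -
      have "\<forall>\<^sub>F n in sequentially. N (xs n - z) \<le> d + e" "\<forall>\<^sub>F n in sequentially. N (xs n - z') \<le> d + e"
        using z that by (auto simp: asym_ball_def)
      then show ?thesis
      proof eventually_elim
        case (elim n)
        have "xs n = u *\<^sub>R xs n + v *\<^sub>R xs n" using uv(3) by (metis scaleR_left.add scaleR_one)
        then have "xs n - (u *\<^sub>R z + v *\<^sub>R z') = u *\<^sub>R (xs n - z) + v *\<^sub>R (xs n - z')"
          by (simp add: algebra_simps)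
        then have "N (xs n - (u *\<^sub>R z + v *\<^sub>R z')) \<le> u * N (xs n - z) + v * N (xs n - z')"
          using N_triangle[of "u *\<^sub>R (xs n - z)" "v *\<^sub>R (xs n - z')"] uv by (simp add: N_scaleR)
        also have "\<dots> \<le> u * (d + e) + v * (d + e)"
          using elim uv by (intro add_mono mult_left_mono) auto
        also have "\<dots> = d + e" using uv(3) by (metis distrib_right mult_1)
        finally show ?case .
      qed
    qed
    ultimately show "u *\<^sub>R z + v *\<^sub>R z' \<in> ?D" by (simp add: asym_ball_def)
  qed
  show "bounded ?D" using K(3) by (rule bounded_subset) (auto simp: asym_ball_def)
  show "T \<in> ?D \<rightarrow> ?D"
  proof
    fix z assume z: "z \<in> ?D"
    then have zK: "z \<in> K" by (simp add: asym_ball_def)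
    have "\<forall>\<^sub>F n in sequentially. N (xs n - T z) \<le> d + e" if "0 < e" for e
    proof -
      have "\<forall>\<^sub>F n in sequentially. N (xs n - z) \<le> d + e/2" using z that by (auto simp: asym_ball_def)
      moreover have "\<forall>\<^sub>F n in sequentially. N (T (xs n) - xs n) < e/2"
        by (rule order_tendstoD(2)[OF xs(2)]) (use that in auto)
      ultimately show ?thesis
      proof eventually_elim
        case (elim n)
        then show ?case using N_diff_triangle[of "xs n" "T z" "T (xs n)"] K(5)[OF xs(1)[of n] zK]
            N_minus_commute[of "xs n" "T (xs n)"] by linarith
      qed
    qed
    then show "T z \<in> ?D" using K(4)[OF zK] by (simp add: asym_ball_def)
  qed
  show "N (T z - T y) \<le> N (z - y)" if "z \<in> ?D" "y \<in> ?D" for z y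
    using that K(5) by (auto simp: asym_ball_def)
qed

lemma asym_ball_contains_tail:
  assumes af: "approx_fixed T K xs x r" and d: "2 * r < d"
  shows "asym_ball K xs d \<noteq> {}"
proof -
  have ev: "\<forall>\<^sub>F n in sequentially. norm (xs n - x) < d/2"
    using af d by (intro order_tendstoD(2)[where y = r]) (auto simp: approx_fixed_def)
  then obtain m where m: "norm (xs m - x) < d/2"
    by (metis (lifting) eventually_happens trivial_limit_sequentially)
  have "\<forall>\<^sub>F n in sequentially. N (xs n - xs m) \<le> d + e" if "0 < e" for e
    using ev
  proof eventually_elim
    case (elim n)
    then show ?case using m N_le_norm[of "xs n - xs m"] norm_triangle_ineq4[of "xs n - x" "xs m - x"] that
      by simp
  qed
  then have "xs m \<in> asym_ball K xs d" using af by (simp add: asym_ball_def approx_fixed_def)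
  then show ?thesis by blast
qed

text \<open>This is the additivity of radii. A tail beyond \<open>k\<close> is compared with its \<open>l1\<close> length, and
  \<open>norm_add_coordinatewise_null\<close> is applied once along each of the two sequences. The case of a
  general \<open>k\<close> also controls how far apart the coordinatewise limits are, beyond \<open>k\<close>.\<close>

lemma asym_ball_radii:
  assumes xs: "approx_fixed T K xs x r" and ys: "approx_fixed T (asym_ball K' xs d) ys y s"
  shows "r + s + norm (tail k (x - y)) \<le> (1 + \<tau> k) * d"
proof (rule field_le_epsilon)
  fix e0 :: real assume "0 < e0"
  define e where "e = e0 / (3 + \<tau> k)"
  have t: "0 < 3 + \<tau> k" using \<tau>_nonneg[of k] by linarith
  have e: "0 < e" using \<open>0 < e0\<close> t by (simp add: e_def)
  have "(1 + \<tau> k) * e + 2 * e = (3 + \<tau> k) * e" by (simp add: algebra_simps)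
  then have e0: "(1 + \<tau> k) * e + 2 * e = e0" using t by (simp add: e_def)
  have low: "r + norm (tail k (x - ys m)) - e \<le> (1 + \<tau> k) * (d + e)" for m
  proof -
    have "\<forall>\<^sub>F n in sequentially. r + norm (tail k (x - ys m)) - e \<le> norm (tail k ((xs n - x) + (x - ys m)))"
    proof (rule norm_add_coordinatewise_null)
      show "(\<lambda>n. coord (xs n - x) i) \<longlonglongrightarrow> 0" for i
        using xs by (auto simp: approx_fixed_def intro!: LIM_zero)
    qed (use xs e in \<open>auto simp: approx_fixed_def\<close>)
    moreover have "\<forall>\<^sub>F n in sequentially. N (xs n - ys m) \<le> d + e"
      using ys e by (auto simp: approx_fixed_def asym_ball_def)
    ultimately have "\<forall>\<^sub>F n in sequentially. r + norm (tail k (x - ys m)) - e \<le> (1 + \<tau> k) * (d + e)"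
    proof eventually_elim
      case (elim n)
      have "norm (tail k (xs n - ys m)) \<le> (1 + \<tau> k) * N (tail k (xs n - ys m))"
        by (rule norm_tail_le_N)
      also have "\<dots> \<le> (1 + \<tau> k) * (d + e)"
        using N_tail_le[of k "xs n - ys m"] elim(2) \<tau>_nonneg[of k] by (intro mult_left_mono) auto
      finally show ?case using elim(1) by simp
    qed
    then show ?thesis by simp
  qed
  have "\<forall>\<^sub>F m in sequentially. s + norm (tail k (x - y)) - e \<le> norm (tail k ((y - ys m) + (x - y)))"
  proof (rule norm_add_coordinatewise_null)
    show "(\<lambda>n. coord (y - ys n) i) \<longlonglongrightarrow> 0" for i
      using ys by (auto simp: approx_fixed_def intro!: tendsto_eq_intros)
  qed (use ys e in \<open>auto simp: approx_fixed_def norm_minus_commute\<close>)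
  then obtain m where "s + norm (tail k (x - y)) - e \<le> norm (tail k ((y - ys m) + (x - y)))"
    by (metis (lifting) eventually_happens trivial_limit_sequentially)
  with low[of m] have "r + s + norm (tail k (x - y)) \<le> (1 + \<tau> k) * (d + e) + 2 * e" by simp
  also have "\<dots> = (1 + \<tau> k) * d + e0" using e0 by (simp add: algebra_simps)
  finally show "r + s + norm (tail k (x - y)) \<le> (1 + \<tau> k) * d + e0" .
qed

lemma asym_ball_radii_limit:
  assumes xs: "approx_fixed T K xs x r" and ys: "approx_fixed T (asym_ball K' xs d) ys y s"
  shows "r + s \<le> d"
proof (rule LIMSEQ_le_const)
  have "(\<lambda>k. (1 + \<tau> k) * d) \<longlonglongrightarrow> (1 + 0) * d" by (intro tendsto_intros \<tau>_lim)
  then show "(\<lambda>k. (1 + \<tau> k) * d) \<longlonglongrightarrow> d" by simp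
  show "\<exists>M. \<forall>n\<ge>M. r + s \<le> (1 + \<tau> n) * d"
    using asym_ball_radii[OF xs ys] norm_ge_zero by (meson add_increasing2 order_refl order_trans)
qed

definition radius :: "(l1 \<Rightarrow> l1) \<Rightarrow> l1 set \<Rightarrow> real" where
  "radius T K = Inf {r. \<exists>xs x. approx_fixed T K xs x r}"

lemma radius_le: "approx_fixed T K xs x r \<Longrightarrow> radius T K \<le> r"
  unfolding radius_def by (rule cInf_lower) (auto intro!: bdd_belowI[of _ 0] dest: approx_fixed_nonneg)

lemma radius_approx:
  assumes "invariant T K" and "radius T K < e"
  obtains xs x r where "approx_fixed T K xs x r" "r < e"
proof -
  have "{r. \<exists>xs x. approx_fixed T K xs x r} \<noteq> {}" using approx_fixed_exists[OF assms(1)] by blast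
  from cInf_lessD[OF this] assms(2) show thesis unfolding radius_def using that by blast
qed

lemma radius_antimono:
  assumes "invariant T K" "K \<subseteq> K'"
  shows "radius T K' \<le> radius T K"
proof (rule ccontr)
  assume "\<not> radius T K' \<le> radius T K"
  then obtain xs x r where "approx_fixed T K xs x r" "r < radius T K'"
    using radius_approx[OF assms(1)] by (metis not_le)
  then show False using radius_le[OF approx_fixed_mono[OF _ assms(2)]] by fastforce
qed

text \<open>The size of the perturbation in \<open>radius_eq_0\<close> depends on how many coordinates count as the head.
  This number must be fixed before a sequence of nearly minimal radius is chosen, so all limits in
  question must have small tails beyond the same \<open>k\<close>. Additivity of radii achieves this
  near a single sequence of radius close to the infimum.\<close>

lemma uniformly_small_tails:
  assumes inv: "invariant T C" and c: "0 < radius T C"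
  obtains D k where "invariant T D" "D \<subseteq> C"
    "\<And>ys y s. approx_fixed T D ys y s \<Longrightarrow> norm (tail k y) \<le> radius T C / 4"
proof -
  define c where "c = radius T C"
  have "0 < c" using assms by (simp add: c_def)
  \<comment> \<open>Any slack that is small compared to \<open>c/8\<close> would do; \<open>(1 + 1/64) * 2 * (c + c/64) - 2 * c\<close> is less than \<open>c/8\<close>.\<close>
  then obtain xs x r where xs: "approx_fixed T C xs x r" "r < c + c/64"
    using radius_approx[OF inv, of "c + c/64"] by (auto simp: c_def)
  define d where "d = 2 * (c + c/64)"
  define D where "D = asym_ball C xs d"
  have D: "invariant T D"
    unfolding D_def using asym_ball_invariant[OF inv xs(1)] asym_ball_contains_tail[OF xs(1), of d] xs(2)
    by (auto simp: d_def)
  have "\<forall>\<^sub>F k in sequentially. norm (tail k x) < c/8 \<and> \<tau> k < 1/64"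
    by (intro eventually_conj order_tendstoD(2)[OF tail_tendsto_0] order_tendstoD(2)[OF \<tau>_lim])
      (use \<open>0 < c\<close> in auto)
  then obtain k where k: "norm (tail k x) < c/8" "\<tau> k < 1/64"
    by (metis (lifting) eventually_happens trivial_limit_sequentially)
  have "norm (tail k y) \<le> c/4" if ys: "approx_fixed T D ys y s" for ys y s
  proof -
    have "c \<le> r" "c \<le> s"
      using radius_le[OF xs(1)] radius_le[OF approx_fixed_mono[OF ys, of C]]
      by (auto simp: c_def D_def asym_ball_def)
    moreover have "r + s + norm (tail k (x - y)) \<le> (1 + \<tau> k) * d"
      using asym_ball_radii[OF xs(1)] ys unfolding D_def by blast
    moreover have "(1 + \<tau> k) * d \<le> (1 + 1/64) * d"
      using k(2) \<open>0 < c\<close> by (intro mult_right_mono) (auto simp: d_def)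
    moreover have "(1 + 1/64) * d = c * (2 + 129/2048)" by (simp add: d_def)
    moreover have "norm (tail k y) \<le> norm (tail k x) + norm (tail k (x - y))"
      using norm_triangle_ineq4[of "tail k x" "tail k (x - y)"] by (simp add: tail_linear)
    ultimately have "norm (tail k (x - y)) \<le> c * (129/2048)" "norm (tail k y) \<le> norm (tail k x) + norm (tail k (x - y))"
      by (simp_all add: distrib_left)
    then show ?thesis using k(1) \<open>0 < c\<close> by linarith
  qed
  with D that show thesis by (metis (no_types, lifting) D_def asym_ball_def c_def mem_Collect_eq subsetI)
qed

text \<open>If the radius were positive, mixing a little of \<open>z0\<close> into a sequence of nearly minimal radius would
  bring points of the set asymptotically closer to it than two radii allow.\<close>

lemma radius_eq_0:
  assumes inv: "invariant T C"
  shows "radius T C = 0"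
proof (rule ccontr)
  assume "radius T C \<noteq> 0"
  moreover have "0 \<le> radius T C"
    unfolding radius_def by (rule cInf_greatest) (use approx_fixed_exists[OF inv] approx_fixed_nonneg in auto)
  ultimately have "0 < radius T C" by simp
  then obtain D k0 where D: "invariant T D" "D \<subseteq> C"
    and k0: "\<And>ys y s. approx_fixed T D ys y s \<Longrightarrow> norm (tail k0 y) \<le> radius T C / 4"
    using uniformly_small_tails[OF inv] by blast
  define c where "c = radius T D"
  have cC: "radius T C \<le> c" unfolding c_def by (rule radius_antimono[OF D])
  then have c: "0 < c" using \<open>0 < radius T C\<close> by linarith
  obtain z0 where z0: "z0 \<in> D" using D(1) by (auto simp: invariant_def)
  have "\<forall>\<^sub>F k in sequentially. norm (tail k z0) < c/4 \<and> k0 \<le> k"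
    by (intro eventually_conj order_tendstoD(2)[OF tail_tendsto_0] eventually_ge_at_top) (use c in auto)
  then obtain k where k: "norm (tail k z0) < c/4" "k0 \<le> k"
    by (metis (lifting) eventually_happens trivial_limit_sequentially)
  obtain B where B: "\<And>x. x \<in> D \<Longrightarrow> norm x \<le> B" using D(1) unfolding invariant_def bounded_iff by blast
  obtain t where t: "0 < t" "t \<le> 1" and flat_t: "\<And>w z a. \<lbrakk>c \<le> a; norm (tail k w) \<le> a;
      norm (head k z) \<le> B + norm z0\<rbrakk> \<Longrightarrow> N (tail k w + t *\<^sub>R head k z) \<le> a + c/4 * t"
    using flat[of c "c/4" k "B + norm z0"] c by auto
  \<comment> \<open>The errors add up to \<open>6 * \<kappa>\<close>, which has to stay below the remaining gain \<open>t * c / 8\<close>.\<close>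
  define \<kappa> where "\<kappa> = t * c / 100"
  have \<kappa>: "0 < \<kappa>" using t c by (simp add: \<kappa>_def)
  obtain ys y s where ys: "approx_fixed T D ys y s" and s: "s < c + \<kappa>"
    using radius_approx[OF D(1), of "c + \<kappa>"] \<kappa> by (auto simp: c_def)
  have cs: "c \<le> s" using radius_le[OF ys] by (simp add: c_def)
  have ysD: "ys n \<in> D" for n using ys by (simp add: approx_fixed_def)
  have "norm y \<le> B"
  proof (rule coordinatewise_limit_in_ball[of ys "coord y" 0 B])
    show "(\<lambda>n. coord (ys n) i) \<longlonglongrightarrow> coord y i" for i using ys by (auto simp: approx_fixed_def)
    show "norm y \<le> B" if "coord x = coord y" "norm (x - 0) \<le> B" for x
      using that by (simp add: coord_inject)
  qed (use B ysD in auto)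
  have taily: "norm (tail k y) \<le> c/4"
  proof -
    have "norm (tail k y) \<le> norm (tail k0 y)" by (rule norm_l1_mono) (use k(2) in auto)
    also have "\<dots> \<le> c/4" using k0[OF ys] cC by linarith
    finally show ?thesis .
  qed
  have null: "(\<lambda>n. coord (ys n - y) i) \<longlonglongrightarrow> 0" for i
    using ys by (auto simp: approx_fixed_def intro!: LIM_zero)
  have near: "\<forall>\<^sub>F n in sequentially. norm (ys n - y) < c + \<kappa> \<and> norm (head k (ys n - y)) < \<kappa>"
  proof (intro eventually_conj)
    show "\<forall>\<^sub>F n in sequentially. norm (ys n - y) < c + \<kappa>"
      using ys s by (intro order_tendstoD(2)[where y = s]) (auto simp: approx_fixed_def)
    show "\<forall>\<^sub>F n in sequentially. norm (head k (ys n - y)) < \<kappa>"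
      by (rule order_tendstoD(2)[OF head_tendsto_0[OF null] \<kappa>])
  qed
  then obtain m where m: "norm (ys m - y) < c + \<kappa>" "norm (head k (ys m - y)) < \<kappa>"
    by (metis (lifting) eventually_happens trivial_limit_sequentially)
  define z where "z = (1 - t) *\<^sub>R ys m + t *\<^sub>R z0"
  define d where "d = 2 * c - t * c / 8"
  have "z \<in> D" unfolding z_def using D(1) ysD[of m] z0 t
    by (intro convexD) (auto simp: invariant_def)
  moreover have "\<forall>\<^sub>F n in sequentially. N (ys n - z) \<le> d"
    using near
  proof eventually_elim
    case (elim n)
    define w where "w = (ys n - y) - (1 - t) *\<^sub>R (ys m - y) - t *\<^sub>R (z0 - y)"
    define a where "a = (2 - t) * (c + \<kappa>) + t * c / 2"
    \<comment> \<open>The heads of the first two terms tend to zero; the rest is a vector far out, perturbed in the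
      first \<open>k\<close> coordinates by \<open>t\<close> times a bounded vector.\<close>
    have split: "ys n - z = head k (ys n - y) + (- (1 - t)) *\<^sub>R head k (ys m - y) + (tail k w + t *\<^sub>R head k (y - z0))"
      by (rule l1_eqI) (simp add: w_def z_def algebra_simps)
    have "norm (tail k w) \<le> norm (tail k (ys n - y)) + norm ((1 - t) *\<^sub>R tail k (ys m - y))
        + norm (t *\<^sub>R (tail k z0 - tail k y))"
    proof -
      have "tail k w = tail k (ys n - y) - (1 - t) *\<^sub>R tail k (ys m - y) - t *\<^sub>R (tail k z0 - tail k y)"
        unfolding w_def by (simp only: tail_linear)
      then show ?thesis using norm_triangle_ineq4 by (metis add_mono norm_triangle_le_diff order_refl)
    qed
    also have "\<dots> \<le> norm (ys n - y) + (1 - t) * norm (ys m - y) + t * (c/4 + c/4)"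
    proof (intro add_mono)
      show "norm ((1 - t) *\<^sub>R tail k (ys m - y)) \<le> (1 - t) * norm (ys m - y)"
        using t norm_tail_le[of k "ys m - y"] by (simp add: mult_left_mono)
      have "norm (tail k z0 - tail k y) \<le> c/4 + c/4"
        using norm_triangle_ineq4[of "tail k z0" "tail k y"] k(1) taily by linarith
      then show "norm (t *\<^sub>R (tail k z0 - tail k y)) \<le> t * (c/4 + c/4)"
        using t by (simp add: mult_left_mono)
    qed (rule norm_tail_le)
    also have "\<dots> \<le> (c + \<kappa>) + (1 - t) * (c + \<kappa>) + t * (c/4 + c/4)"
      using elim m t by (intro add_mono mult_left_mono) auto
    also have "\<dots> = a" by (simp add: a_def algebra_simps)
    finally have wa: "norm (tail k w) \<le> a" .
    have "c * 1 \<le> (c + \<kappa>) * (2 - t)" using c \<kappa> t by (intro mult_mono) auto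
    then have ca: "c \<le> a" using t c by (simp add: a_def mult.commute add_increasing2)
    have "norm (head k (y - z0)) \<le> B + norm z0"
      using norm_head_le[of k "y - z0"] norm_triangle_ineq4[of y z0] \<open>norm y \<le> B\<close> by linarith
    then have 1: "N (tail k w + t *\<^sub>R head k (y - z0)) \<le> a + c/4 * t" using flat_t[OF ca wa] by blast
    have 2: "N (head k (ys n - y)) \<le> \<kappa>" using elim N_le_norm[of "head k (ys n - y)"] by linarith
    have "N ((- (1 - t)) *\<^sub>R head k (ys m - y)) \<le> 1 * N (head k (ys m - y))"
      unfolding N_scaleR using t N_nonneg by (intro mult_right_mono) auto
    then have 3: "N ((- (1 - t)) *\<^sub>R head k (ys m - y)) \<le> \<kappa>"
      using m(2) N_le_norm[of "head k (ys m - y)"] by linarith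
    have "N (ys n - z) \<le> \<kappa> + \<kappa> + (a + c/4 * t)"
      unfolding split using 1 2 3 N_triangle by (meson add_mono order_trans)
    also have "\<dots> \<le> d"
    proof -
      have "0 \<le> t * \<kappa>" using t \<kappa> by simp
      moreover have "a = 2 * c + 2 * \<kappa> - t * c - t * \<kappa> + t * c / 2" by (simp add: a_def algebra_simps)
      moreover have "t * c = 100 * \<kappa>" by (simp add: \<kappa>_def)
      ultimately show ?thesis unfolding d_def using \<kappa> by (simp add: mult.commute)
    qed
    finally show ?case .
  qed
  then have "\<forall>e>0. \<forall>\<^sub>F n in sequentially. N (ys n - z) \<le> d + e"
    by (auto elim: eventually_mono)
  ultimately have "asym_ball D ys d \<noteq> {}" by (auto simp: asym_ball_def)
  then have "invariant T (asym_ball D ys d)" by (rule asym_ball_invariant[OF D(1) ys])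
  then obtain zs z' s' where zs: "approx_fixed T (asym_ball D ys d) zs z' s'"
    using approx_fixed_exists by blast
  then have "s + s' \<le> d" by (rule asym_ball_radii_limit[OF ys])
  moreover have "c \<le> s'"
    unfolding c_def by (rule radius_le[OF approx_fixed_mono[OF zs]]) (auto simp: asym_ball_def)
  moreover have "0 < t * c" using t c by simp
  ultimately show False using cs by (simp add: d_def)
qed

lemma invariant_shrink:
  assumes inv: "invariant T K" and e: "0 < e"
  shows "\<exists>K'. invariant T K' \<and> K' \<subseteq> K \<and> (\<forall>x\<in>K'. \<forall>y\<in>K'. N (x - y) \<le> e)"
proof -
  obtain xs x r where xs: "approx_fixed T K xs x r" "r < e/8"
    using radius_approx[OF inv, of "e/8"] radius_eq_0[OF inv] e by auto
  have "N (y - z) \<le> e" if "y \<in> asym_ball K xs (e/4)" "z \<in> asym_ball K xs (e/4)" for y z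
  proof -
    have "\<forall>\<^sub>F n in sequentially. N (xs n - y) \<le> e/4 + e/4" if "y \<in> asym_ball K xs (e/4)" for y
      using that e unfolding asym_ball_def mem_Collect_eq by (metis zero_less_divide_iff zero_less_numeral)
    from this[OF that(1)] this[OF that(2)] have "\<forall>\<^sub>F n in sequentially. N (y - z) \<le> e"
    proof eventually_elim
      case (elim n)
      then show ?case using N_diff_triangle[of y z "xs n"] N_minus_commute[of y "xs n"] by linarith
    qed
    then show ?thesis by simp
  qed
  then show ?thesis
    using asym_ball_invariant[OF inv xs(1) asym_ball_contains_tail[OF xs(1), of "e/4"]] xs(2)
    by (intro exI[of _ "asym_ball K xs (e/4)"]) (auto simp: asym_ball_def)
qed

text \<open>Nested invariant sets with diameters tending to zero meet in a single point, which \<open>T\<close> fixes.\<close>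

theorem invariant_fixed_point:
  assumes "invariant T C"
  shows "\<exists>x\<in>C. T x = x"
proof -
  obtain K where K': "\<And>n. invariant T (K n) \<and> (n = 0 \<longrightarrow> K n = C)"
    "\<And>n. K (Suc n) \<subseteq> K n \<and> (\<forall>x\<in>K (Suc n). \<forall>y\<in>K (Suc n). N (x - y) \<le> inverse (real (Suc n)))"
  proof (rule dependent_nat_choice[of "\<lambda>n K. invariant T K \<and> (n = 0 \<longrightarrow> K = C)"
        "\<lambda>n K K'. K' \<subseteq> K \<and> (\<forall>x\<in>K'. \<forall>y\<in>K'. N (x - y) \<le> inverse (real (Suc n)))", THEN exE])
    show "\<exists>K. invariant T K \<and> (0 = 0 \<longrightarrow> K = C)" using assms by blast
    show "\<exists>K'. (invariant T K' \<and> (Suc n = 0 \<longrightarrow> K' = C)) \<and> K' \<subseteq> K \<and>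
        (\<forall>x\<in>K'. \<forall>y\<in>K'. N (x - y) \<le> inverse (real (Suc n)))"
      if "invariant T K \<and> (n = 0 \<longrightarrow> K = C)" for K n
      using invariant_shrink[of T K "inverse (real (Suc n))"] that by simp
  qed blast
  then have K: "K 0 = C" "\<And>n. invariant T (K n)" "\<And>n. K (Suc n) \<subseteq> K n"
    "\<And>n x y. x \<in> K (Suc n) \<Longrightarrow> y \<in> K (Suc n) \<Longrightarrow> N (x - y) \<le> inverse (real (Suc n))"
    by auto
  have "\<exists>a. \<Inter>(range K) = {a}"
  proof (rule decreasing_closed_nest_sing)
    show "closed (K n)" "K n \<noteq> {}" for n using K(2)[of n] by (auto simp: invariant_def)
    show "K n \<subseteq> K m" if "m \<le> n" for m n using lift_Suc_antimono_le[of K, OF K(3) that] .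
    show "\<exists>n. \<forall>x\<in>K n. \<forall>y\<in>K n. dist x y < e" if "0 < e" for e
    proof -
      have "(\<lambda>n. (1 + \<tau> 0) * inverse (real (Suc n))) \<longlonglongrightarrow> (1 + \<tau> 0) * 0"
        by (intro tendsto_intros LIMSEQ_inverse_real_of_nat)
      then have "\<forall>\<^sub>F n in sequentially. (1 + \<tau> 0) * inverse (real (Suc n)) < e"
        using that by (intro order_tendstoD(2)) auto
      then obtain n where n: "(1 + \<tau> 0) * inverse (real (Suc n)) < e"
        by (metis (lifting) eventually_happens trivial_limit_sequentially)
      have "dist x y < e" if xy: "x \<in> K (Suc n)" "y \<in> K (Suc n)" for x y
      proof -
        have "norm (x - y) \<le> (1 + \<tau> 0) * N (x - y)" by (rule norm_le_N)
        also have "\<dots> \<le> (1 + \<tau> 0) * inverse (real (Suc n))"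
          using K(4)[OF xy] \<tau>_nonneg[of 0] by (intro mult_left_mono) auto
        finally show ?thesis using n by (simp add: dist_norm)
      qed
      then show ?thesis by blast
    qed
  qed
  then obtain a where a: "\<Inter>(range K) = {a}" by blast
  have "T a \<in> K n" for n using K(2)[of n] a unfolding invariant_def by blast
  then have "T a = a" using a by blast
  moreover have "a \<in> C" using a K(1) by blast
  ultimately show ?thesis by blast
qed

end

section \<open>Isometric copies of renormings\<close>

text \<open>An ultrafilter below \<open>sequentially\<close> turns limits into a linear functional on all bounded
  sequences. It supplies the element of the bidual of \<open>l1\<close> that does not come from \<open>l1\<close>.\<close>

lemma ultrafilter_exists:
  fixes G :: "'a filter"
  assumes "G \<noteq> bot"
  obtains F where "F \<noteq> bot" "F \<le> G" "\<And>P. eventually P F \<or> eventually (\<lambda>x. \<not> P x) F"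
proof -
  let ?A = "{F. F \<noteq> bot \<and> F \<le> G}"
  have "\<exists>M\<in>?A. \<forall>F\<in>?A. F \<le> M \<longrightarrow> F = M"
  proof (rule predicate_Zorn[of ?A "\<lambda>F F'. F' \<le> F"])
    show "partial_order_on ?A (relation_of (\<lambda>F F'. F' \<le> F) ?A)"
      by (rule partial_order_on_relation_ofI) auto
    fix C assume C: "C \<in> Chains (relation_of (\<lambda>F F'. F' \<le> F) ?A)"
    have CA: "F \<noteq> bot \<and> F \<le> G" if "F \<in> C" for F
      using C that by (auto simp: Chains_def relation_of_def)
    have tot: "F \<le> F' \<or> F' \<le> F" if "F \<in> C" "F' \<in> C" for F F'
      using C that by (auto simp: Chains_def relation_of_def)
    show "\<exists>u\<in>?A. \<forall>a\<in>C. u \<le> a"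
    proof (cases "C = {}")
      case True
      then show ?thesis using assms by auto
    next
      case False
      have "eventually P (Inf C) \<longleftrightarrow> (\<exists>F\<in>C. eventually P F)" for P
        by (rule eventually_Inf_base[OF False]) (metis inf.absorb_iff1 inf.absorb_iff2 order_refl tot)
      then have "Inf C \<noteq> bot"
        using CA by (metis eventually_False)
      moreover have "Inf C \<le> G" using False CA by (meson Inf_lower2 ex_in_conv)
      ultimately show ?thesis by (auto intro: Inf_lower)
    qed
  qed
  then obtain F where F: "F \<noteq> bot" "F \<le> G" and max: "\<And>F'. F' \<noteq> bot \<Longrightarrow> F' \<le> F \<Longrightarrow> F' = F"
    by (auto intro: order_trans)
  have "eventually P F \<or> eventually (\<lambda>x. \<not> P x) F" for P
  proof (cases "eventually P F")
    case False
    have "inf F (principal {x. \<not> P x}) \<noteq> bot"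
      using False by (simp add: trivial_limit_def eventually_inf_principal)
    then have "inf F (principal {x. \<not> P x}) = F" by (rule max) simp
    then have "F \<le> principal {x. \<not> P x}" by (metis inf.cobounded2)
    then show ?thesis by (simp add: le_principal)
  qed simp
  with F that show thesis by blast
qed

lemma generalized_limit_exists:
  "\<exists>L :: (nat \<Rightarrow> real) \<Rightarrow> real.
    (\<forall>f g. Bseq f \<longrightarrow> Bseq g \<longrightarrow> L (\<lambda>n. f n + g n) = L f + L g) \<and>
    (\<forall>c f. Bseq f \<longrightarrow> L (\<lambda>n. c * f n) = c * L f) \<and>
    (\<forall>f B. (\<forall>n. \<bar>f n\<bar> \<le> B) \<longrightarrow> \<bar>L f\<bar> \<le> B) \<and>
    (\<forall>f l. f \<longlonglongrightarrow> l \<longrightarrow> L f = l)"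
proof -
  obtain F :: "nat filter" where F: "F \<noteq> bot" "F \<le> sequentially"
    and ultra: "\<And>P. eventually P F \<or> eventually (\<lambda>x. \<not> P x) F"
    using ultrafilter_exists[of sequentially] by auto
  have conv: "\<exists>l. (f \<longlongrightarrow> l) F" if "Bseq f" for f :: "nat \<Rightarrow> real"
  proof -
    obtain B where B: "\<And>n. norm (f n) \<le> B" using \<open>Bseq f\<close> by (auto simp: Bseq_def)
    have "compact (cball (0::real) B)" by simp
    moreover have "filtermap f F \<noteq> bot" using F(1) by (simp add: filtermap_bot_iff)
    moreover have "eventually (\<lambda>x. x \<in> cball 0 B) (filtermap f F)"
      using B by (simp add: eventually_filtermap)
    ultimately obtain l where l: "inf (nhds l) (filtermap f F) \<noteq> bot"
      unfolding compact_filter by blast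
    have "(f \<longlongrightarrow> l) F"
    proof (rule topological_tendstoI)
      fix S assume S: "open S" "l \<in> S"
      show "eventually (\<lambda>n. f n \<in> S) F"
      proof (rule ccontr)
        assume "\<not> ?thesis"
        then have "eventually (\<lambda>n. f n \<notin> S) F" using ultra by blast
        then have "eventually (\<lambda>x. x \<notin> S) (filtermap f F)" by (simp add: eventually_filtermap)
        moreover have "eventually (\<lambda>x. x \<in> S) (nhds l)" using S by (simp add: eventually_nhds_in_open)
        ultimately have "eventually (\<lambda>x. False) (inf (nhds l) (filtermap f F))"
          unfolding eventually_inf by (intro exI[of _ "\<lambda>x. x \<in> S"] exI[of _ "\<lambda>x. x \<notin> S"]) auto
        then show False using l by (simp add: trivial_limit_def)
      qed
    qed
    then show ?thesis by blast
  qed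
  define L where "L f = Lim F f" for f :: "nat \<Rightarrow> real"
  have L: "(f \<longlongrightarrow> L f) F" if "Bseq f" for f
    using conv[OF that] F(1) unfolding L_def by (metis tendsto_Lim)
  have L_eq: "L f = l" if "(f \<longlongrightarrow> l) F" for f l
    unfolding L_def using F(1) that by (rule tendsto_Lim)
  show ?thesis
  proof (intro exI[of _ L] conjI allI impI)
    show "L (\<lambda>n. f n + g n) = L f + L g" if "Bseq f" "Bseq g" for f g
      by (intro L_eq tendsto_add L that)
    show "L (\<lambda>n. c * f n) = c * L f" if "Bseq f" for c f
      by (intro L_eq tendsto_mult tendsto_const L that)
    show "\<bar>L f\<bar> \<le> B" if "\<forall>n. \<bar>f n\<bar> \<le> B" for f B
    proof -
      have "((\<lambda>n. \<bar>f n\<bar>) \<longlongrightarrow> \<bar>L f\<bar>) F"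
        by (intro tendsto_rabs L BseqI') (use that in auto)
      then show ?thesis by (rule tendsto_upperbound) (use that F(1) in auto)
    qed
    show "L f = l" if "f \<longlonglongrightarrow> l" for f l
      by (rule L_eq, rule tendsto_mono[OF F(2) that])
  qed
qed

definition renormed_l1 :: "(l1 \<Rightarrow> real) \<Rightarrow> l1 nspace" where
  "renormed_l1 N = \<lparr>pts = UNIV, nadd = (+), nzero = 0, nscale = scaleR, nnorm = N\<rparr>"

lemma renormed_l1_simps [simp]:
  "pts (renormed_l1 N) = UNIV" "nadd (renormed_l1 N) = (+)" "nzero (renormed_l1 N) = 0"
  "nscale (renormed_l1 N) = scaleR" "nnorm (renormed_l1 N) = N"
  by (simp_all add: renormed_l1_def)

lemma restrict_nspace_simps [simp]:
  "pts (restrict_nspace X S) = S" "nadd (restrict_nspace X S) = nadd X"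
  "nscale (restrict_nspace X S) = nscale X" "nnorm (restrict_nspace X S) = nnorm X"
  by (simp_all add: restrict_nspace_def)

lemma dual_simps [simp]:
  "nadd (dual X) = (\<lambda>f g. \<lambda>x\<in>pts X. f x + g x)" "nscale (dual X) = (\<lambda>c f. \<lambda>x\<in>pts X. c * f x)"
  "nnorm (dual X) f = (SUP x\<in>{x \<in> pts X. nnorm X x \<le> 1}. \<bar>f x\<bar>)"
  by (simp_all add: dual_def)

lemma real_line_simps [simp]:
  "pts real_line = UNIV" "nadd real_line = (+)" "nscale real_line = (*)" "nnorm real_line = abs"
  by (simp_all add: real_line_def)

lemma mem_dual_iff:
  "f \<in> pts (dual X) \<longleftrightarrow> f \<in> extensional (pts X) \<and>
    (\<forall>x\<in>pts X. \<forall>y\<in>pts X. f (nadd X x y) = f x + f y) \<and> (\<forall>c. \<forall>x\<in>pts X. f (nscale X c x) = c * f x) \<and>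
    (\<exists>B. \<forall>x\<in>pts X. \<bar>f x\<bar> \<le> B * nnorm X x)"
  by (auto simp: dual_def nlinear_def)

lemma le_dual_norm:
  assumes f: "f \<in> pts (dual X)" and x: "x \<in> pts X" "nnorm X x \<le> 1"
    and nonneg: "\<And>x. x \<in> pts X \<Longrightarrow> 0 \<le> nnorm X x"
  shows "\<bar>f x\<bar> \<le> nnorm (dual X) f"
proof -
  obtain B where B: "\<forall>x\<in>pts X. \<bar>f x\<bar> \<le> B * nnorm X x" using f by (auto simp: mem_dual_iff)
  have "\<bar>f x\<bar> \<le> \<bar>B\<bar>" if "x \<in> pts X" "nnorm X x \<le> 1" for x
  proof -
    have "\<bar>f x\<bar> \<le> B * nnorm X x" using B that by blast
    also have "\<dots> \<le> \<bar>B\<bar> * nnorm X x" using nonneg[OF that(1)] by (intro mult_right_mono) auto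
    also have "\<dots> \<le> \<bar>B\<bar> * 1" using that by (intro mult_left_mono) auto
    finally show ?thesis by simp
  qed
  then show ?thesis
    unfolding dual_simps using x by (intro cSUP_upper bdd_aboveI2[of _ _ "\<bar>B\<bar>"]) auto
qed

lemma dual_closed:
  assumes add: "\<And>x y. x \<in> pts X \<Longrightarrow> y \<in> pts X \<Longrightarrow> nadd X x y \<in> pts X"
    and scale: "\<And>c x. x \<in> pts X \<Longrightarrow> nscale X c x \<in> pts X"
    and f: "f \<in> pts (dual X)" and g: "g \<in> pts (dual X)"
  shows "nadd (dual X) f g \<in> pts (dual X)" "nscale (dual X) c f \<in> pts (dual X)"
proof -
  obtain B where B: "\<forall>x\<in>pts X. \<bar>f x\<bar> \<le> B * nnorm X x" using f by (auto simp: mem_dual_iff)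
  obtain B' where B': "\<forall>x\<in>pts X. \<bar>g x\<bar> \<le> B' * nnorm X x" using g by (auto simp: mem_dual_iff)
  have "\<forall>x\<in>pts X. \<bar>f x + g x\<bar> \<le> (B + B') * nnorm X x"
    using B B' by (force simp: distrib_right)
  then show "nadd (dual X) f g \<in> pts (dual X)"
    using f g by (auto simp: mem_dual_iff add scale distrib_left intro!: exI[of _ "B + B'"])
  have "\<forall>x\<in>pts X. \<bar>c * f x\<bar> \<le> (\<bar>c\<bar> * B) * nnorm X x"
    using B by (auto simp: abs_mult mult.assoc mult_left_mono)
  then show "nscale (dual X) c f \<in> pts (dual X)"
    using f by (auto simp: mem_dual_iff add scale distrib_left intro!: exI[of _ "\<bar>c\<bar> * B"])
qed

definition unit_vec :: "nat \<Rightarrow> l1" where "unit_vec n = Abs_l1 (\<lambda>i. if i = n then 1 else 0)"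

lemma coord_unit_vec [simp]: "coord (unit_vec n) i = (if i = n then 1 else 0)"
proof -
  have "summable (\<lambda>i. \<bar>if i = n then 1 else 0::real\<bar>)"
    by (rule summable_finite[of "{n}"]) auto
  then show ?thesis unfolding unit_vec_def by (simp add: coord_Abs_l1)
qed

lemma norm_unit_vec: "norm (unit_vec n) = 1"
proof -
  have "(\<lambda>i. \<bar>coord (unit_vec n) i\<bar>) sums (\<Sum>i\<in>{n}. \<bar>coord (unit_vec n) i\<bar>)"
    by (rule sums_finite) auto
  then show ?thesis by (simp add: norm_l1_eq sums_unique[symmetric])
qed

lemma summable_coord': "summable (coord x)"
  by (rule summable_rabs_cancel[OF summable_coord])

lemma abs_suminf_coord_le: "\<bar>\<Sum>i. coord x i\<bar> \<le> norm x"
  unfolding norm_l1_eq by (rule summable_rabs[OF summable_coord])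

lemma sum_unit_vec: "(\<Sum>i. coord (unit_vec n) i) = 1"
proof -
  have "(\<lambda>i. coord (unit_vec n) i) sums (\<Sum>i\<in>{n}. coord (unit_vec n) i)"
    by (rule sums_finite) auto
  then show ?thesis by (simp add: sums_unique[symmetric])
qed

context l1_renorming
begin

context
  fixes X :: "'v nspace" and T :: "l1 \<Rightarrow> 'v"
  assumes metric: "Metric_space (pts X) (ndist X)"
    and linear: "nlinear (renormed_l1 N) X T"
    and isometric: "\<And>x. nnorm X (T x) = N x"
begin

lemma T_pts: "T x \<in> pts X" and T_add: "T (x + y) = nadd X (T x) (T y)"
  and T_scale: "T (c *\<^sub>R x) = nscale X c (T x)"
  using linear by (auto simp: nlinear_def)

lemma ndist_T: "ndist X (T x) (T y) = N (x - y)"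
proof -
  have "nadd X (T x) (nscale X (-1) (T y)) = T (x - y)"
    by (simp flip: T_add T_scale)
  then show ?thesis by (simp add: ndist_def T_pts isometric)
qed

lemma T_inj: "inj T"
proof (rule injI)
  fix x y assume "T x = T y"
  then have "N (x - y) = N (x - x)" by (metis ndist_T)
  then have "N (x - y) = 0" using N_scaleR[of 0 x] by simp
  then show "x = y" using N_eq_0 by fastforce
qed

lemma inv_T [simp]: "inv T (T x) = x"
  by (simp add: T_inj)

lemma ndist_restrict: "ndist (restrict_nspace X (range T)) (T x) (T y) = N (x - y)"
  using ndist_T[of x y] T_pts by (simp add: ndist_def)

lemma Metric_space_range: "Metric_space (range T) (ndist (restrict_nspace X (range T)))"
proof
  fix x y z
  have off: "ndist (restrict_nspace X (range T)) x y = 0" if "\<not> (x \<in> range T \<and> y \<in> range T)" for x y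
    using that by (auto simp: ndist_def)
  show "0 \<le> ndist (restrict_nspace X (range T)) x y"
    using off N_nonneg ndist_restrict by (cases "x \<in> range T \<and> y \<in> range T") auto
  show "ndist (restrict_nspace X (range T)) x y = ndist (restrict_nspace X (range T)) y x"
    using off[of x y] off[of y x] N_minus_commute ndist_restrict
    by (cases "x \<in> range T \<and> y \<in> range T") auto
  show "ndist (restrict_nspace X (range T)) x y = 0 \<longleftrightarrow> x = y" if xy: "x \<in> range T" "y \<in> range T"
  proof -
    obtain a b where ab: "x = T a" "y = T b" using xy by blast
    have "N (a - b) = 0 \<longleftrightarrow> a = b" using N_eq_0[of "a - b"] N_scaleR[of 0 0] by auto
    then show ?thesis using T_inj by (auto simp: ab ndist_restrict inj_eq)
  qed
  show "ndist (restrict_nspace X (range T)) x z \<le>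
      ndist (restrict_nspace X (range T)) x y + ndist (restrict_nspace X (range T)) y z"
    if "x \<in> range T" "y \<in> range T" "z \<in> range T"
    using that N_diff_triangle by (auto simp: ndist_restrict)
qed

lemma N_tendsto_0:
  assumes "xs \<longlonglongrightarrow> x" shows "(\<lambda>n. N (xs n - x)) \<longlonglongrightarrow> 0"
proof (rule tendsto_sandwich[OF _ _ tendsto_const])
  show "(\<lambda>n. norm (xs n - x)) \<longlonglongrightarrow> 0" using assms by (simp add: LIM_zero tendsto_norm_zero)
qed (use N_nonneg N_le_norm in auto)

lemma closed_subspace_range:
  assumes nz: "nzero X = T 0"
  shows "closed_subspace X (range T)"
proof -
  interpret Metric_space "pts X" "ndist X" by (rule metric)
  have "closedin (ntopology X) (range T)"
    unfolding ntopology_def metric_closedin_iff_sequentially_closed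
  proof (intro conjI allI impI)
    show "range T \<subseteq> pts X" using T_pts by auto
    fix \<sigma> l assume "range \<sigma> \<subseteq> range T \<and> limitin mtopology \<sigma> l sequentially"
    then have \<sigma>: "range \<sigma> \<subseteq> range T" and lim: "limitin mtopology \<sigma> l sequentially" by auto
    define xs where "xs n = inv T (\<sigma> n)" for n
    have xs: "\<sigma> n = T (xs n)" for n using \<sigma> by (simp add: xs_def f_inv_into_f range_subsetD)
    have "MCauchy \<sigma>" by (rule convergent_imp_MCauchy[OF _ lim]) (use xs T_pts in auto)
    have "Cauchy xs"
    proof (rule metric_CauchyI)
      fix e :: real assume "0 < e"
      have p: "0 < 1 + \<tau> 0" using \<tau>_nonneg[of 0] by linarith
      obtain M where M: "\<And>m n. M \<le> m \<Longrightarrow> M \<le> n \<Longrightarrow> ndist X (\<sigma> m) (\<sigma> n) < e / (1 + \<tau> 0)"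
        using \<open>MCauchy \<sigma>\<close> \<open>0 < e\<close> p unfolding MCauchy_def by (metis divide_pos_pos)
      have "dist (xs m) (xs n) < e" if "M \<le> m" "M \<le> n" for m n
      proof -
        have "(1 + \<tau> 0) * N (xs m - xs n) < e"
          using M[OF that] p by (simp add: xs ndist_T pos_less_divide_eq mult.commute)
        then show ?thesis using norm_le_N[of "xs m - xs n"] by (simp add: dist_norm)
      qed
      then show "\<exists>M. \<forall>m\<ge>M. \<forall>n\<ge>M. dist (xs m) (xs n) < e" by blast
    qed
    then obtain x where "xs \<longlonglongrightarrow> x" by (auto simp: Cauchy_convergent_iff convergent_def)
    then have "limitin mtopology \<sigma> (T x) sequentially"
      using N_tendsto_0 T_pts by (simp add: limitin_metric_dist_null xs ndist_T)
    then have "l = T x" using lim limitin_metric_unique trivial_limit_sequentially by blast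
    then show "l \<in> range T" by simp
  qed
  then show ?thesis
    using nz unfolding closed_subspace_def by (auto simp flip: T_add T_scale)
qed

lemma FPP_range: "FPP (restrict_nspace X (range T))"
  unfolding FPP_def
proof (intro allI impI, elim conjE)
  let ?Y = "restrict_nspace X (range T)"
  interpret Metric_space "range T" "ndist ?Y" by (rule Metric_space_range)
  fix C U
  assume C: "C \<noteq> {}" "closedin (ntopology ?Y) C" "nconvex ?Y C" "nbounded ?Y C"
    and U: "U \<in> C \<rightarrow> C" "nonexpansive_on ?Y C U"
  have clo: "C \<subseteq> range T" "\<And>\<sigma> l. range \<sigma> \<subseteq> C \<Longrightarrow> limitin mtopology \<sigma> l sequentially \<Longrightarrow> l \<in> C"
    using C(2) by (auto simp: ntopology_def metric_closedin_iff_sequentially_closed)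
  define K where "K = T -` C"
  define S where "S x = inv T (U (T x))" for x
  have TS: "T (S x) = U (T x)" if "x \<in> K" for x
    using that U(1) clo(1) unfolding S_def K_def by (auto simp: f_inv_into_f)
  have "invariant S K"
    unfolding invariant_def
  proof (intro conjI ballI)
    show "K \<noteq> {}" using C(1) clo(1) by (auto simp: K_def)
    show "closed K"
      unfolding closed_sequential_limits
    proof (intro allI impI, elim conjE)
      fix xs x assume xs: "\<forall>n. xs n \<in> K" "xs \<longlonglongrightarrow> x"
      have "limitin mtopology (\<lambda>n. T (xs n)) (T x) sequentially"
        using N_tendsto_0[OF xs(2)] by (simp add: limitin_metric_dist_null ndist_restrict)
      then show "x \<in> K" using clo(2)[of "\<lambda>n. T (xs n)"] xs(1) by (auto simp: K_def)
    qed
    show "convex K"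
      using C(3) unfolding convex_alt nconvex_def K_def by (simp add: T_add T_scale)
    obtain B where B: "\<forall>y\<in>C. nnorm X y \<le> B" using C(4) by (auto simp: nbounded_def)
    have "norm x \<le> (1 + \<tau> 0) * B" if "x \<in> K" for x
    proof -
      have "N x \<le> B" using B that by (auto simp: K_def isometric)
      then have "(1 + \<tau> 0) * N x \<le> (1 + \<tau> 0) * B" using \<tau>_nonneg[of 0] by (intro mult_left_mono) auto
      then show ?thesis using norm_le_N[of x] by linarith
    qed
    then show "bounded K" unfolding bounded_iff by blast
    show "S \<in> K \<rightarrow> K" using TS U(1) by (auto simp: K_def)
    show "N (S x - S y) \<le> N (x - y)" if "x \<in> K" "y \<in> K" for x y
      using U(2) that TS unfolding nonexpansive_on_def K_def
      by (metis (no_types, lifting) K_def ndist_restrict vimageD)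
  qed
  then obtain x where x: "x \<in> K" "S x = x" using invariant_fixed_point by blast
  then show "\<exists>y\<in>C. U y = y" using TS[OF x(1)] by (intro bexI[of _ "T x"]) (auto simp: K_def)
qed

text \<open>Functionals on \<open>l1\<close> are transported to the copy; the equivalence of \<open>N\<close> with the usual norm
  keeps them bounded.\<close>

lemma functional_on_range:
  assumes add: "\<And>x y. h (x + y) = h x + h y" and scale: "\<And>c x. h (c *\<^sub>R x) = c * h x"
    and bnd: "\<And>x. \<bar>h x\<bar> \<le> norm x"
  shows "(\<lambda>y\<in>range T. h (inv T y)) \<in> pts (dual (restrict_nspace X (range T)))"
  unfolding mem_dual_iff restrict_nspace_simps
proof (intro conjI)
  show "\<exists>B. \<forall>x\<in>range T. \<bar>restrict (\<lambda>y. h (inv T y)) (range T) x\<bar> \<le> B * nnorm X x"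
    using order_trans[OF bnd norm_le_N] by (auto simp: isometric)
qed (auto simp: add scale simp flip: T_add T_scale)

text \<open>A generalized limit of the unit vectors annihilates all coordinate functionals but not the
  functional that sums up the coordinates, which no vector can do.\<close>

lemma not_reflexive_range: "\<not> reflexive (restrict_nspace X (range T))"
proof
  let ?Y = "restrict_nspace X (range T)"
  assume refl: "reflexive ?Y"
  obtain L :: "(nat \<Rightarrow> real) \<Rightarrow> real" where
    L': "\<forall>f g. Bseq f \<longrightarrow> Bseq g \<longrightarrow> L (\<lambda>n. f n + g n) = L f + L g"
      "\<forall>c f. Bseq f \<longrightarrow> L (\<lambda>n. c * f n) = c * L f"
      "\<forall>f B. (\<forall>n. \<bar>f n\<bar> \<le> B) \<longrightarrow> \<bar>L f\<bar> \<le> B"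
      "\<forall>f l. f \<longlonglongrightarrow> l \<longrightarrow> L f = l"
    using generalized_limit_exists by (elim exE conjE)
  note L_add = L'(1)[rule_format] and L_scale = L'(2)[rule_format] and L_bnd = L'(3)[rule_format]
    and L_lim = L'(4)[rule_format]
  define \<Phi> where "\<Phi> = (\<lambda>f\<in>pts (dual ?Y). L (\<lambda>n. f (T (unit_vec n))))"
  have bnd: "\<bar>f (T (unit_vec n))\<bar> \<le> nnorm (dual ?Y) f" if "f \<in> pts (dual ?Y)" for f n
    by (rule le_dual_norm[OF that]) (use N_le_norm[of "unit_vec n"] N_nonneg in \<open>auto simp: isometric norm_unit_vec\<close>)
  then have Bs: "Bseq (\<lambda>n. f (T (unit_vec n)))" if "f \<in> pts (dual ?Y)" for f
    using that by (intro BseqI'[of _ "nnorm (dual ?Y) f"]) auto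
  have closed: "nadd (dual ?Y) f g \<in> pts (dual ?Y)" "nscale (dual ?Y) c f \<in> pts (dual ?Y)"
    if "f \<in> pts (dual ?Y)" "g \<in> pts (dual ?Y)" for f g c
    by (rule dual_closed; use that in \<open>auto simp flip: T_add T_scale\<close>)+
  have "\<Phi> \<in> pts (dual (dual ?Y))"
    unfolding mem_dual_iff[of _ "dual ?Y"]
  proof (intro conjI ballI allI)
    show "\<Phi> \<in> extensional (pts (dual ?Y))" by (simp add: \<Phi>_def)
    show "\<Phi> (nadd (dual ?Y) f g) = \<Phi> f + \<Phi> g" if "f \<in> pts (dual ?Y)" "g \<in> pts (dual ?Y)" for f g
      using closed(1)[OF that] that L_add[OF Bs[OF that(1)] Bs[OF that(2)]] by (simp add: \<Phi>_def)
    show "\<Phi> (nscale (dual ?Y) c f) = c * \<Phi> f" if "f \<in> pts (dual ?Y)" for f c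
      using closed(2)[OF that that] that L_scale[OF Bs[OF that]] by (simp add: \<Phi>_def)
    show "\<exists>B. \<forall>f\<in>pts (dual ?Y). \<bar>\<Phi> f\<bar> \<le> B * nnorm (dual ?Y) f"
      by (rule exI[of _ 1]) (use L_bnd[OF bnd] in \<open>auto simp: \<Phi>_def simp del: dual_simps\<close>)
  qed
  then obtain x where x: "\<Phi> = canonical_embedding ?Y (T x)"
    using refl unfolding reflexive_def by auto
  have eval: "L (\<lambda>n. h (unit_vec n)) = h x"
    if "\<And>x y. h (x + y) = h x + h y" "\<And>c x. h (c *\<^sub>R x) = c * h x" "\<And>x. \<bar>h x\<bar> \<le> norm x" for h
    using fun_cong[OF x, of "\<lambda>y\<in>range T. h (inv T y)"] functional_on_range[of h, OF that]
    by (simp add: \<Phi>_def canonical_embedding_def)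
  have "coord x k = 0" for k
  proof -
    have "L (\<lambda>n. coord (unit_vec n) k) = coord x k"
      by (rule eval[of "\<lambda>x. coord x k"]) (auto simp: coord_le_norm)
    moreover have "(\<lambda>n. coord (unit_vec n) k) \<longlonglongrightarrow> 0"
      by (rule tendsto_eventually, rule eventually_sequentiallyI[of "Suc k"]) auto
    ultimately show ?thesis using L_lim by force
  qed
  moreover have "L (\<lambda>n. \<Sum>i. coord (unit_vec n) i) = (\<Sum>i. coord x i)"
    by (rule eval) (auto simp: suminf_add summable_coord' suminf_mult abs_suminf_coord_le)
  ultimately show False using L_lim[of "\<lambda>_. 1" 1] by (simp add: sum_unit_vec del: coord_unit_vec)
qed

end

theorem nonreflexive_FPP_subspace_if_copy:
  assumes "Metric_space (pts X) (ndist X)" and zero: "\<And>x. x \<in> pts X \<Longrightarrow> nscale X 0 x = nzero X"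
    and "contains_isometric_copy X (renormed_l1 N)"
  shows "\<exists>Y. closed_subspace X Y \<and> \<not> reflexive (restrict_nspace X Y) \<and> FPP (restrict_nspace X Y)"
proof -
  obtain T where T: "nlinear (renormed_l1 N) X T" "\<And>x. nnorm X (T x) = N x"
    using assms(3) by (auto simp: contains_isometric_copy_def)
  note * = assms(1) T
  have "nzero X = T 0"
    using T_scale[OF *, of 0 0] zero[OF T_pts[OF *]] by simp
  then show ?thesis
    using closed_subspace_range[OF *] not_reflexive_range[OF *] FPP_range[OF *] by blast
qed

end

lemma contains_isometric_copy_trans:
  assumes "contains_isometric_copy X Y" "contains_isometric_copy Y Z"
  shows "contains_isometric_copy X Z"
proof -
  obtain S T where "nlinear Y X S" "\<forall>y\<in>pts Y. nnorm X (S y) = nnorm Y y"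
    "nlinear Z Y T" "\<forall>y\<in>pts Z. nnorm Y (T y) = nnorm Z y"
    using assms by (auto simp: contains_isometric_copy_def)
  then show ?thesis
    unfolding contains_isometric_copy_def nlinear_def
    by (intro exI[of _ "S \<circ> T"]) (auto simp: Pi_iff)
qed

section \<open>A renorming inside \<open>ell_infty\<close>\<close>

definition lin_weight :: "nat \<Rightarrow> real" where "lin_weight k = 1 - 1 / (real k + 2)"

definition lin_norm :: "l1 \<Rightarrow> real" where
  "lin_norm x = (SUP k. lin_weight k * norm (tail k x))"

lemma lin_weight: "0 < lin_weight k" "lin_weight k \<le> 1" "j \<le> k \<Longrightarrow> lin_weight j \<le> lin_weight k"
  by (auto simp: lin_weight_def field_simps)

lemma lin_term_le_norm: "lin_weight k * norm (tail k x) \<le> norm x"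
  using mult_mono[OF lin_weight(2)[of k] norm_tail_le[of k x]] by simp

lemma lin_norm_ge: "lin_weight k * norm (tail k x) \<le> lin_norm x"
  unfolding lin_norm_def by (rule cSUP_upper) (auto intro!: bdd_aboveI2[of _ _ "norm x"] lin_term_le_norm)

lemma lin_norm_le: "(\<And>k. lin_weight k * norm (tail k x) \<le> B) \<Longrightarrow> lin_norm x \<le> B"
  unfolding lin_norm_def by (rule cSUP_least) auto

text \<open>A vector that is small compared to \<open>w\<close> and supported in the first \<open>k\<close> coordinates only enters the
  terms of the supremum with index below \<open>k\<close>. These carry weights at most \<open>lin_weight k < 1\<close> and so
  have room to spare; here the norm does not grow at all.\<close>

interpretation lin: l1_renorming lin_norm "\<lambda>k. 1 / (real k + 1)"
proof
  fix x y :: l1 and c d B :: real and k :: nat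
  show "lin_norm (x + y) \<le> lin_norm x + lin_norm y"
  proof (rule lin_norm_le)
    fix k
    have "lin_weight k * norm (tail k (x + y)) \<le> lin_weight k * (norm (tail k x) + norm (tail k y))"
      using lin_weight(1)[of k] by (intro mult_left_mono) (auto simp: tail_linear norm_triangle_ineq)
    also have "\<dots> \<le> lin_norm x + lin_norm y"
      using lin_norm_ge[of k x] lin_norm_ge[of k y] by (simp add: distrib_left)
    finally show "lin_weight k * norm (tail k (x + y)) \<le> lin_norm x + lin_norm y" .
  qed
  have le: "lin_norm (c *\<^sub>R x) \<le> \<bar>c\<bar> * lin_norm x" for c x
    by (rule lin_norm_le) (use mult_left_mono[OF lin_norm_ge, of "\<bar>c\<bar>"] in \<open>simp add: tail_linear mult.left_commute\<close>)
  show "lin_norm (c *\<^sub>R x) = \<bar>c\<bar> * lin_norm x"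
  proof (cases "c = 0")
    case True
    then show ?thesis using le[of 0 x] lin_norm_ge[of 0 "0 *\<^sub>R x"] by (auto simp: tail_linear)
  next
    case False
    have "\<bar>c\<bar> * lin_norm x \<le> \<bar>c\<bar> * (\<bar>inverse c\<bar> * lin_norm (c *\<^sub>R x))"
      using le[of "inverse c" "c *\<^sub>R x"] False by (intro mult_left_mono) auto
    also have "\<dots> = lin_norm (c *\<^sub>R x)" using False by (simp add: field_simps)
    finally show ?thesis using le[of c x] by linarith
  qed
  show "lin_norm x \<le> norm x" by (rule lin_norm_le[OF lin_term_le_norm])
  show "lin_norm (tail k x) \<le> lin_norm x"
  proof (rule lin_norm_le)
    fix j
    have "norm (tail j (tail k x)) \<le> norm (tail j x)" by (rule norm_l1_mono) auto
    then have "lin_weight j * norm (tail j (tail k x)) \<le> lin_weight j * norm (tail j x)"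
      using lin_weight(1)[of j] by (intro mult_left_mono) auto
    then show "lin_weight j * norm (tail j (tail k x)) \<le> lin_norm x"
      using lin_norm_ge[of j x] by linarith
  qed
  have tt: "tail k (tail k x) = tail k x" by (rule l1_eqI) auto
  have "(1 + 1 / (real k + 1)) * lin_weight k = 1"
    by (simp add: lin_weight_def divide_simps) (simp add: algebra_simps)
  then have "(1 + 1 / (real k + 1)) * (lin_weight k * norm (tail k x)) = norm (tail k x)"
    by (metis mult.assoc mult_1)
  then show "norm (tail k x) \<le> (1 + 1 / (real k + 1)) * lin_norm (tail k x)"
    using mult_left_mono[OF lin_norm_ge[of k "tail k x"], of "1 + 1 / (real k + 1)"]
    unfolding tt by (metis add_nonneg_nonneg divide_nonneg_nonneg of_nat_0_le_iff zero_le_one)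
  show "0 \<le> 1 / (real k + 1)" by simp
  show "(\<lambda>k. 1 / (real k + 1)) \<longlonglongrightarrow> 0"
    using LIMSEQ_inverse_real_of_nat by (simp add: inverse_eq_divide add.commute)
  assume cd: "0 < c" "0 < d"
  define q where "q = (real k + 2) * (\<bar>B\<bar> + 1)"
  have q: "0 < q" unfolding q_def by (intro mult_pos_pos) auto
  define t where "t = min 1 (c / q)"
  have "t * q \<le> c"
    using q by (simp add: t_def flip: pos_le_divide_eq)
  then have t: "t * q \<le> c" "0 < t" "t \<le> 1" 
    using cd q by (auto simp: t_def)
  have t: "0 < t" "t \<le> 1" "t * ((real k + 2) * (\<bar>B\<bar> + 1)) \<le> c"
    using t by (simp_all add: q_def)
  have "lin_norm (tail k w + t *\<^sub>R head k z) \<le> a"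
    if "c \<le> a" "norm (tail k w) \<le> a" "norm (head k z) \<le> B" for w z a
  proof (rule lin_norm_le)
    fix j
    show "lin_weight j * norm (tail j (tail k w + t *\<^sub>R head k z)) \<le> a"
    proof (cases "k \<le> j")
      case True
      then have "tail j (tail k w + t *\<^sub>R head k z) = tail j (tail k w)" by (intro l1_eqI) auto
      then show ?thesis using lin_term_le_norm[of j "tail k w"] that by simp
    next
      case False
      have "norm (tail j (tail k w + t *\<^sub>R head k z)) \<le> norm (tail k w + t *\<^sub>R head k z)"
        by (rule norm_tail_le)
      also have "\<dots> \<le> norm (tail k w) + t * norm (head k z)"
        using norm_triangle_ineq[of "tail k w" "t *\<^sub>R head k z"] t by simp
      also have "\<dots> \<le> a + t * (\<bar>B\<bar> + 1)"
        using that t by (intro add_mono mult_left_mono) auto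
      also have "\<dots> \<le> a + a / (real k + 2)"
        using t(3) that(1) by (simp add: field_simps)
      finally have "lin_weight j * norm (tail j (tail k w + t *\<^sub>R head k z))
          \<le> lin_weight k * (a + a / (real k + 2))"
        using False lin_weight[of j] lin_weight(1)[of k] by (intro mult_mono lin_weight(3)) auto
      also have "\<dots> = a * ((1 - 1 / (real k + 2)) * (1 + 1 / (real k + 2)))"
        by (simp add: lin_weight_def algebra_simps)
      also have "\<dots> = a * (1 - (1 / (real k + 2))^2)" by (simp add: power2_eq_square algebra_simps)
      also have "\<dots> \<le> a * 1" using that(1) cd by (intro mult_left_mono) auto
      finally show ?thesis by simp
    qed
  qed
  then show "\<exists>t>0. t \<le> 1 \<and> (\<forall>w z a. c \<le> a \<longrightarrow> norm (tail k w) \<le> a \<longrightarrow>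
      norm (head k z) \<le> B \<longrightarrow> lin_norm (tail k w + t *\<^sub>R head k z) \<le> a + d * t)"
    using t(1,2) cd by (intro exI[of _ t]) (auto intro!: add_increasing2)
qed

text \<open>The functionals whose supremum is \<open>lin_norm\<close>: the number \<open>s\<close> encodes the finite set of indices in
  \<open>{k..<m}\<close> that get the sign \<open>+\<close>.\<close>

definition signed_sum :: "nat \<Rightarrow> nat \<Rightarrow> nat \<Rightarrow> l1 \<Rightarrow> real" where
  "signed_sum k m s x =
    lin_weight k * (\<Sum>i\<in>{k..<m}. if i \<in> set_decode s then coord x i else - coord x i)"

lemma ell_infty_contains_renormed_l1: "contains_isometric_copy ell_infty (renormed_l1 lin_norm)"
proof -
  \<comment> \<open>A single index \<open>n\<close> enumerates all triples \<open>(k, m, s)\<close>.\<close>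
  define T where "T x n = (case prod_decode n of (k, r) \<Rightarrow> case prod_decode r of (m, s) \<Rightarrow> signed_sum k m s x)" for x n
  have le: "\<bar>signed_sum k m s x\<bar> \<le> lin_norm x" for k m s x
  proof -
    have "\<bar>\<Sum>i\<in>{k..<m}. if i \<in> set_decode s then coord x i else - coord x i\<bar> \<le> (\<Sum>i\<in>{k..<m}. \<bar>coord (tail k x) i\<bar>)"
      by (rule order_trans[OF sum_abs]) (auto intro!: sum_mono)
    also have "\<dots> \<le> norm (tail k x)" by (rule sum_coord_le_norm) simp
    finally have "\<bar>signed_sum k m s x\<bar> \<le> lin_weight k * norm (tail k x)"
      using lin_weight(1)[of k] by (simp add: signed_sum_def abs_mult mult_left_mono)
    then show ?thesis using lin_norm_ge[of k x] by linarith
  qed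
  have T_le: "\<bar>T x n\<bar> \<le> lin_norm x" for x n
    unfolding T_def using le by (auto split: prod.split)
  have bdd: "bdd_above (range (\<lambda>n. \<bar>T x n\<bar>))" for x
    by (rule bdd_aboveI2[of _ _ "lin_norm x"]) (rule T_le)
  have "(SUP n. \<bar>T x n\<bar>) = lin_norm x" for x
  proof (rule antisym)
    show "(SUP n. \<bar>T x n\<bar>) \<le> lin_norm x" by (rule cSUP_least) (auto simp: T_le)
    show "lin_norm x \<le> (SUP n. \<bar>T x n\<bar>)"
    proof (rule lin_norm_le)
      fix k
      have "(\<Sum>i<m. \<bar>coord (tail k x) i\<bar>) \<le> (SUP n. \<bar>T x n\<bar>) / lin_weight k" for m
      proof -
        define s where "s = set_encode {i\<in>{k..<m}. 0 \<le> coord x i}"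
        have s: "set_decode s = {i\<in>{k..<m}. 0 \<le> coord x i}" by (simp add: s_def)
        have "(\<Sum>i<m. \<bar>coord (tail k x) i\<bar>) = (\<Sum>i\<in>{k..<m}. \<bar>coord x i\<bar>)"
          by (rule sum.mono_neutral_cong_right) auto
        also have "\<dots> = (\<Sum>i\<in>{k..<m}. if i \<in> set_decode s then coord x i else - coord x i)"
          by (rule sum.cong) (auto simp: s)
        finally have "lin_weight k * (\<Sum>i<m. \<bar>coord (tail k x) i\<bar>) = T x (prod_encode (k, prod_encode (m, s)))"
          by (simp add: T_def signed_sum_def)
        also have "\<dots> \<le> (SUP n. \<bar>T x n\<bar>)"
          by (rule order_trans[OF abs_ge_self cSUP_upper[OF UNIV_I bdd]])
        finally show ?thesis using lin_weight(1)[of k] by (simp add: field_simps)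
      qed
      then have "norm (tail k x) \<le> (SUP n. \<bar>T x n\<bar>) / lin_weight k" by (rule norm_l1_leI)
      then show "lin_weight k * norm (tail k x) \<le> (SUP n. \<bar>T x n\<bar>)"
        using lin_weight(1)[of k] by (simp add: field_simps)
    qed
  qed
  moreover have "bounded (range (T x))" for x
    unfolding bounded_iff using T_le by auto
  moreover have "signed_sum k m s (x + y) = signed_sum k m s x + signed_sum k m s y" for k m s x y
    unfolding signed_sum_def distrib_left[symmetric] sum.distrib[symmetric]
    by (intro arg_cong2[where f="(*)"] sum.cong) auto
  moreover have "signed_sum k m s (c *\<^sub>R x) = c * signed_sum k m s x" for k m s x c
    unfolding signed_sum_def mult.left_commute[of c] sum_distrib_left[of c]
    by (intro arg_cong2[where f="(*)"] sum.cong) auto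
  ultimately show ?thesis
    unfolding contains_isometric_copy_def nlinear_def
    by (intro exI[of _ T]) (auto simp: ell_infty_def T_def fun_eq_iff split: prod.split)
qed

section \<open>The Luxemburg norm\<close>

lemma powr_convex_nonneg:
  fixes q x y a b :: real
  assumes q: "1 \<le> q" and xy: "0 \<le> x" "0 \<le> y" and ab: "0 \<le> a" "0 \<le> b" "a + b = 1"
  shows "(a * x + b * y) powr q \<le> a * x powr q + b * y powr q"
proof -
  have zero: "(c * z) powr q \<le> c * z powr q" if "0 \<le> c" "c \<le> 1" "0 \<le> z" for c z :: real
  proof (cases "c = 0")
    case False
    have "c powr q \<le> c powr 1" using that False q by (intro powr_mono') auto
    then show ?thesis using that False by (simp add: powr_mult mult_right_mono)
  qed (use q in simp)
  consider "x = 0" | "y = 0" | "0 < x" "0 < y" using xy by linarith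
  then show ?thesis
  proof cases
    case 3
    have a: "a = 1 - b" using ab by simp
    show ?thesis using convex_onD[OF powr_convex[OF q], of b x y] 3 ab(1,2) unfolding a by simp
  qed (use zero[of b y] zero[of a x] ab xy q in auto)
qed

locale variable_exponent = sigma_finite_measure M for M :: "'a measure" +
  fixes p :: "'a \<Rightarrow> ennreal"
  assumes p_measurable [measurable]: "p \<in> borel_measurable M"
    and p_ge_1: "t \<in> space M \<Longrightarrow> 1 \<le> p t"
begin

definition fin_part :: "'a set" where "fin_part = {t \<in> space M. p t < \<infinity>}"
definition inf_part :: "'a set" where "inf_part = {t \<in> space M. p t = \<infinity>}"

abbreviation expo :: "'a \<Rightarrow> real" where "expo t \<equiv> enn2real (p t)"

lemma parts_measurable [measurable]: "fin_part \<in> sets M" "inf_part \<in> sets M"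
  unfolding fin_part_def inf_part_def by measurable

lemma expo_ge_1: "t \<in> fin_part \<Longrightarrow> 1 \<le> expo t"
proof -
  assume "t \<in> fin_part"
  then have "1 \<le> p t" "p t < top" using p_ge_1 by (auto simp: fin_part_def)
  then show ?thesis using enn2real_mono[of 1 "p t"] by simp
qed

definition ess_inf_part :: "('a \<Rightarrow> real) \<Rightarrow> ennreal" where
  "ess_inf_part u = esssup (restrict_space M inf_part) (\<lambda>t. ennreal \<bar>u t\<bar>)"

lemma modular_eq:
  "modular M p u = (\<integral>\<^sup>+ t. ennreal (\<bar>u t\<bar> powr expo t) * indicator fin_part t \<partial>M) + ess_inf_part u"
  by (simp add: modular_def ess_inf_part_def fin_part_def inf_part_def)

lemma ess_inf_part_le_iff:
  assumes [measurable]: "u \<in> borel_measurable M"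
  shows "ess_inf_part u \<le> c \<longleftrightarrow> (AE t in M. t \<in> inf_part \<longrightarrow> ennreal \<bar>u t\<bar> \<le> c)"
proof -
  have AE_iff: "(AE t in restrict_space M inf_part. P t) \<longleftrightarrow> (AE t in M. t \<in> inf_part \<longrightarrow> P t)" for P
    by (rule AE_restrict_space_iff) measurable
  show ?thesis
  proof
    assume "ess_inf_part u \<le> c"
    moreover have "AE t in M. t \<in> inf_part \<longrightarrow> ennreal \<bar>u t\<bar> \<le> ess_inf_part u"
      using esssup_AE[where M="restrict_space M inf_part" and f="\<lambda>t. ennreal \<bar>u t\<bar>"]
      unfolding AE_iff ess_inf_part_def .
    ultimately show "AE t in M. t \<in> inf_part \<longrightarrow> ennreal \<bar>u t\<bar> \<le> c" by (auto elim!: AE_mp)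
  next
    assume "AE t in M. t \<in> inf_part \<longrightarrow> ennreal \<bar>u t\<bar> \<le> c"
    then show "ess_inf_part u \<le> c"
      unfolding ess_inf_part_def by (intro esssup_I measurable_restrict_space1) (auto simp: AE_iff)
  qed
qed

lemma ess_inf_part_AE: 
  assumes [measurable]: "u \<in> borel_measurable M"
  shows "AE t in M. t \<in> inf_part \<longrightarrow> ennreal \<bar>u t\<bar> \<le> ess_inf_part u"
  using ess_inf_part_le_iff[OF assms] by blast

lemma modular_mono:
  assumes [measurable]: "u \<in> borel_measurable M" "v \<in> borel_measurable M"
    and le: "AE t in M. \<bar>u t\<bar> \<le> \<bar>v t\<bar>"
  shows "modular M p u \<le> modular M p v"
  unfolding modular_eq
proof (intro add_mono nn_integral_mono_AE)
  show "AE t in M. ennreal (\<bar>u t\<bar> powr expo t) * indicator fin_part t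
      \<le> ennreal (\<bar>v t\<bar> powr expo t) * indicator fin_part t"
    using le by eventually_elim (auto intro!: ennreal_leI powr_mono2 dest: expo_ge_1 simp: indicator_def)
  show "ess_inf_part u \<le> ess_inf_part v"
    unfolding ess_inf_part_le_iff[OF assms(1)]
    using le ess_inf_part_AE[OF assms(2)] by eventually_elim (auto intro: order_trans ennreal_leI)
qed

lemma modular_cong:
  assumes "u \<in> borel_measurable M" "v \<in> borel_measurable M" "AE t in M. u t = v t"
  shows "modular M p u = modular M p v"
  by (intro antisym modular_mono assms eventually_mono[OF assms(3)]) auto

lemma modular_convex:
  assumes [measurable]: "u \<in> borel_measurable M" "v \<in> borel_measurable M"
    and ab: "0 \<le> a" "0 \<le> b" "a + b = 1"
  shows "modular M p (\<lambda>t. a * u t + b * v t) \<le> ennreal a * modular M p u + ennreal b * modular M p v"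
proof -
  let ?I = "\<lambda>u. (\<integral>\<^sup>+ t. ennreal (\<bar>u t\<bar> powr expo t) * indicator fin_part t \<partial>M)"
  have "?I (\<lambda>t. a * u t + b * v t) \<le> (\<integral>\<^sup>+ t. ennreal a * (ennreal (\<bar>u t\<bar> powr expo t) * indicator fin_part t)
      + ennreal b * (ennreal (\<bar>v t\<bar> powr expo t) * indicator fin_part t) \<partial>M)"
  proof (rule nn_integral_mono)
    fix t
    show "ennreal (\<bar>a * u t + b * v t\<bar> powr expo t) * indicator fin_part t
      \<le> ennreal a * (ennreal (\<bar>u t\<bar> powr expo t) * indicator fin_part t)
      + ennreal b * (ennreal (\<bar>v t\<bar> powr expo t) * indicator fin_part t)"
    proof (cases "t \<in> fin_part")
      case True
      have "\<bar>a * u t + b * v t\<bar> \<le> a * \<bar>u t\<bar> + b * \<bar>v t\<bar>"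
        using abs_triangle_ineq[of "a * u t" "b * v t"] ab by (simp add: abs_mult)
      then have "\<bar>a * u t + b * v t\<bar> powr expo t \<le> (a * \<bar>u t\<bar> + b * \<bar>v t\<bar>) powr expo t"
        using expo_ge_1[OF True] by (intro powr_mono2) auto
      also have "\<dots> \<le> a * \<bar>u t\<bar> powr expo t + b * \<bar>v t\<bar> powr expo t"
        using expo_ge_1[OF True] ab by (intro powr_convex_nonneg) auto
      finally have "ennreal (\<bar>a * u t + b * v t\<bar> powr expo t)
          \<le> ennreal (a * \<bar>u t\<bar> powr expo t + b * \<bar>v t\<bar> powr expo t)" by (rule ennreal_leI)
      then show ?thesis using True ab by (simp add: ennreal_plus ennreal_mult)
    qed simp
  qed
  also have "\<dots> = ennreal a * ?I u + ennreal b * ?I v"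
    by (simp add: nn_integral_add nn_integral_cmult)
  finally have I: "?I (\<lambda>t. a * u t + b * v t) \<le> ennreal a * ?I u + ennreal b * ?I v" .
  have E: "ess_inf_part (\<lambda>t. a * u t + b * v t) \<le> ennreal a * ess_inf_part u + ennreal b * ess_inf_part v"
  proof (subst ess_inf_part_le_iff)
    show "AE t in M. t \<in> inf_part \<longrightarrow>
        ennreal \<bar>a * u t + b * v t\<bar> \<le> ennreal a * ess_inf_part u + ennreal b * ess_inf_part v"
      using ess_inf_part_AE[OF assms(1)] ess_inf_part_AE[OF assms(2)]
    proof eventually_elim
      case (elim t)
      show ?case
      proof
        assume t: "t \<in> inf_part"
        have "\<bar>a * u t + b * v t\<bar> \<le> a * \<bar>u t\<bar> + b * \<bar>v t\<bar>"
          using abs_triangle_ineq[of "a * u t" "b * v t"] ab by (simp add: abs_mult)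
        then have "ennreal \<bar>a * u t + b * v t\<bar> \<le> ennreal a * ennreal \<bar>u t\<bar> + ennreal b * ennreal \<bar>v t\<bar>"
          using ab by (simp add: ennreal_leI flip: ennreal_plus ennreal_mult)
        also have "\<dots> \<le> ennreal a * ess_inf_part u + ennreal b * ess_inf_part v"
          using elim t by (intro add_mono mult_left_mono) auto
        finally show "ennreal \<bar>a * u t + b * v t\<bar> \<le> ennreal a * ess_inf_part u + ennreal b * ess_inf_part v" .
      qed
    qed
  qed measurable
  show ?thesis
    unfolding modular_eq using add_mono[OF I E] by (simp add: distrib_left ac_simps)
qed

lemma modular_zero: "modular M p (\<lambda>_. 0) = 0"
proof -
  have "ess_inf_part (\<lambda>_. 0) \<le> 0" by (subst ess_inf_part_le_iff) auto
  moreover have "(\<lambda>t. ennreal (\<bar>0\<bar> powr expo t) * indicator fin_part t) = (\<lambda>_. 0)"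
    by (auto simp: fun_eq_iff)
  ultimately show ?thesis by (simp add: modular_eq)
qed

text \<open>Convexity, with value 0 at 0, is what links the size of the modular to that of the norm.\<close>

lemma modular_scale_le:
  assumes "u \<in> borel_measurable M" "0 \<le> a" "a \<le> 1"
  shows "modular M p (\<lambda>t. a * u t) \<le> ennreal a * modular M p u"
  using modular_convex[of u "\<lambda>_. 0" a "1 - a"] assms by (simp add: modular_zero)

lemma modular_divide_mono:
  assumes [measurable]: "u \<in> borel_measurable M" and "0 < \<alpha>" "\<alpha> \<le> \<beta>"
  shows "modular M p (\<lambda>t. u t / \<beta>) \<le> modular M p (\<lambda>t. u t / \<alpha>)"
  using assms(2,3) by (intro modular_mono AE_I2) (auto simp: abs_divide intro!: divide_left_mono)

lemma Lvar_fun_measurable [measurable_dest]: "u \<in> Lvar_fun M p \<Longrightarrow> u \<in> borel_measurable M"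
  by (simp add: Lvar_fun_def)

lemma luxemburg_set_nonempty:
  assumes "u \<in> Lvar_fun M p"
  shows "{\<alpha>. 0 < \<alpha> \<and> modular M p (\<lambda>t. u t / \<alpha>) \<le> 1} \<noteq> {}"
proof -
  from assms obtain c where [measurable]: "u \<in> borel_measurable M" and c: "0 < c" "modular M p (\<lambda>t. u t / c) < \<infinity>"
    by (auto simp: Lvar_fun_def)
  define r where "r = enn2real (modular M p (\<lambda>t. u t / c))"
  have r: "modular M p (\<lambda>t. u t / c) = ennreal r" "0 \<le> r" using c by (auto simp: r_def)
  define K where "K = max 1 r"
  have K: "1 \<le> K" "r \<le> K" by (auto simp: K_def)
  have "modular M p (\<lambda>t. u t / (c * K)) = modular M p (\<lambda>t. (1 / K) * (u t / c))"
    by (simp add: mult.commute)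
  also have "\<dots> \<le> ennreal (1 / K) * modular M p (\<lambda>t. u t / c)"
    using K by (intro modular_scale_le) auto
  also have "\<dots> = ennreal (1 / K * r)"
    unfolding r(1) using K r(2) by (intro ennreal_mult[symmetric]) auto
  also have "\<dots> \<le> 1" using K by simp
  finally have "c * K \<in> {\<alpha>. 0 < \<alpha> \<and> modular M p (\<lambda>t. u t / \<alpha>) \<le> 1}" using c K by simp
  then show ?thesis by blast
qed

lemma luxemburg_le:
  assumes "0 < \<alpha>" "modular M p (\<lambda>t. u t / \<alpha>) \<le> 1"
  shows "luxemburg M p u \<le> \<alpha>"
  unfolding luxemburg_def by (rule cInf_lower) (use assms in \<open>auto intro!: bdd_belowI[of _ 0]\<close>)

lemma luxemburg_nonneg: "u \<in> Lvar_fun M p \<Longrightarrow> 0 \<le> luxemburg M p u"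
  unfolding luxemburg_def by (rule cInf_greatest[OF luxemburg_set_nonempty]) auto

lemma modular_le_1:
  assumes u: "u \<in> Lvar_fun M p" and less: "luxemburg M p u < \<alpha>"
  shows "modular M p (\<lambda>t. u t / \<alpha>) \<le> 1"
proof -
  obtain \<beta> where \<beta>: "0 < \<beta>" "modular M p (\<lambda>t. u t / \<beta>) \<le> 1" "\<beta> < \<alpha>"
    using cInf_lessD[OF luxemburg_set_nonempty[OF u]] less unfolding luxemburg_def by blast
  then show ?thesis using modular_divide_mono[OF Lvar_fun_measurable[OF u], of \<beta> \<alpha>] by simp
qed

lemma Lvar_funI:
  assumes "u \<in> borel_measurable M" "0 < \<alpha>" "modular M p (\<lambda>t. u t / \<alpha>) \<le> 1"
  shows "u \<in> Lvar_fun M p"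
proof -
  have "modular M p (\<lambda>t. u t / \<alpha>) < \<infinity>"
    using assms(3) by (rule order.strict_trans1) simp
  then show ?thesis using assms by (auto simp: Lvar_fun_def)
qed

lemma modular_add_le_1:
  assumes [measurable]: "u \<in> borel_measurable M" "v \<in> borel_measurable M"
    and \<alpha>: "0 < \<alpha>" "modular M p (\<lambda>t. u t / \<alpha>) \<le> 1" and \<beta>: "0 < \<beta>" "modular M p (\<lambda>t. v t / \<beta>) \<le> 1"
  shows "modular M p (\<lambda>t. (u t + v t) / (\<alpha> + \<beta>)) \<le> 1"
proof -
  let ?a = "\<alpha> / (\<alpha> + \<beta>)" and ?b = "\<beta> / (\<alpha> + \<beta>)"
  have ab: "0 \<le> ?a" "0 \<le> ?b" "?a + ?b = 1" using \<alpha> \<beta> by (auto simp flip: add_divide_distrib)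
  have "(\<lambda>t. (u t + v t) / (\<alpha> + \<beta>)) = (\<lambda>t. ?a * (u t / \<alpha>) + ?b * (v t / \<beta>))"
    using \<alpha> \<beta> by (simp add: fun_eq_iff add_divide_distrib)
  then have "modular M p (\<lambda>t. (u t + v t) / (\<alpha> + \<beta>))
      \<le> ennreal ?a * modular M p (\<lambda>t. u t / \<alpha>) + ennreal ?b * modular M p (\<lambda>t. v t / \<beta>)"
    using modular_convex[of "\<lambda>t. u t / \<alpha>" "\<lambda>t. v t / \<beta>", OF _ _ ab] by simp
  also have "\<dots> \<le> ennreal ?a * 1 + ennreal ?b * 1"
    using \<alpha> \<beta> by (intro add_mono mult_left_mono) auto
  also have "\<dots> = 1" using ab by (simp flip: ennreal_plus)
  finally show ?thesis .
qed

lemma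
  assumes u: "u \<in> Lvar_fun M p" and v: "v \<in> Lvar_fun M p"
  shows Lvar_fun_add: "(\<lambda>t. u t + v t) \<in> Lvar_fun M p"
    and luxemburg_triangle: "luxemburg M p (\<lambda>t. u t + v t) \<le> luxemburg M p u + luxemburg M p v"
proof -
  have [measurable]: "u \<in> borel_measurable M" "v \<in> borel_measurable M"
    using assms by (auto simp: Lvar_fun_def)
  have *: "modular M p (\<lambda>t. (u t + v t) / ((luxemburg M p u + e) + (luxemburg M p v + e))) \<le> 1"
    and pos: "0 < luxemburg M p u + e" "0 < luxemburg M p v + e" if "0 < e" for e
  proof -
    show pos: "0 < luxemburg M p u + e" "0 < luxemburg M p v + e"
      using luxemburg_nonneg[OF u] luxemburg_nonneg[OF v] that by auto
    show "modular M p (\<lambda>t. (u t + v t) / ((luxemburg M p u + e) + (luxemburg M p v + e))) \<le> 1"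
      using that by (intro modular_add_le_1 pos modular_le_1 u v) auto
  qed
  show "(\<lambda>t. u t + v t) \<in> Lvar_fun M p"
    by (rule Lvar_funI[OF _ _ *[of 1]]) (use pos[of 1] in auto)
  show "luxemburg M p (\<lambda>t. u t + v t) \<le> luxemburg M p u + luxemburg M p v"
  proof (rule field_le_epsilon)
    fix e :: real assume "0 < e"
    then show "luxemburg M p (\<lambda>t. u t + v t) \<le> luxemburg M p u + luxemburg M p v + e"
      using luxemburg_le[OF _ *[of "e/2"]] pos[of "e/2"] by simp
  qed
qed

lemma modular_scale_divide:
  assumes "c \<noteq> 0"
  shows "modular M p (\<lambda>t. c * u t / (\<bar>c\<bar> * \<alpha>)) = modular M p (\<lambda>t. u t / \<alpha>)"
proof -
  have "\<bar>c * u t / (\<bar>c\<bar> * \<alpha>)\<bar> = \<bar>u t / \<alpha>\<bar>" for t using assms by (simp add: abs_mult)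
  then show ?thesis unfolding modular_def by simp
qed

lemma
  assumes u: "u \<in> Lvar_fun M p"
  shows Lvar_fun_scale: "(\<lambda>t. c * u t) \<in> Lvar_fun M p"
    and luxemburg_scale: "luxemburg M p (\<lambda>t. c * u t) = \<bar>c\<bar> * luxemburg M p u"
proof -
  have um [measurable]: "u \<in> borel_measurable M" using u by (rule Lvar_fun_measurable)
  obtain \<alpha> where \<alpha>: "0 < \<alpha>" "modular M p (\<lambda>t. u t / \<alpha>) \<le> 1"
    using luxemburg_set_nonempty[OF u] by blast
  have mem: "(\<lambda>t. c * u t) \<in> Lvar_fun M p" for c
  proof (cases "c = 0")
    case True
    then show ?thesis using Lvar_funI[of "\<lambda>_. 0" 1] by (simp add: modular_zero)
  next
    case False
    then show ?thesis using \<alpha> by (intro Lvar_funI[of _ "\<bar>c\<bar> * \<alpha>"]) (auto simp: modular_scale_divide)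
  qed
  then show "(\<lambda>t. c * u t) \<in> Lvar_fun M p" .
  have le: "luxemburg M p (\<lambda>t. c * v t) \<le> \<bar>c\<bar> * luxemburg M p v" if v: "v \<in> Lvar_fun M p" "c \<noteq> 0" for c v
  proof (rule field_le_epsilon)
    fix e :: real assume "0 < e"
    define \<alpha> where "\<alpha> = luxemburg M p v + e / \<bar>c\<bar>"
    have "luxemburg M p v < \<alpha>" using \<open>0 < e\<close> that by (simp add: \<alpha>_def)
    then have "0 < \<alpha>" "modular M p (\<lambda>t. v t / \<alpha>) \<le> 1"
      using luxemburg_nonneg[OF v(1)] modular_le_1[OF v(1)] by auto
    moreover have "modular M p (\<lambda>t. c * v t / (\<bar>c\<bar> * \<alpha>)) = modular M p (\<lambda>t. v t / \<alpha>)"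
      using that by (intro modular_scale_divide) auto
    ultimately have "luxemburg M p (\<lambda>t. c * v t) \<le> \<bar>c\<bar> * \<alpha>"
      using that by (intro luxemburg_le) auto
    also have "\<dots> = \<bar>c\<bar> * luxemburg M p v + e" using that by (simp add: \<alpha>_def distrib_left)
    finally show "luxemburg M p (\<lambda>t. c * v t) \<le> \<bar>c\<bar> * luxemburg M p v + e" .
  qed
  show "luxemburg M p (\<lambda>t. c * u t) = \<bar>c\<bar> * luxemburg M p u"
  proof (cases "c = 0")
    case True
    have "luxemburg M p (\<lambda>_. 0) \<le> e" if "0 < e" for e
      using luxemburg_le[OF that] by (simp add: modular_zero)
    then have "luxemburg M p (\<lambda>_. 0) \<le> 0" by (metis dense not_le)
    then show ?thesis using True luxemburg_nonneg[OF mem[of 0]] by simp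
  next
    case False
    have "\<bar>c\<bar> * luxemburg M p u \<le> \<bar>c\<bar> * (\<bar>inverse c\<bar> * luxemburg M p (\<lambda>t. c * u t))"
      using le[OF mem[of c], of "inverse c"] False by (intro mult_left_mono) (auto simp flip: mult.assoc)
    also have "\<dots> = luxemburg M p (\<lambda>t. c * u t)" using False by simp
    finally show ?thesis using le[OF u False] by linarith
  qed
qed

lemma Lvar_fun_diff: "u \<in> Lvar_fun M p \<Longrightarrow> v \<in> Lvar_fun M p \<Longrightarrow> (\<lambda>t. u t - v t) \<in> Lvar_fun M p"
  using Lvar_fun_add[OF _ Lvar_fun_scale, of u v "-1"] by simp

lemma luxemburg_cong:
  assumes [measurable]: "u \<in> borel_measurable M" "v \<in> borel_measurable M" and eq: "AE t in M. u t = v t"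
  shows "luxemburg M p u = luxemburg M p v" and "u \<in> Lvar_fun M p \<longleftrightarrow> v \<in> Lvar_fun M p"
proof -
  have "modular M p (\<lambda>t. u t / c) = modular M p (\<lambda>t. v t / c)" for c
    by (rule modular_cong) (use eq in auto)
  then show "luxemburg M p u = luxemburg M p v" "u \<in> Lvar_fun M p \<longleftrightarrow> v \<in> Lvar_fun M p"
    by (auto simp: luxemburg_def Lvar_fun_def)
qed

text \<open>If the norm is zero, all multiples of \<open>u\<close> have modular at most 1, and convexity
  makes the modular of \<open>u\<close> itself zero.\<close>

lemma luxemburg_eq_0:
  assumes u: "u \<in> Lvar_fun M p" and zero: "luxemburg M p u = 0"
  shows "AE t in M. u t = 0"
proof -
  have [measurable]: "u \<in> borel_measurable M" using u by (rule Lvar_fun_measurable)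
  have small: "modular M p u \<le> ennreal \<alpha>" if "0 < \<alpha>" "\<alpha> < 1" for \<alpha>
  proof -
    have "modular M p u = modular M p (\<lambda>t. \<alpha> * (u t / \<alpha>))" using that by simp
    also have "\<dots> \<le> ennreal \<alpha> * modular M p (\<lambda>t. u t / \<alpha>)" by (rule modular_scale_le) (use that in auto)
    also have "\<dots> \<le> ennreal \<alpha> * 1" using modular_le_1[OF u, of \<alpha>] zero that by (intro mult_left_mono) auto
    finally show ?thesis by simp
  qed
  have "modular M p u = 0"
  proof (rule ccontr)
    assume "modular M p u \<noteq> 0"
    moreover have "modular M p u \<le> ennreal (1/2)" by (rule small) auto
    ultimately obtain r where r: "0 < r" "modular M p u = ennreal r"
      by (cases "modular M p u") (auto simp: top_unique)
    define \<alpha> where "\<alpha> = min (r/2) (1/2)"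
    have \<alpha>: "0 < \<alpha>" "\<alpha> < 1" "\<alpha> < r" using r(1) by (auto simp: \<alpha>_def min_def)
    have "ennreal r \<le> ennreal \<alpha>" using small[OF \<alpha>(1,2)] r(2) by simp
    then show False using \<alpha> by (simp add: ennreal_le_iff)
  qed
  then have I: "(\<integral>\<^sup>+ t. ennreal (\<bar>u t\<bar> powr expo t) * indicator fin_part t \<partial>M) = 0"
    and E: "ess_inf_part u \<le> 0" by (auto simp: modular_eq)
  have "AE t in M. ennreal (\<bar>u t\<bar> powr expo t) * indicator fin_part t = 0"
    using I by (subst (asm) nn_integral_0_iff_AE) auto
  moreover have "AE t in M. t \<in> inf_part \<longrightarrow> ennreal \<bar>u t\<bar> \<le> 0"
    using E unfolding ess_inf_part_le_iff[OF \<open>u \<in> borel_measurable M\<close>] .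
  ultimately show ?thesis
    using AE_space
  proof eventually_elim
    case (elim t)
    then show ?case by (cases "p t = \<infinity>") (auto simp: fin_part_def inf_part_def top.not_eq_extremum)
  qed
qed

subsection \<open>The space of classes\<close>

definition cls :: "('a \<Rightarrow> real) \<Rightarrow> ('a \<Rightarrow> real) set" where "cls u = ae_eq M `` {u}"

lemma mem_cls_iff: "v \<in> cls u \<longleftrightarrow> u \<in> borel_measurable M \<and> v \<in> borel_measurable M \<and> (AE t in M. u t = v t)"
  by (simp add: cls_def ae_eq_def)

lemma equiv_ae_eq: "equiv (borel_measurable M) (ae_eq M)"
proof (rule equivI)
  show "sym (ae_eq M)" by (auto simp: sym_def ae_eq_def elim: AE_mp)
  show "trans (ae_eq M)" by (auto simp: trans_def ae_eq_def elim: AE_mp)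
qed (auto simp: refl_on_def ae_eq_def)

lemma cls_eq_iff:
  "u \<in> borel_measurable M \<Longrightarrow> v \<in> borel_measurable M \<Longrightarrow> cls u = cls v \<longleftrightarrow> (AE t in M. u t = v t)"
  unfolding cls_def eq_equiv_class_iff[OF equiv_ae_eq] by (simp add: ae_eq_def)

lemma pts_Lvar: "pts (Lvar M p) = cls ` Lvar_fun M p"
  by (auto simp: Lvar_def quotient_def cls_def)

lemma nzero_Lvar: "nzero (Lvar M p) = cls (\<lambda>_. 0)"
  by (simp add: Lvar_def cls_def)

lemma nadd_cls:
  assumes [measurable]: "u \<in> borel_measurable M" "v \<in> borel_measurable M"
  shows "nadd (Lvar M p) (cls u) (cls v) = cls (\<lambda>t. u t + v t)"
proof -
  have "cls (\<lambda>t. f t + g t) = cls (\<lambda>t. u t + v t)" if "f \<in> cls u" "g \<in> cls v" for f g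
    using that by (subst cls_eq_iff) (auto simp: mem_cls_iff elim: eventually_elim2)
  moreover have "u \<in> cls u" "v \<in> cls v" by (auto simp: mem_cls_iff)
  ultimately have "(\<Union>f\<in>cls u. \<Union>g\<in>cls v. cls (\<lambda>t. f t + g t)) = cls (\<lambda>t. u t + v t)" by blast
  then show ?thesis by (simp add: Lvar_def cls_def)
qed

lemma nscale_cls:
  assumes [measurable]: "u \<in> borel_measurable M"
  shows "nscale (Lvar M p) c (cls u) = cls (\<lambda>t. c * u t)"
proof -
  have "cls (\<lambda>t. c * f t) = cls (\<lambda>t. c * u t)" if "f \<in> cls u" for f
  proof -
    have f: "f \<in> borel_measurable M" "AE t in M. u t = f t" using that by (auto simp: mem_cls_iff)
    have "AE t in M. c * f t = c * u t" using f(2) by eventually_elim simp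
    then show ?thesis using f(1) by (subst cls_eq_iff) auto
  qed
  moreover have "u \<in> cls u" by (auto simp: mem_cls_iff)
  ultimately have "(\<Union>f\<in>cls u. cls (\<lambda>t. c * f t)) = cls (\<lambda>t. c * u t)" by blast
  then show ?thesis by (simp add: Lvar_def cls_def)
qed

lemma nnorm_cls:
  assumes u: "u \<in> borel_measurable M"
  shows "nnorm (Lvar M p) (cls u) = luxemburg M p u"
proof -
  have "luxemburg M p f = luxemburg M p u" if "f \<in> cls u" for f
    using that by (intro luxemburg_cong) (auto simp: mem_cls_iff elim: eventually_elim2)
  moreover have "u \<in> cls u" using u by (auto simp: mem_cls_iff)
  ultimately have "luxemburg M p ` cls u = {luxemburg M p u}" by blast
  then show ?thesis by (simp add: Lvar_def)
qed

lemma ndist_cls: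
  assumes "u \<in> Lvar_fun M p" "v \<in> Lvar_fun M p"
  shows "ndist (Lvar M p) (cls u) (cls v) = luxemburg M p (\<lambda>t. u t - v t)"
proof -
  have [measurable]: "u \<in> borel_measurable M" "v \<in> borel_measurable M"
    using assms by (auto simp: Lvar_fun_def)
  show ?thesis
    using assms by (simp add: ndist_def pts_Lvar nscale_cls nadd_cls nnorm_cls)
qed

lemma Metric_space_Lvar: "Metric_space (pts (Lvar M p)) (ndist (Lvar M p))"
proof -
  let ?d = "ndist (Lvar M p)" and ?P = "pts (Lvar M p)"
  have off: "?d x y = 0" if "\<not> (x \<in> ?P \<and> y \<in> ?P)" for x y
    using that by (auto simp: ndist_def)
  have comm: "luxemburg M p (\<lambda>t. u t - v t) = luxemburg M p (\<lambda>t. v t - u t)"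
    if "u \<in> Lvar_fun M p" "v \<in> Lvar_fun M p" for u v
    using luxemburg_scale[OF Lvar_fun_diff[OF that], of "-1"] by simp
  show ?thesis
  proof
    fix x y z
    show "0 \<le> ?d x y"
      using off[of x y] by (cases "x \<in> ?P \<and> y \<in> ?P") (auto simp: pts_Lvar ndist_cls intro!: luxemburg_nonneg Lvar_fun_diff)
    show "?d x y = ?d y x"
      using off[of x y] off[of y x] by (cases "x \<in> ?P \<and> y \<in> ?P") (auto simp: pts_Lvar ndist_cls intro!: comm)
    show "?d x y = 0 \<longleftrightarrow> x = y" if xy: "x \<in> ?P" "y \<in> ?P"
    proof -
      obtain u v where uv: "x = cls u" "y = cls v" "u \<in> Lvar_fun M p" "v \<in> Lvar_fun M p"
        using xy by (auto simp: pts_Lvar)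
      have m [measurable]: "u \<in> borel_measurable M" "v \<in> borel_measurable M" using uv by (auto simp: Lvar_fun_def)
      show ?thesis
      proof
        assume "?d x y = 0"
        then have "AE t in M. u t - v t = 0"
          using uv by (intro luxemburg_eq_0) (auto simp: ndist_cls intro!: Lvar_fun_diff)
        then show "x = y" using uv m by (auto simp: cls_eq_iff)
      next
        assume "x = y"
        then show "?d x y = 0"
          using uv luxemburg_scale[OF uv(3), of 0] by (simp add: ndist_cls)
      qed
    qed
    show "?d x z \<le> ?d x y + ?d y z" if xyz: "x \<in> ?P" "y \<in> ?P" "z \<in> ?P"
    proof -
      obtain u v w where uv: "x = cls u" "y = cls v" "z = cls w"
          "u \<in> Lvar_fun M p" "v \<in> Lvar_fun M p" "w \<in> Lvar_fun M p"
        using xyz by (auto simp: pts_Lvar)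
      then show ?thesis
        using luxemburg_triangle[OF Lvar_fun_diff[OF uv(4,5)] Lvar_fun_diff[OF uv(5,6)]]
        by (simp add: ndist_cls)
    qed
  qed
qed

lemma nscale_0_Lvar: "x \<in> pts (Lvar M p) \<Longrightarrow> nscale (Lvar M p) 0 x = nzero (Lvar M p)"
  by (auto simp: pts_Lvar nscale_cls nzero_Lvar Lvar_fun_measurable)

lemma contains_isometric_copyI:
  assumes mem: "\<And>x. x \<in> pts Y \<Longrightarrow> G x \<in> Lvar_fun M p"
    and add: "\<And>x y. x \<in> pts Y \<Longrightarrow> y \<in> pts Y \<Longrightarrow> G (nadd Y x y) = (\<lambda>t. G x t + G y t)"
    and scale: "\<And>c x. x \<in> pts Y \<Longrightarrow> G (nscale Y c x) = (\<lambda>t. c * G x t)"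
    and norm: "\<And>x. x \<in> pts Y \<Longrightarrow> luxemburg M p (G x) = nnorm Y x"
  shows "contains_isometric_copy (Lvar M p) Y"
  unfolding contains_isometric_copy_def nlinear_def
  using assms Lvar_fun_measurable[OF mem]
  by (intro exI[of _ "\<lambda>x. cls (G x)"]) (auto simp: pts_Lvar nadd_cls nscale_cls nnorm_cls)

end

section \<open>Disjoint sets of positive measure\<close>

context sigma_finite_measure
begin

lemma finite_positive_subset:
  assumes A: "A \<in> sets M" "0 < emeasure M A"
  obtains B where "B \<in> sets M" "B \<subseteq> A" "0 < emeasure M B" "emeasure M B < \<infinity>"
proof -
  obtain C :: "nat \<Rightarrow> 'a set" where C: "range C \<subseteq> sets M" "(\<Union>i. C i) = space M" "\<And>i. emeasure M (C i) \<noteq> \<infinity>"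
    using sigma_finite by metis
  have "\<exists>i. 0 < emeasure M (A \<inter> C i)"
  proof (rule ccontr)
    assume "\<not> ?thesis"
    then have "A \<inter> C i \<in> null_sets M" for i using A C by (auto simp: null_sets_def)
    then have "(\<Union>i. A \<inter> C i) \<in> null_sets M" by (rule null_sets_UN)
    moreover have "(\<Union>i. A \<inter> C i) = A" using C(2) sets.sets_into_space[OF A(1)] by blast
    ultimately show False using A by auto
  qed
  then obtain i where i: "0 < emeasure M (A \<inter> C i)" by blast
  have "emeasure M (A \<inter> C i) \<le> emeasure M (C i)" using C(1) by (intro emeasure_mono) auto
  then have "emeasure M (A \<inter> C i) < \<infinity>" using C(3)[of i] by (simp add: less_top[symmetric] top_unique) (metis top.not_eq_extremum order.strict_trans1)
  with i A C(1) show thesis by (intro that[of "A \<inter> C i"]) auto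
qed

lemma finite_positive_subsets:
  fixes A :: "nat \<Rightarrow> 'a set"
  assumes "\<And>n. A n \<in> sets M" "\<And>n. 0 < emeasure M (A n)" "disjoint_family A"
  obtains B where "\<And>n. B n \<in> sets M" "\<And>n. B n \<subseteq> A n" "\<And>n. 0 < measure M (B n)"
    "\<And>n. emeasure M (B n) = ennreal (measure M (B n))" "disjoint_family B"
proof -
  have "\<exists>B. B \<in> sets M \<and> B \<subseteq> A n \<and> 0 < emeasure M B \<and> emeasure M B < \<infinity>" for n
    using finite_positive_subset[OF assms(1,2)] by metis
  then obtain B where B: "\<And>n. B n \<in> sets M \<and> B n \<subseteq> A n \<and> 0 < emeasure M (B n) \<and> emeasure M (B n) < \<infinity>"
    by metis
  have fin: "emeasure M (B n) = ennreal (measure M (B n))" for n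
    using B[of n] by (intro emeasure_eq_ennreal_measure) auto
  moreover have "0 < measure M (B n)" for n
    using B[of n] fin[of n] by (metis ennreal_less_zero_iff)
  moreover have "disjoint_family B" using assms(3) B unfolding disjoint_family_on_def by blast
  ultimately show thesis using B that by blast
qed

text \<open>The sets are level sets \<open>D (n + 1) \<le> h < min (D n) (e n)\<close> for levels chosen one after the other: each layer
  \<open>0 < h < b\<close> is the union of the layers \<open>1/k \<le> h < b\<close>, so one of these has positive measure.
  The lower bound by a positive constant on each set comes from this choice.\<close>

lemma disjoint_sets_small_values:
  fixes h :: "'a \<Rightarrow> real" and e :: "nat \<Rightarrow> real"
  assumes [measurable]: "h \<in> borel_measurable M" "S \<in> sets M"
    and small: "\<And>e. 0 < e \<Longrightarrow> 0 < emeasure M {t \<in> S. 0 < h t \<and> h t < e}"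
    and e: "\<And>n. 0 < e n"
  obtains A \<delta> where "\<And>n. A n \<in> sets M" "\<And>n. A n \<subseteq> S" "\<And>n. 0 < measure M (A n)"
    "\<And>n. emeasure M (A n) = ennreal (measure M (A n))" "disjoint_family A"
    "\<And>n. 0 < \<delta> n" "\<And>n t. t \<in> A n \<Longrightarrow> \<delta> n \<le> h t \<and> h t < e n"
proof -
  have Sp: "t \<in> S \<Longrightarrow> t \<in> space M" for t using sets.sets_into_space[OF assms(2)] by blast
  have m: "{t \<in> S. a \<le> h t \<and> h t < b} \<in> sets M" for a b
  proof -
    have "{t \<in> S. a \<le> h t \<and> h t < b} = S \<inter> {t \<in> space M. a \<le> h t \<and> h t < b}" using Sp by blast
    then show ?thesis by simp
  qed
  have "\<exists>d>0. d < b \<and> 0 < emeasure M {t \<in> S. d \<le> h t \<and> h t < b}" if b: "0 < b" for b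
  proof -
    have "\<exists>k::nat. 0 < emeasure M {t \<in> S. inverse (real (Suc k)) \<le> h t \<and> h t < b}"
    proof (rule ccontr)
      assume "\<not> ?thesis"
      then have "{t \<in> S. inverse (real (Suc k)) \<le> h t \<and> h t < b} \<in> null_sets M" for k
        using m by (auto simp: null_sets_def)
      then have "(\<Union>k. {t \<in> S. inverse (real (Suc k)) \<le> h t \<and> h t < b}) \<in> null_sets M" by (rule null_sets_UN)
      moreover have "(\<Union>k. {t \<in> S. inverse (real (Suc k)) \<le> h t \<and> h t < b}) = {t \<in> S. 0 < h t \<and> h t < b}"
      proof (intro equalityI subsetI)
        fix t assume t: "t \<in> {t \<in> S. 0 < h t \<and> h t < b}"
        then obtain k where "inverse (real (Suc k)) < h t" using reals_Archimedean by blast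
        with t show "t \<in> (\<Union>k. {t \<in> S. inverse (real (Suc k)) \<le> h t \<and> h t < b})" by (auto intro: less_imp_le)
      next
        fix t assume "t \<in> (\<Union>k. {t \<in> S. inverse (real (Suc k)) \<le> h t \<and> h t < b})"
        then obtain k where "t \<in> S" "inverse (real (Suc k)) \<le> h t" "h t < b" by auto
        moreover have "0 < inverse (real (Suc k))" by simp
        ultimately show "t \<in> {t \<in> S. 0 < h t \<and> h t < b}" using less_le_trans by blast
      qed
      ultimately show False using small[OF b] by auto
    qed
    then obtain k where k: "0 < emeasure M {t \<in> S. inverse (real (Suc k)) \<le> h t \<and> h t < b}" by blast
    have "inverse (real (Suc k)) < b"
    proof (rule ccontr)
      assume "\<not> ?thesis"
      then have "{t \<in> S. inverse (real (Suc k)) \<le> h t \<and> h t < b} = {}" by auto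
      with k show False by (metis emeasure_empty less_irrefl)
    qed
    with k show ?thesis by (intro exI[of _ "inverse (real (Suc k))"]) auto
  qed
  then obtain d where d: "\<And>b. 0 < b \<Longrightarrow> 0 < d b \<and> d b < b \<and> 0 < emeasure M {t \<in> S. d b \<le> h t \<and> h t < b}"
    by metis
  define D where "D = rec_nat (e 0) (\<lambda>n x. d (min x (e n)))"
  have D_Suc: "D (Suc n) = d (min (D n) (e n))" for n by (simp add: D_def)
  have D_pos: "0 < D n" for n
  proof (induction n)
    case (Suc n)
    then show ?case using d[of "min (D n) (e n)"] e by (simp add: D_Suc)
  qed (simp add: D_def e)
  have D_dec: "D (Suc n) \<le> D n" for n
    using d[of "min (D n) (e n)"] D_pos[of n] e[of n] by (simp add: D_Suc)
  define B where "B n = {t \<in> S. D (Suc n) \<le> h t \<and> h t < min (D n) (e n)}" for n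
  have B: "B n \<in> sets M" "0 < emeasure M (B n)" for n
    using d[of "min (D n) (e n)"] D_pos[of n] e[of n] m by (auto simp: B_def D_Suc)
  have "B m \<inter> B n = {}" if "m < n" for m n
  proof -
    have "D n \<le> D (Suc m)" using lift_Suc_antimono_le[of D, OF D_dec] that by (simp add: Suc_leI)
    then show ?thesis by (auto simp: B_def)
  qed
  then have "disjoint_family B"
    unfolding disjoint_family_on_def by (metis Int_commute linorder_neqE_nat)
  with B obtain A where A: "\<And>n. A n \<in> sets M" "\<And>n. A n \<subseteq> B n" "\<And>n. 0 < measure M (A n)"
    "\<And>n. emeasure M (A n) = ennreal (measure M (A n))" "disjoint_family A"
    using finite_positive_subsets[of B] by blast
  have "D (Suc n) \<le> h t \<and> h t < e n" if "t \<in> A n" for n t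
    using A(2) that by (force simp: B_def)
  moreover have "A n \<subseteq> S" for n using A(2)[of n] by (auto simp: B_def)
  ultimately show thesis using A D_pos that[of A "\<lambda>n. D (Suc n)"] by blast
qed

lemma ess_finitely_many_atoms_split:
  assumes B: "B \<subseteq> S" "B \<in> sets M" "S \<in> sets M"
    and 1: "ess_finitely_many_atoms M B" and 2: "ess_finitely_many_atoms M (S - B)"
  shows "ess_finitely_many_atoms M S"
proof -
  obtain \<A> where \<A>: "finite \<A>" "\<forall>A\<in>\<A>. atom M A" "sym_diff B (\<Union>\<A>) \<in> null_sets M"
    using 1 by (auto simp: ess_finitely_many_atoms_def)
  obtain \<B> where \<B>: "finite \<B>" "\<forall>A\<in>\<B>. atom M A" "sym_diff (S - B) (\<Union>\<B>) \<in> null_sets M"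
    using 2 by (auto simp: ess_finitely_many_atoms_def)
  have m: "\<Union>\<A> \<in> sets M" "\<Union>\<B> \<in> sets M"
    using \<A>(1,2) \<B>(1,2) by (auto simp: atom_def intro!: sets.finite_Union)
  have "sym_diff S (\<Union>(\<A> \<union> \<B>)) \<in> null_sets M"
  proof (rule null_sets_subset[OF null_sets.Un[OF \<A>(3) \<B>(3)]])
    show "sym_diff S (\<Union>(\<A> \<union> \<B>)) \<in> sets M" using m assms by auto
  qed (use B in auto)
  then show ?thesis
    unfolding ess_finitely_many_atoms_def using \<A>(1,2) \<B>(1,2) by (intro exI[of _ "\<A> \<union> \<B>"]) auto
qed

text \<open>A set that is not, up to a null set, a finite union of atoms is not an atom itself, so it splits
  into two parts of positive measure, one of which again is not such a union. Split off the other
  part and repeat.\<close>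

lemma disjoint_sets_if_not_atomic:
  assumes S: "S \<in> sets M" and not: "\<not> ess_finitely_many_atoms M S"
  obtains A :: "nat \<Rightarrow> 'a set" where "\<And>n. A n \<in> sets M" "\<And>n. A n \<subseteq> S" "\<And>n. 0 < measure M (A n)"
    "\<And>n. emeasure M (A n) = ennreal (measure M (A n))" "disjoint_family A"
proof -
  let ?big = "\<lambda>S. S \<in> sets M \<and> \<not> ess_finitely_many_atoms M S"
  have step: "\<exists>S'. ?big S' \<and> S' \<subseteq> S \<and> 0 < emeasure M (S - S')" if S: "?big S" for S
  proof -
    have "S \<notin> null_sets M"
    proof
      assume "S \<in> null_sets M"
      then have "ess_finitely_many_atoms M S"
        unfolding ess_finitely_many_atoms_def by (intro exI[of _ "{}"]) auto
      with S show False by blast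
    qed
    then have pos: "0 < emeasure M S" using S by (auto simp: null_sets_def zero_less_iff_neq_zero)
    have "\<not> atom M S"
    proof
      assume "atom M S"
      then have "ess_finitely_many_atoms M S"
        unfolding ess_finitely_many_atoms_def by (intro exI[of _ "{S}"]) auto
      with S show False by blast
    qed
    then obtain B where B: "B \<in> sets M" "B \<subseteq> S" "emeasure M B \<noteq> 0" "emeasure M B \<noteq> emeasure M S"
      using S pos by (auto simp: atom_def)
    show ?thesis
    proof (cases "ess_finitely_many_atoms M (S - B)")
      case False
      moreover have "S - (S - B) = B" using B by blast
      ultimately show ?thesis using S B
        by (intro exI[of _ "S - B"]) (auto simp: zero_less_iff_neq_zero)
    next
      case True
      then have "\<not> ess_finitely_many_atoms M B"
        using ess_finitely_many_atoms_split[OF B(2,1)] S by blast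
      moreover have "emeasure M (S - B) \<noteq> 0"
      proof
        assume "emeasure M (S - B) = 0"
        moreover have "emeasure M S = emeasure M B + emeasure M (S - B)"
          using B S by (subst plus_emeasure) (auto intro!: arg_cong[where f="emeasure M"])
        ultimately show False using B(4) by simp
      qed
      ultimately show ?thesis using B by (intro exI[of _ B]) (auto simp: zero_less_iff_neq_zero)
    qed
  qed
  obtain F :: "nat \<Rightarrow> 'a set" where F0: "F 0 = S" and F: "\<And>n. ?big (F n)"
    "\<And>n. F (Suc n) \<subseteq> F n \<and> 0 < emeasure M (F n - F (Suc n))"
  proof -
    define nxt where "nxt S = (SOME S'. ?big S' \<and> S' \<subseteq> S \<and> 0 < emeasure M (S - S'))" for S
    have nxt: "?big (nxt S) \<and> nxt S \<subseteq> S \<and> 0 < emeasure M (S - nxt S)" if "?big S" for S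
      unfolding nxt_def by (rule someI_ex[OF step[OF that]])
    have "?big ((nxt ^^ n) S)" for n by (induction n) (use S not nxt in auto)
    then show thesis using nxt by (intro that[of "\<lambda>n. (nxt ^^ n) S"]) auto
  qed
  define B where "B n = F n - F (Suc n)" for n
  have dec: "F n \<subseteq> F m" if "m \<le> n" for m n
    using lift_Suc_antimono_le[of F, OF _ that] F(2) by blast
  have "B m \<inter> B n = {}" if "m < n" for m n
    using dec[of "Suc m" n] that by (auto simp: B_def)
  then have "disjoint_family B"
    unfolding disjoint_family_on_def by (metis Int_commute linorder_neqE_nat)
  moreover have "B n \<in> sets M" "0 < emeasure M (B n)" for n using F by (auto simp: B_def)
  ultimately obtain A where A: "\<And>n. A n \<in> sets M" "\<And>n. A n \<subseteq> B n" "\<And>n. 0 < measure M (A n)"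
    "\<And>n. emeasure M (A n) = ennreal (measure M (A n))" "disjoint_family A"
    using finite_positive_subsets[of B] by blast
  moreover have "A n \<subseteq> S" for n using A(2)[of n] dec[of 0 n] F0 by (auto simp: B_def)
  ultimately show thesis using that by blast
qed

end

section \<open>Copies of \<open>ell1\<close> and \<open>ell_infty\<close> spanned by disjointly supported functions\<close>

text \<open>For disjoint \<open>A\<close>, the step function with value \<open>c n\<close> on \<open>A n\<close>. Selecting the index by \<open>LEAST\<close> makes
  it linear in \<open>c\<close> for any \<open>A\<close>.\<close>

definition spread :: "(nat \<Rightarrow> 'a set) \<Rightarrow> (nat \<Rightarrow> real) \<Rightarrow> 'a \<Rightarrow> real" where
  "spread A c t = (if t \<in> (\<Union>n. A n) then c (LEAST n. t \<in> A n) else 0)"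

lemma spread_on:
  assumes "disjoint_family A" "t \<in> A n" shows "spread A c t = c n"
proof -
  have "m = n" if "t \<in> A m" for m using assms that unfolding disjoint_family_on_def by blast
  moreover have "t \<in> A (LEAST m. t \<in> A m)" by (rule LeastI[of "\<lambda>m. t \<in> A m", OF assms(2)])
  ultimately have "(LEAST m. t \<in> A m) = n" by blast
  then show ?thesis using assms by (auto simp: spread_def)
qed

lemma spread_off: "t \<notin> (\<Union>n. A n) \<Longrightarrow> spread A c t = 0"
  by (simp add: spread_def)

lemma spread_linear:
  "spread A (\<lambda>n. a n + b n) t = spread A a t + spread A b t"
  "spread A (\<lambda>n. k * a n) t = k * spread A a t"
  by (auto simp: spread_def)

lemma spread_measurable [measurable (raw)]:
  assumes [measurable]: "\<And>n. A n \<in> sets M"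
  shows "spread A c \<in> borel_measurable M"
proof -
  have "(\<lambda>t. LEAST n. t \<in> A n) \<in> measurable M (count_space UNIV)" by measurable
  then have "(\<lambda>t. c (LEAST n. t \<in> A n)) \<in> borel_measurable M"
    by (rule measurable_compose) simp
  then show ?thesis unfolding spread_def[abs_def] by measurable
qed

context variable_exponent
begin

lemma luxemburg_eqI:
  assumes "0 \<le> S" and "\<And>\<alpha>. 0 < \<alpha> \<Longrightarrow> modular M p (\<lambda>t. u t / \<alpha>) \<le> 1 \<longleftrightarrow> S \<le> \<alpha>"
  shows "luxemburg M p u = S"
  unfolding luxemburg_def
proof (rule cInf_eq)
  fix y assume y: "\<And>x. x \<in> {\<alpha>. 0 < \<alpha> \<and> modular M p (\<lambda>t. u t / \<alpha>) \<le> 1} \<Longrightarrow> y \<le> x"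
  show "y \<le> S"
  proof (rule field_le_epsilon)
    fix e :: real assume "0 < e"
    then show "y \<le> S + e" using assms by (intro y) auto
  qed
qed (use assms in auto)

lemma luxemburg_mono:
  assumes "u \<in> borel_measurable M" "v \<in> Lvar_fun M p" "\<And>t. \<bar>u t\<bar> \<le> \<bar>v t\<bar>"
  shows "luxemburg M p u \<le> luxemburg M p v"
proof (rule field_le_epsilon)
  fix e :: real assume e: "0 < e"
  have v [measurable]: "v \<in> borel_measurable M" using assms(2) by (rule Lvar_fun_measurable)
  have pos: "0 < luxemburg M p v + e" using luxemburg_nonneg[OF assms(2)] e by linarith
  have "modular M p (\<lambda>t. u t / (luxemburg M p v + e)) \<le> modular M p (\<lambda>t. v t / (luxemburg M p v + e))"
    using assms(1,3) pos by (intro modular_mono AE_I2) (auto simp: abs_divide divide_right_mono)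
  also have "\<dots> \<le> 1" using e by (intro modular_le_1 assms(2)) simp
  finally show "luxemburg M p u \<le> luxemburg M p v + e" using pos by (intro luxemburg_le)
qed

lemma modular_disjoint:
  assumes [measurable]: "u \<in> borel_measurable M" "\<And>n. A n \<in> sets M"
    and A: "disjoint_family A" "\<And>n. A n \<subseteq> fin_part" and off: "\<And>t. t \<notin> (\<Union>n. A n) \<Longrightarrow> u t = 0"
  shows "modular M p u = (\<Sum>n. (\<integral>\<^sup>+t\<in>A n. ennreal (\<bar>u t\<bar> powr expo t) \<partial>M))"
proof -
  have "t \<notin> inf_part" if "t \<in> A n" for t n using A(2)[of n] that by (auto simp: fin_part_def inf_part_def)
  then have "ess_inf_part u \<le> 0"
    by (subst ess_inf_part_le_iff) (auto intro!: AE_I2 off)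
  moreover have "(\<integral>\<^sup>+ t. ennreal (\<bar>u t\<bar> powr expo t) * indicator fin_part t \<partial>M)
      = (\<integral>\<^sup>+t\<in>(\<Union>n. A n). ennreal (\<bar>u t\<bar> powr expo t) \<partial>M)"
  proof (intro nn_integral_cong)
    fix t show "ennreal (\<bar>u t\<bar> powr expo t) * indicator fin_part t
      = ennreal (\<bar>u t\<bar> powr expo t) * indicator (\<Union>n. A n) t"
      using off[of t] A(2) by (cases "t \<in> (\<Union>n. A n)") (auto simp: indicator_def)
  qed
  ultimately show ?thesis
    by (simp add: modular_eq nn_integral_disjoint_family[OF _ _ A(1)])
qed

text \<open>Where \<open>p = 1\<close> the modular is the integral of the absolute value, so normalized indicators of disjoint
  sets span \<open>ell1\<close>.\<close>

theorem contains_ell1: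
  assumes "\<not> ess_finitely_many_atoms M {t \<in> space M. p t = 1}"
  shows "contains_isometric_copy (Lvar M p) ell1"
proof -
  have m: "{t \<in> space M. p t = 1} \<in> sets M" by measurable
  obtain A :: "nat \<Rightarrow> 'a set" where A [measurable]: "\<And>n. A n \<in> sets M"
    and A1: "\<And>n. A n \<subseteq> {t \<in> space M. p t = 1}" and pos: "\<And>n. 0 < measure M (A n)"
    and fin: "\<And>n. emeasure M (A n) = ennreal (measure M (A n))" and disj: "disjoint_family A"
    using disjoint_sets_if_not_atomic[OF m assms] by blast
  define G where "G x = spread A (\<lambda>n. x n / measure M (A n))" for x :: "nat \<Rightarrow> real"
  have mod: "modular M p (\<lambda>t. G x t / \<alpha>) \<le> 1 \<longleftrightarrow> (\<Sum>n. \<bar>x n\<bar>) \<le> \<alpha>"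
    if x: "summable (\<lambda>n. \<bar>x n\<bar>)" and \<alpha>: "0 < \<alpha>" for x \<alpha>
  proof -
    have "modular M p (\<lambda>t. G x t / \<alpha>) = (\<Sum>n. (\<integral>\<^sup>+t\<in>A n. ennreal (\<bar>G x t / \<alpha>\<bar> powr expo t) \<partial>M))"
    proof (rule modular_disjoint[OF _ A disj])
      show "A n \<subseteq> fin_part" for n using A1[of n] by (auto simp: fin_part_def)
    qed (auto simp: G_def spread_off)
    also have "\<dots> = (\<Sum>n. ennreal (\<bar>x n\<bar> / \<alpha>))"
    proof (intro arg_cong[where f=suminf] ext)
      fix n
      have "(\<integral>\<^sup>+t\<in>A n. ennreal (\<bar>G x t / \<alpha>\<bar> powr expo t) \<partial>M)
          = (\<integral>\<^sup>+t\<in>A n. ennreal (\<bar>x n\<bar> / (measure M (A n) * \<alpha>)) \<partial>M)"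
      proof (rule nn_integral_cong)
        fix t
        have "ennreal (\<bar>G x t / \<alpha>\<bar> powr expo t) = ennreal (\<bar>x n\<bar> / (measure M (A n) * \<alpha>))" if "t \<in> A n"
          using that A1[of n] \<alpha> pos[of n] by (auto simp: G_def spread_on[OF disj that] abs_divide)
        then show "ennreal (\<bar>G x t / \<alpha>\<bar> powr expo t) * indicator (A n) t
            = ennreal (\<bar>x n\<bar> / (measure M (A n) * \<alpha>)) * indicator (A n) t"
          by (auto simp: indicator_def)
      qed
      also have "\<dots> = ennreal (\<bar>x n\<bar> / (measure M (A n) * \<alpha>)) * emeasure M (A n)"
        by (rule nn_integral_cmult_indicator) (rule A)
      also have "\<dots> = ennreal (\<bar>x n\<bar> / (measure M (A n) * \<alpha>) * measure M (A n))"
        unfolding fin using \<alpha> pos[of n] by (intro ennreal_mult[symmetric]) auto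
      also have "\<dots> = ennreal (\<bar>x n\<bar> / \<alpha>)" using pos[of n] by (simp add: divide_simps)
      finally show "(\<integral>\<^sup>+t\<in>A n. ennreal (\<bar>G x t / \<alpha>\<bar> powr expo t) \<partial>M) = ennreal (\<bar>x n\<bar> / \<alpha>)" .
    qed
    also have "\<dots> = ennreal (\<Sum>n. \<bar>x n\<bar> / \<alpha>)"
      using \<alpha> by (intro suminf_ennreal2 summable_divide x) auto
    also have "(\<Sum>n. \<bar>x n\<bar> / \<alpha>) = (\<Sum>n. \<bar>x n\<bar>) / \<alpha>" by (rule suminf_divide[OF x])
    finally show ?thesis using \<alpha> by (simp add: pos_divide_le_eq)
  qed
  show ?thesis
  proof (rule contains_isometric_copyI)
    fix x y assume x: "x \<in> pts ell1" and y: "y \<in> pts ell1"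
    then have sx: "summable (\<lambda>n. \<bar>x n\<bar>)" by (simp add: ell1_def)
    have "0 \<le> (\<Sum>n. \<bar>x n\<bar>)" by (rule suminf_nonneg[OF sx]) simp
    then show "luxemburg M p (G x) = nnorm ell1 x"
      using mod[OF sx] by (simp add: ell1_def luxemburg_eqI)
    show "G x \<in> Lvar_fun M p"
    proof (rule Lvar_funI)
      show "modular M p (\<lambda>t. G x t / ((\<Sum>n. \<bar>x n\<bar>) + 1)) \<le> 1"
        using \<open>0 \<le> (\<Sum>n. \<bar>x n\<bar>)\<close> by (subst mod[OF sx]) auto
    qed (use \<open>0 \<le> (\<Sum>n. \<bar>x n\<bar>)\<close> in \<open>auto simp: G_def\<close>)
    show "G (nadd ell1 x y) = (\<lambda>t. G x t + G y t)"
      by (simp add: G_def ell1_def add_divide_distrib spread_linear fun_eq_iff)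
    show "G (nscale ell1 c x) = (\<lambda>t. c * G x t)" for c
      using spread_linear(2)[of A c "\<lambda>n. x n / measure M (A n)"] by (simp add: G_def ell1_def fun_eq_iff)
  qed
qed

text \<open>All pieces of \<open>w\<close> together have modular at most 1, so coefficients bounded by 1 give norm at most 1;
  but no single piece may be enlarged by a factor \<open>s > 1\<close>, so each coefficient is bounded by the norm.\<close>

lemma contains_ell_infty_if_disjoint:
  fixes A :: "nat \<Rightarrow> 'a set"
  assumes A [measurable]: "\<And>n. A n \<in> sets M" and disj: "disjoint_family A"
    and w [measurable]: "w \<in> borel_measurable M"
    and le: "modular M p (\<lambda>t. w t * indicator (\<Union>n. A n) t) \<le> 1"
    and gt: "\<And>n s. 1 < s \<Longrightarrow> 1 < modular M p (\<lambda>t. s * (w t * indicator (A n) t))"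
  shows "contains_isometric_copy (Lvar M p) ell_infty"
proof -
  define G where "G x t = spread A x t * w t" for x :: "nat \<Rightarrow> real" and t
  have [measurable]: "G x \<in> borel_measurable M" for x unfolding G_def[abs_def] by measurable
  have bdd: "bdd_above (range (\<lambda>n. \<bar>x n\<bar>))" if x: "x \<in> pts ell_infty" for x
  proof -
    obtain a where "\<And>n. \<bar>x n\<bar> \<le> a" using x by (auto simp: ell_infty_def bounded_iff)
    then show ?thesis by (intro bdd_aboveI2)
  qed
  have nn: "0 \<le> (SUP n. \<bar>x n\<bar>)" if "x \<in> pts ell_infty" for x
    by (rule cSUP_upper2[OF bdd[OF that] UNIV_I]) simp
  have mod: "modular M p (\<lambda>t. G x t / \<alpha>) \<le> 1 \<longleftrightarrow> (SUP n. \<bar>x n\<bar>) \<le> \<alpha>"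
    if x: "x \<in> pts ell_infty" and \<alpha>: "0 < \<alpha>" for x \<alpha>
  proof
    assume sup: "(SUP n. \<bar>x n\<bar>) \<le> \<alpha>"
    have "modular M p (\<lambda>t. G x t / \<alpha>) \<le> modular M p (\<lambda>t. w t * indicator (\<Union>n. A n) t)"
    proof (intro modular_mono AE_I2)
      fix t
      show "\<bar>G x t / \<alpha>\<bar> \<le> \<bar>w t * indicator (\<Union>n. A n) t\<bar>"
      proof (cases "t \<in> (\<Union>n. A n)")
        case True
        then obtain n where n: "t \<in> A n" by blast
        have "\<bar>x n\<bar> \<le> \<alpha>" using cSUP_upper[OF UNIV_I bdd[OF x], of n] sup by linarith
        then have "\<bar>x n\<bar> * \<bar>w t\<bar> / \<alpha> \<le> \<alpha> * \<bar>w t\<bar> / \<alpha>" using \<alpha> by (intro divide_right_mono mult_right_mono) auto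
        then show ?thesis using True \<alpha> by (simp add: G_def spread_on[OF disj n] abs_mult abs_divide)
      qed (simp add: G_def spread_off)
    qed auto
    then show "modular M p (\<lambda>t. G x t / \<alpha>) \<le> 1" using le by (rule order_trans)
  next
    assume m: "modular M p (\<lambda>t. G x t / \<alpha>) \<le> 1"
    show "(SUP n. \<bar>x n\<bar>) \<le> \<alpha>"
    proof (rule cSUP_least)
      fix n
      show "\<bar>x n\<bar> \<le> \<alpha>"
      proof (rule ccontr)
        assume "\<not> \<bar>x n\<bar> \<le> \<alpha>"
        then have "1 < modular M p (\<lambda>t. \<bar>x n\<bar> / \<alpha> * (w t * indicator (A n) t))"
          using \<alpha> by (intro gt) simp
        also have "\<dots> \<le> modular M p (\<lambda>t. G x t / \<alpha>)"
          using \<alpha> by (intro modular_mono AE_I2) (auto simp: G_def spread_on[OF disj] abs_mult abs_divide indicator_def)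
        finally show False using m by simp
      qed
    qed auto
  qed
  show ?thesis
  proof (rule contains_isometric_copyI)
    fix x y assume x: "x \<in> pts ell_infty" and y: "y \<in> pts ell_infty"
    show "luxemburg M p (G x) = nnorm ell_infty x"
      using luxemburg_eqI[OF nn[OF x] mod[OF x]] by (simp add: ell_infty_def)
    show "G x \<in> Lvar_fun M p"
    proof (rule Lvar_funI)
      show "modular M p (\<lambda>t. G x t / ((SUP n. \<bar>x n\<bar>) + 1)) \<le> 1"
        using nn[OF x] by (subst mod[OF x]) auto
    qed (use nn[OF x] in auto)
    show "G (nadd ell_infty x y) = (\<lambda>t. G x t + G y t)"
      by (simp add: G_def ell_infty_def spread_linear fun_eq_iff distrib_right)
    show "G (nscale ell_infty c x) = (\<lambda>t. c * G x t)" for c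
      by (simp add: G_def ell_infty_def spread_linear fun_eq_iff)
  qed
qed

theorem contains_ell_infty_inf_part:
  assumes "\<not> ess_finitely_many_atoms M inf_part"
  shows "contains_isometric_copy (Lvar M p) ell_infty"
proof -
  obtain A :: "nat \<Rightarrow> 'a set" where A [measurable]: "\<And>n. A n \<in> sets M"
    and Ai: "\<And>n. A n \<subseteq> inf_part" and pos: "\<And>n. 0 < measure M (A n)"
    and fin: "\<And>n. emeasure M (A n) = ennreal (measure M (A n))" and disj: "disjoint_family A"
    using disjoint_sets_if_not_atomic[OF parts_measurable(2) assms] by blast
  have off: "t \<notin> fin_part" if "t \<in> A n" for t n using Ai[of n] that by (auto simp: fin_part_def inf_part_def)
  show ?thesis
  proof (rule contains_ell_infty_if_disjoint[OF A disj])
    show "(\<lambda>_. 1) \<in> borel_measurable M" by simp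
    have "(\<integral>\<^sup>+ t. ennreal (\<bar>1 * indicator (\<Union>n. A n) t\<bar> powr expo t) * indicator fin_part t \<partial>M) = (\<integral>\<^sup>+ t. 0 \<partial>M)"
      by (intro nn_integral_cong) (use off in \<open>auto simp: indicator_def\<close>)
    moreover have "ess_inf_part (\<lambda>t. 1 * indicator (\<Union>n. A n) t) \<le> 1"
      by (subst ess_inf_part_le_iff) (auto simp: indicator_def)
    ultimately show "modular M p (\<lambda>t. 1 * indicator (\<Union>n. A n) t) \<le> 1" by (simp add: modular_eq)
    fix n and s :: real assume s: "1 < s"
    show "1 < modular M p (\<lambda>t. s * (1 * indicator (A n) t))"
    proof (rule ccontr)
      assume "\<not> ?thesis"
      then have "modular M p (\<lambda>t. s * (1 * indicator (A n) t)) \<le> 1" by simp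
      then have "ess_inf_part (\<lambda>t. s * (1 * indicator (A n) t)) \<le> 1"
        unfolding modular_eq by (rule order_trans[rotated]) simp
      then have "AE t in M. t \<in> inf_part \<longrightarrow> ennreal \<bar>s * (1 * indicator (A n) t)\<bar> \<le> 1"
        by (subst (asm) ess_inf_part_le_iff) auto
      then have "AE t in M. t \<notin> A n"
        by eventually_elim (use s Ai in \<open>auto simp: indicator_def subset_eq\<close>)
      then have "emeasure M (A n) = 0" by (subst (asm) AE_iff_measurable[of "A n"]) (use sets.sets_into_space[OF A[of n]] in auto)
      then show False using pos[of n] fin[of n] by simp
    qed
  qed
qed

end

section \<open>Copies of \<open>ell_infty\<close> for unbounded exponents\<close>

context variable_exponent
begin

text \<open>With this weight the modular of \<open>s\<close> times the restriction to \<open>A n\<close> is \<open>c n\<close> times an average over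
  \<open>A n\<close> of powers of \<open>s\<close>, so no equation for norms has to be solved to normalize the pieces, although
  the exponent varies on \<open>A n\<close>.\<close>

definition avg_weight :: "(nat \<Rightarrow> 'a set) \<Rightarrow> (nat \<Rightarrow> real) \<Rightarrow> 'a \<Rightarrow> real" where
  "avg_weight A c t = spread A (\<lambda>n. c n / measure M (A n)) t powr (1 / expo t)"

definition avg_power :: "'a set \<Rightarrow> real \<Rightarrow> ennreal" where
  "avg_power A s = (\<integral>\<^sup>+t\<in>A. ennreal (\<bar>s\<bar> powr expo t / measure M A) \<partial>M)"

lemma avg_weight_measurable [measurable]:
  assumes [measurable]: "\<And>n. A n \<in> sets M"
  shows "avg_weight A c \<in> borel_measurable M"
  unfolding avg_weight_def[abs_def] by measurable

lemma avg_weight_powr: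
  assumes "disjoint_family A" "t \<in> A n" "A n \<subseteq> fin_part" "0 \<le> c n"
  shows "\<bar>s * avg_weight A c t\<bar> powr expo t = c n * (\<bar>s\<bar> powr expo t / measure M (A n))"
proof -
  have q: "1 \<le> expo t" using assms expo_ge_1 by blast
  have "\<bar>s * avg_weight A c t\<bar> powr expo t = \<bar>s\<bar> powr expo t * (avg_weight A c t powr expo t)"
    by (simp add: abs_mult powr_mult avg_weight_def)
  also have "avg_weight A c t powr expo t = c n / measure M (A n)"
    using q assms by (simp add: avg_weight_def spread_on powr_powr)
  finally show ?thesis by simp
qed

lemma avg_power_mono_bound:
  assumes A [measurable]: "A \<in> sets M" and fin: "emeasure M A = ennreal (measure M A)" "0 < measure M A"
  shows "0 \<le> b \<Longrightarrow> (\<And>t. t \<in> A \<Longrightarrow> \<bar>s\<bar> powr expo t \<le> b) \<Longrightarrow> avg_power A s \<le> ennreal b"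
    and "0 \<le> b \<Longrightarrow> (\<And>t. t \<in> A \<Longrightarrow> b \<le> \<bar>s\<bar> powr expo t) \<Longrightarrow> ennreal b \<le> avg_power A s"
proof -
  have const: "(\<integral>\<^sup>+t\<in>A. ennreal (b / measure M A) \<partial>M) = ennreal b" if "0 \<le> b" for b
  proof -
    have "(\<integral>\<^sup>+t\<in>A. ennreal (b / measure M A) \<partial>M) = ennreal (b / measure M A) * emeasure M A"
      by (rule nn_integral_cmult_indicator) (rule A)
    also have "\<dots> = ennreal (b / measure M A * measure M A)"
      unfolding fin(1) using that fin(2) by (intro ennreal_mult[symmetric]) auto
    finally show ?thesis using fin(2) by simp
  qed
  show "avg_power A s \<le> ennreal b" if "0 \<le> b" "\<And>t. t \<in> A \<Longrightarrow> \<bar>s\<bar> powr expo t \<le> b"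
    unfolding const[OF that(1), symmetric] avg_power_def
    using that(2) fin(2) by (intro nn_integral_mono) (auto simp: indicator_def intro!: ennreal_leI divide_right_mono)
  show "ennreal b \<le> avg_power A s" if "0 \<le> b" "\<And>t. t \<in> A \<Longrightarrow> b \<le> \<bar>s\<bar> powr expo t"
    unfolding const[OF that(1), symmetric] avg_power_def
    using that(2) fin(2) by (intro nn_integral_mono) (auto simp: indicator_def intro!: ennreal_leI divide_right_mono)
qed

lemma modular_spread_avg:
  assumes A [measurable]: "\<And>n. A n \<in> sets M" and disj: "disjoint_family A" and fin: "\<And>n. A n \<subseteq> fin_part"
    and c: "\<And>n. 0 \<le> c n"
  shows "modular M p (\<lambda>t. spread A x t * avg_weight A c t) = (\<Sum>n. ennreal (c n) * avg_power (A n) (x n))"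
proof -
  have "modular M p (\<lambda>t. spread A x t * avg_weight A c t)
      = (\<Sum>n. (\<integral>\<^sup>+t\<in>A n. ennreal (\<bar>spread A x t * avg_weight A c t\<bar> powr expo t) \<partial>M))"
    by (rule modular_disjoint[OF _ A disj fin]) (auto simp: spread_off)
  also have "\<dots> = (\<Sum>n. ennreal (c n) * avg_power (A n) (x n))"
  proof (intro arg_cong[where f=suminf] ext)
    fix n
    have "(\<integral>\<^sup>+t\<in>A n. ennreal (\<bar>spread A x t * avg_weight A c t\<bar> powr expo t) \<partial>M)
        = (\<integral>\<^sup>+t. ennreal (c n) * (ennreal (\<bar>x n\<bar> powr expo t / measure M (A n)) * indicator (A n) t) \<partial>M)"
    proof (rule nn_integral_cong)
      fix t
      show "ennreal (\<bar>spread A x t * avg_weight A c t\<bar> powr expo t) * indicator (A n) t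
        = ennreal (c n) * (ennreal (\<bar>x n\<bar> powr expo t / measure M (A n)) * indicator (A n) t)"
      proof (cases "t \<in> A n")
        case True
        show ?thesis
          unfolding spread_on[OF disj True] avg_weight_powr[OF disj True fin c]
          using True c[of n] by (simp flip: ennreal_mult')
      qed simp
    qed
    also have "\<dots> = ennreal (c n) * avg_power (A n) (x n)"
      unfolding avg_power_def by (rule nn_integral_cmult) measurable
    finally show "(\<integral>\<^sup>+t\<in>A n. ennreal (\<bar>spread A x t * avg_weight A c t\<bar> powr expo t) \<partial>M)
      = ennreal (c n) * avg_power (A n) (x n)" .
  qed
  finally show ?thesis .
qed

text \<open>Multiplying a function by \<open>s > 1\<close> multiplies its modular on a set where \<open>p \<ge> j\<^sup>2\<close> by at least
  \<open>s\<close> to the power \<open>j\<^sup>2\<close>. Thus on infinitely many such sets with modulars \<open>2\<^sup>-\<^sup>j\<^sup>-\<^sup>1\<close> every enlargement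
  leaves the unit ball, although the total modular is at most 1. Infinitely many disjoint groups of
  such sets give the pieces of \<open>contains_ell_infty_if_disjoint\<close>.\<close>

theorem contains_ell_infty_unbounded:
  assumes unb: "\<And>k::nat. 0 < emeasure M {t \<in> fin_part. real k < expo t}"
  shows "contains_isometric_copy (Lvar M p) ell_infty"
proof -
  have small: "0 < emeasure M {t \<in> fin_part. 0 < 1 / expo t \<and> 1 / expo t < e}" if "0 < e" for e
  proof -
    obtain k :: nat where k: "1 / e < real k" using reals_Archimedean2 by blast
    have sub: "{t \<in> fin_part. real k < expo t} \<subseteq> {t \<in> fin_part. 0 < 1 / expo t \<and> 1 / expo t < e}"
    proof safe
      fix t assume t: "t \<in> fin_part" "real k < expo t"
      then have "1 / e < expo t" "0 < expo t" using k expo_ge_1[OF t(1)] by auto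
      then show "0 < 1 / expo t" "1 / expo t < e" using \<open>0 < e\<close> by (auto simp: field_simps)
    qed
    have Sp: "t \<in> fin_part \<Longrightarrow> t \<in> space M" for t by (simp add: fin_part_def)
    have "{t \<in> fin_part. 0 < 1 / expo t \<and> 1 / expo t < e} = fin_part \<inter> {t \<in> space M. 0 < 1 / expo t \<and> 1 / expo t < e}"
      using Sp by blast
    then have "{t \<in> fin_part. 0 < 1 / expo t \<and> 1 / expo t < e} \<in> sets M" by simp
    then show "0 < emeasure M {t \<in> fin_part. 0 < 1 / expo t \<and> 1 / expo t < e}"
      using emeasure_mono[OF sub] less_le_trans[OF unb[of k]] by blast
  qed
  have q: "0 < 1 / (real n * real n + 1)" for n by (simp add: add_nonneg_pos)
  have me: "(\<lambda>t. 1 / expo t) \<in> borel_measurable M" by measurable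
  obtain B \<delta> where B [measurable]: "\<And>n. B n \<in> sets M" and fin: "\<And>n. B n \<subseteq> fin_part"
    and pos: "\<And>n. 0 < measure M (B n)" and em: "\<And>n. emeasure M (B n) = ennreal (measure M (B n))"
    and disj: "disjoint_family B" and "\<And>n. 0 < \<delta> n"
    and small: "\<And>n t. t \<in> B n \<Longrightarrow> \<delta> n \<le> 1 / expo t \<and> 1 / expo t < 1 / (real n * real n + 1)"
    by (rule disjoint_sets_small_values[of "\<lambda>t. 1 / expo t" fin_part "\<lambda>n. 1 / (real n * real n + 1)",
          OF me parts_measurable(1) _ q]) (erule small, rule that)
  have big: "real n * real n \<le> expo t" if "t \<in> B n" for n t
  proof -
    have "0 < expo t" using expo_ge_1[of t] fin[of n] that by fastforce
    moreover have "0 < real n * real n + 1" by (simp add: add_nonneg_pos)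
    ultimately show ?thesis using small[OF that] by (simp add: field_simps del: of_nat_mult)
  qed
  define c where "c n = (1/2::real) ^ Suc n" for n
  define w where "w = avg_weight B c"
  \<comment> \<open>The pairing of natural numbers splits the sets into infinitely many infinite groups.\<close>
  define A where "A n = (\<Union>i. B (prod_encode (n, i)))" for n
  have w [measurable]: "w \<in> borel_measurable M" unfolding w_def by measurable
  have A [measurable]: "A n \<in> sets M" for n unfolding A_def by measurable
  have UA: "(\<Union>n. A n) = (\<Union>n. B n)"
  proof (intro equalityI subsetI)
    fix t assume "t \<in> (\<Union>n. B n)"
    then obtain m where m: "t \<in> B m" by blast
    obtain n i where "prod_decode m = (n, i)" by (cases "prod_decode m")
    then have "m = prod_encode (n, i)" by (metis prod_decode_inverse)
    with m show "t \<in> (\<Union>n. A n)" by (auto simp: A_def)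
  qed (auto simp: A_def)
  have "disjoint_family A"
    unfolding disjoint_family_on_def
  proof (intro ballI impI)
    fix m n :: nat assume "m \<noteq> n"
    have "B (prod_encode (m, i)) \<inter> B (prod_encode (n, j)) = {}" for i j
      using disj \<open>m \<noteq> n\<close> unfolding disjoint_family_on_def by (simp add: prod_encode_eq)
    then show "A m \<inter> A n = {}" unfolding A_def by blast
  qed
  from A this w show ?thesis
  proof (rule contains_ell_infty_if_disjoint)
    have "(\<lambda>t. w t * indicator (\<Union>n. A n) t) = (\<lambda>t. spread B (\<lambda>_. 1) t * w t)"
      unfolding UA by (auto simp: fun_eq_iff spread_def indicator_def)
    then have "modular M p (\<lambda>t. w t * indicator (\<Union>n. A n) t) = (\<Sum>n. ennreal (c n) * avg_power (B n) 1)"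
      unfolding w_def using modular_spread_avg[OF B disj fin, of c] by (simp add: c_def)
    also have "\<dots> \<le> (\<Sum>n. ennreal (c n))"
    proof (intro suminf_le summableI)
      fix n
      have "avg_power (B n) 1 \<le> ennreal 1" by (rule avg_power_mono_bound(1)[OF B em pos]) auto
      then show "ennreal (c n) * avg_power (B n) 1 \<le> ennreal (c n)"
        using mult_left_mono[of "avg_power (B n) 1" 1 "ennreal (c n)"] by simp
    qed
    also have "\<dots> = 1"
    proof -
      have "c sums 1" unfolding c_def[abs_def] by (rule power_half_series)
      then have "(\<Sum>n. ennreal (c n)) = ennreal 1" by (intro suminf_ennreal_eq) (simp add: c_def)
      then show ?thesis by simp
    qed
    finally show "modular M p (\<lambda>t. w t * indicator (\<Union>n. A n) t) \<le> 1" .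
    fix n and s :: real assume s: "1 < s"
    \<comment> \<open>\<open>s\<close> to the power \<open>j\<^sup>2\<close> exceeds \<open>4 ^ j\<close>, which beats the factor \<open>2\<^sup>-\<^sup>j\<^sup>-\<^sup>1\<close>.\<close>
    obtain k where k: "4 < s ^ k" using real_arch_pow[OF s] by blast
    define j where "j = prod_encode (n, Suc k)"
    have kj: "k \<le> j" "1 \<le> j" unfolding j_def using le_prod_encode_2[of "Suc k" n] by auto
    have "4 < s ^ j" using k power_increasing[OF kj(1), of s] s by linarith
    then have "4 ^ j < (s ^ j) ^ j" using kj by (intro power_strict_mono) auto
    have "avg_power (B j) s \<ge> ennreal (s powr (real j * real j))"
      using s big by (intro avg_power_mono_bound(2)[OF B em pos]) (auto intro!: powr_mono)
    have "ennreal 1 < ennreal (c j * s powr (real j * real j))"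
    proof (rule ennreal_lessI)
      have "s powr (real j * real j) = (s ^ j) ^ j"
        using s by (simp add: powr_realpow flip: power_mult of_nat_mult)
      moreover have "(2::real) ^ Suc j \<le> 2 ^ (2 * j)" using kj by (intro power_increasing) auto
      then have "(2::real) ^ Suc j \<le> 4 ^ j" by (simp add: power_mult)
      ultimately have "2 ^ Suc j < s powr (real j * real j)" using \<open>4 ^ j < (s ^ j) ^ j\<close> by linarith
      then show "1 < c j * s powr (real j * real j)" by (simp add: c_def power_divide field_simps)
      then show "0 < c j * s powr (real j * real j)" by linarith
    qed
    also have "\<dots> = ennreal (c j) * ennreal (s powr (real j * real j))"
      by (rule ennreal_mult) (auto simp: c_def)
    also have "\<dots> \<le> ennreal (c j) * avg_power (B j) s" by (rule mult_left_mono) (fact, simp)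
    also have "\<dots> = (\<Sum>i\<in>{j}. ennreal (c i) * avg_power (B i) (if i = j then s else 0))" by simp
    also have "\<dots> \<le> (\<Sum>i. ennreal (c i) * avg_power (B i) (if i = j then s else 0))"
      by (rule sum_le_suminf) auto
    also have "\<dots> = modular M p (\<lambda>t. spread B (\<lambda>i. if i = j then s else 0) t * w t)"
      unfolding w_def by (rule modular_spread_avg[OF B disj fin, symmetric]) (simp add: c_def)
    also have "\<dots> \<le> modular M p (\<lambda>t. s * (w t * indicator (A n) t))"
    proof (intro modular_mono AE_I2)
      fix t
      show "\<bar>spread B (\<lambda>i. if i = j then s else 0) t * w t\<bar> \<le> \<bar>s * (w t * indicator (A n) t)\<bar>"
      proof (cases "t \<in> B j")
        case True
        then have "t \<in> A n" by (auto simp: A_def j_def)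
        then show ?thesis by (simp add: spread_on[OF disj True])
      next
        case False
        then have "spread B (\<lambda>i. if i = j then s else 0) t = 0"
          by (cases "t \<in> (\<Union>n. B n)") (auto simp: spread_off spread_on[OF disj])
        then show ?thesis by simp
      qed
    qed measurable
    finally show "1 < modular M p (\<lambda>t. s * (w t * indicator (A n) t))" by simp
  qed
qed

end

section \<open>Copies of renormed \<open>l1\<close> for exponents near 1\<close>

text \<open>The error made by replacing the exponent \<open>1 + \<epsilon>\<close> by 1 is at most \<open>\<epsilon>\<close> uniformly in \<open>s\<close>, so summable
  errors \<open>\<epsilon>\<close> cost a bounded amount, and little far out.\<close>

lemma le_powr_plus:
  fixes s \<epsilon> :: real
  assumes "0 \<le> s" "s \<le> 1" "0 < \<epsilon>"
  shows "s \<le> s powr (1 + \<epsilon>) + \<epsilon>"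
proof (cases "s = 0")
  case False
  then have s: "0 < s" using assms by simp
  have "1 + \<epsilon> * ln s \<le> s powr \<epsilon>"
    using s exp_ge_add_one_self[of "\<epsilon> * ln s"] by (simp add: powr_def)
  then have "s * (1 + \<epsilon> * ln s) \<le> s * s powr \<epsilon>" using s by (intro mult_left_mono) auto
  moreover have "s powr (1 + \<epsilon>) = s * s powr \<epsilon>" using s by (simp add: powr_add)
  moreover have "- 1 \<le> s * ln s"
  proof -
    have "- ln s \<le> 1 / s - 1" using ln_le_minus_one[of "1 / s"] s by (simp add: ln_div)
    then have "s * (- ln s) \<le> s * (1 / s - 1)" using s by (intro mult_left_mono) auto
    then show ?thesis using s by (simp add: algebra_simps)
  qed
  then have "\<epsilon> * (- 1) \<le> \<epsilon> * (s * ln s)" using assms by (intro mult_left_mono) auto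
  ultimately show ?thesis by (simp add: algebra_simps)
qed (use assms in simp)

lemma geometric_tail_sum: "(\<Sum>i<m. if k \<le> i then (1/2::real) ^ i else 0) \<le> 2 * (1/2) ^ k"
proof -
  have "(\<Sum>i<m. if k \<le> i then (1/2::real) ^ i else 0) = (if m \<le> k then 0 else 2 * (1/2) ^ k - 2 * (1/2) ^ m)"
  proof (induction m)
    case (Suc m)
    then show ?case by (cases "Suc m \<le> k"; cases "m = k") auto
  qed simp
  then show ?thesis by simp
qed

context variable_exponent
begin

context
  fixes A :: "nat \<Rightarrow> 'a set" and \<delta> :: "nat \<Rightarrow> real"
  assumes A [measurable]: "\<And>n. A n \<in> sets M" and Af: "\<And>n. A n \<subseteq> fin_part"
    and pos: "\<And>n. 0 < measure M (A n)" and em: "\<And>n. emeasure M (A n) = ennreal (measure M (A n))"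
    and disj: "disjoint_family A" and \<delta>: "\<And>n. 0 < \<delta> n"
    and exp_bounds: "\<And>n t. t \<in> A n \<Longrightarrow> \<delta> n \<le> expo t - 1 \<and> expo t - 1 < (1/2) ^ n"
begin

definition nakano_fun :: "l1 \<Rightarrow> 'a \<Rightarrow> real" where
  "nakano_fun x t = spread A (coord x) t * avg_weight A (\<lambda>_. 1) t"

definition nakano_norm :: "l1 \<Rightarrow> real" where
  "nakano_norm x = luxemburg M p (nakano_fun x)"

lemma nakano_fun_measurable [measurable]: "nakano_fun x \<in> borel_measurable M"
  unfolding nakano_fun_def[abs_def] by measurable

lemma modular_nakano:
  "modular M p (\<lambda>t. nakano_fun x t / \<alpha>) = (\<Sum>n. avg_power (A n) (coord x n / \<alpha>))"
proof -
  have "(\<lambda>t. nakano_fun x t / \<alpha>) = (\<lambda>t. spread A (\<lambda>n. coord x n / \<alpha>) t * avg_weight A (\<lambda>_. 1) t)"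
    using spread_linear(2)[of A "1 / \<alpha>" "coord x"] by (simp add: nakano_fun_def fun_eq_iff)
  then show ?thesis using modular_spread_avg[OF A disj Af, of "\<lambda>_. 1"] by simp
qed

lemma avg_power_le:
  assumes "\<bar>s\<bar> \<le> 1"
  shows "avg_power (A n) s \<le> ennreal (\<bar>s\<bar> powr (1 + \<delta> n))"
proof (rule avg_power_mono_bound(1)[OF A em pos])
  fix t assume "t \<in> A n"
  then have "1 + \<delta> n \<le> expo t" using exp_bounds by force
  then show "\<bar>s\<bar> powr expo t \<le> \<bar>s\<bar> powr (1 + \<delta> n)"
    using assms \<delta>[of n] by (cases "s = 0") (auto intro!: powr_mono')
qed simp

lemma avg_power_le_abs:
  assumes "\<bar>s\<bar> \<le> 1"
  shows "avg_power (A n) s \<le> ennreal \<bar>s\<bar>"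
proof -
  have "\<bar>s\<bar> powr (1 + \<delta> n) \<le> \<bar>s\<bar> powr 1"
    by (rule powr_mono') (use assms \<delta>[of n] in auto)
  then have "ennreal (\<bar>s\<bar> powr (1 + \<delta> n)) \<le> ennreal \<bar>s\<bar>" by (intro ennreal_leI) simp
  then show ?thesis using avg_power_le[OF assms, of n] by (rule order_trans[rotated])
qed

lemma avg_power_ge:
  assumes "\<bar>s\<bar> \<le> 1"
  shows "ennreal (\<bar>s\<bar> powr (1 + (1/2) ^ n)) \<le> avg_power (A n) s"
proof (rule avg_power_mono_bound(2)[OF A em pos])
  fix t assume "t \<in> A n"
  then have "expo t \<le> 1 + (1/2) ^ n" "1 \<le> expo t" using exp_bounds \<delta>[of n] by force+
  then show "\<bar>s\<bar> powr (1 + (1/2) ^ n) \<le> \<bar>s\<bar> powr expo t"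
    using assms by (cases "s = 0") (auto intro!: powr_mono')
qed simp

lemma avg_power_ge_abs:
  assumes "1 \<le> \<bar>s\<bar>"
  shows "ennreal \<bar>s\<bar> \<le> avg_power (A n) s"
proof (rule avg_power_mono_bound(2)[OF A em pos])
  fix t assume "t \<in> A n"
  then have "1 \<le> expo t" using exp_bounds \<delta>[of n] by force
  then show "\<bar>s\<bar> \<le> \<bar>s\<bar> powr expo t" using assms powr_mono[of 1 "expo t" "\<bar>s\<bar>"] by simp
qed simp

lemma modular_nakano_le:
  assumes "norm x \<le> \<alpha>" "0 < \<alpha>"
  shows "modular M p (\<lambda>t. nakano_fun x t / \<alpha>) \<le> ennreal (norm x / \<alpha>)"
proof -
  have "modular M p (\<lambda>t. nakano_fun x t / \<alpha>) \<le> (\<Sum>n. ennreal (\<bar>coord x n\<bar> / \<alpha>))"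
    unfolding modular_nakano
  proof (intro suminf_le summableI)
    fix n
    have "\<bar>coord x n / \<alpha>\<bar> \<le> 1" using coord_le_norm[of x n] assms by (simp add: abs_divide)
    from avg_power_le_abs[OF this, of n] show "avg_power (A n) (coord x n / \<alpha>) \<le> ennreal (\<bar>coord x n\<bar> / \<alpha>)"
      using assms by (simp add: abs_divide)
  qed
  also have "\<dots> = ennreal (\<Sum>n. \<bar>coord x n\<bar> / \<alpha>)"
    using assms by (intro suminf_ennreal2 summable_divide summable_coord) auto
  also have "(\<Sum>n. \<bar>coord x n\<bar> / \<alpha>) = norm x / \<alpha>"
    unfolding norm_l1_eq by (rule suminf_divide[OF summable_coord])
  finally show ?thesis .
qed

lemma nakano_fun_Lvar: "nakano_fun x \<in> Lvar_fun M p"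
proof (rule Lvar_funI)
  have p: "0 < norm x + 1" by (simp add: add_nonneg_pos)
  show "0 < norm x + 1" by fact
  have "modular M p (\<lambda>t. nakano_fun x t / (norm x + 1)) \<le> ennreal (norm x / (norm x + 1))"
    by (rule modular_nakano_le) (use p in auto)
  also have "\<dots> \<le> 1" using p by (simp add: pos_divide_le_eq)
  finally show "modular M p (\<lambda>t. nakano_fun x t / (norm x + 1)) \<le> 1" .
qed measurable

text \<open>The factor tends to 1 with \<open>k\<close>: far out the norm is nearly that of \<open>l1\<close>.\<close>

lemma norm_le_if_modular_le_1:
  assumes \<alpha>: "0 < \<alpha>" and m: "modular M p (\<lambda>t. nakano_fun x t / \<alpha>) \<le> 1" and x: "\<And>i. i < k \<Longrightarrow> coord x i = 0"
  shows "norm x \<le> (1 + 2 * (1/2) ^ k) * \<alpha>"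
proof (rule norm_l1_leI)
  fix m
  define s where "s i = coord x i / \<alpha>" for i
  have part: "(\<Sum>i\<in>I. avg_power (A i) (s i)) \<le> 1" if "finite I" for I
  proof -
    have "(\<Sum>i\<in>I. avg_power (A i) (s i)) \<le> (\<Sum>i. avg_power (A i) (s i))"
      by (rule sum_le_suminf) (use that in auto)
    also have "\<dots> \<le> 1" using m unfolding modular_nakano s_def .
    finally show ?thesis .
  qed
  have s1: "\<bar>s i\<bar> \<le> 1" for i
  proof (rule ccontr)
    assume "\<not> \<bar>s i\<bar> \<le> 1"
    then have "ennreal \<bar>s i\<bar> \<le> avg_power (A i) (s i)" by (intro avg_power_ge_abs) simp
    also have "\<dots> \<le> 1" using part[of "{i}"] by simp
    finally show False using \<open>\<not> \<bar>s i\<bar> \<le> 1\<close> by simp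
  qed
  have "ennreal (\<Sum>i<m. \<bar>s i\<bar> powr (1 + (1/2) ^ i)) = (\<Sum>i<m. ennreal (\<bar>s i\<bar> powr (1 + (1/2) ^ i)))"
    by (rule sum_ennreal[symmetric]) simp
  also have "\<dots> \<le> (\<Sum>i<m. avg_power (A i) (s i))" by (intro sum_mono avg_power_ge s1)
  also have "\<dots> \<le> 1" by (rule part) simp
  finally have "(\<Sum>i<m. \<bar>s i\<bar> powr (1 + (1/2) ^ i)) \<le> 1" by simp
  moreover have "(\<Sum>i<m. \<bar>s i\<bar>) \<le> (\<Sum>i<m. \<bar>s i\<bar> powr (1 + (1/2) ^ i) + (if k \<le> i then (1/2) ^ i else 0))"
  proof (rule sum_mono)
    fix i
    show "\<bar>s i\<bar> \<le> \<bar>s i\<bar> powr (1 + (1/2) ^ i) + (if k \<le> i then (1/2) ^ i else 0)"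
      using le_powr_plus[of "\<bar>s i\<bar>" "(1/2) ^ i"] s1[of i] x[of i] by (auto simp: s_def)
  qed
  ultimately have "(\<Sum>i<m. \<bar>s i\<bar>) \<le> 1 + 2 * (1/2) ^ k"
    using geometric_tail_sum[of k m] by (simp add: sum.distrib)
  then have "(\<Sum>i<m. \<bar>s i\<bar>) * \<alpha> \<le> (1 + 2 * (1/2) ^ k) * \<alpha>" using \<alpha> by (intro mult_right_mono) auto
  moreover have "(\<Sum>i<m. \<bar>s i\<bar>) * \<alpha> = (\<Sum>i<m. \<bar>coord x i\<bar>)"
    using \<alpha> by (simp add: s_def sum_distrib_right abs_divide)
  ultimately show "(\<Sum>i<m. \<bar>coord x i\<bar>) \<le> (1 + 2 * (1/2) ^ k) * \<alpha>" by simp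
qed

text \<open>Coordinates of size \<open>O(t)\<close> contribute \<open>O(t powr (1 + \<delta> i))\<close> to the modular, and finitely many of them
  have a smallest \<open>\<delta> i\<close>. Enlarging the radius from \<open>a\<close> to \<open>a + \<theta> * t\<close> leaves the tail the share
  \<open>a / (a + \<theta> * t)\<close> of the modular and frees a share proportional to \<open>t\<close>, which makes up for this.\<close>

lemma nakano_flat:
  assumes c: "0 < c" and \<theta>: "0 < \<theta>"
  shows "\<exists>t>0. t \<le> 1 \<and> (\<forall>w z a. c \<le> a \<longrightarrow> norm (tail k w) \<le> a \<longrightarrow>
      norm (head k z) \<le> B \<longrightarrow> nakano_norm (tail k w + t *\<^sub>R head k z) \<le> a + \<theta> * t)"
proof -
  define b where "b = \<bar>B\<bar> + 1"
  have b: "0 < b" by (simp add: b_def)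
  have "((\<lambda>t. b * (\<Sum>i<k. (t * b / c) powr \<delta> i)) \<longlongrightarrow> b * (\<Sum>i<k. (0 * b / c) powr \<delta> i)) (at_right 0)"
    using \<delta> b c
    by (intro tendsto_intros) (auto simp: eventually_at_right_less intro!: eventually_at_rightI[of 0 1] less_imp_le)
  then have "\<forall>\<^sub>F t in at_right 0. b * (\<Sum>i<k. (t * b / c) powr \<delta> i) < \<theta>"
    by (rule order_tendstoD(2)) (use \<theta> in simp)
  moreover have "\<forall>\<^sub>F t in at_right 0. t < min 1 (c / b)"
    by (rule eventually_at_rightI[of 0 "min 1 (c / b)"]) (use b c in auto)
  moreover have "\<forall>\<^sub>F t in at_right (0::real). 0 < t" by (rule eventually_at_right_less)
  ultimately have "\<forall>\<^sub>F t in at_right 0. b * (\<Sum>i<k. (t * b / c) powr \<delta> i) < \<theta> \<and> t < min 1 (c / b) \<and> 0 < t"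
    by eventually_elim simp
  from eventually_happens[OF this]
  obtain t where t: "b * (\<Sum>i<k. (t * b / c) powr \<delta> i) < \<theta>" "t < min 1 (c / b)" "0 < t"
    by auto
  have tb: "t * b < c" using t(2) b by (simp add: pos_less_divide_eq)
  have "nakano_norm (tail k w + t *\<^sub>R head k z) \<le> a + \<theta> * t"
    if a: "c \<le> a" "norm (tail k w) \<le> a" and z: "norm (head k z) \<le> B" for w z a
  proof -
    define l where "l = a + \<theta> * t"
    have l: "0 < l" "c \<le> l" "a \<le> l" using a c t \<theta> by (auto simp: l_def add_pos_nonneg add_increasing2)
    let ?y = "tail k w + t *\<^sub>R head k z"
    define f where "f i = (if i < k then (t * b / l) * (t * b / c) powr \<delta> i else 0)" for i
    have f0: "0 \<le> f i" for i using t b l by (simp add: f_def)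
    have coord_bound: "avg_power (A i) (coord ?y i / l) \<le> ennreal (\<bar>coord (tail k w) i\<bar> / l + f i)" for i
    proof (cases "i < k")
      case False
      have "\<bar>coord (tail k w) i / l\<bar> \<le> 1"
        using coord_le_norm[of "tail k w" i] a l by (simp only: abs_divide) (simp add: divide_le_eq)
      then have "avg_power (A i) (coord (tail k w) i / l) \<le> ennreal \<bar>coord (tail k w) i / l\<bar>"
        by (rule avg_power_le_abs)
      then show ?thesis using False l by (simp add: f_def abs_divide)
    next
      case True
      define s where "s = coord ?y i / l"
      have "\<bar>coord (head k z) i\<bar> \<le> b" using coord_le_norm[of "head k z" i] z by (simp only: b_def)
      then have "t * \<bar>coord z i\<bar> \<le> t * b" using True t by (intro mult_left_mono) auto
      then have sl: "\<bar>s\<bar> \<le> t * b / l" using True t l by (simp add: s_def abs_divide abs_mult divide_right_mono)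
      also have lc: "\<dots> \<le> t * b / c" using l c t b by (intro divide_left_mono) auto
      finally have sc: "\<bar>s\<bar> \<le> t * b / c" .
      have "t * b / c \<le> 1" using tb c by simp
      then have "avg_power (A i) s \<le> ennreal (\<bar>s\<bar> powr (1 + \<delta> i))" using sc by (intro avg_power_le) linarith
      also have "\<bar>s\<bar> powr (1 + \<delta> i) = \<bar>s\<bar> * \<bar>s\<bar> powr \<delta> i" using powr_add[of "\<bar>s\<bar>" 1 "\<delta> i"] by simp
      also have "ennreal \<dots> \<le> ennreal ((t * b / l) * (t * b / c) powr \<delta> i)"
        using sl sc \<delta>[of i] t b l by (intro ennreal_leI mult_mono powr_mono2) auto
      finally show ?thesis using True by (simp add: f_def s_def)
    qed
    have sw: "summable (\<lambda>i. \<bar>coord (tail k w) i\<bar> / l)" by (intro summable_divide summable_coord)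
    have fs: "f sums (\<Sum>i<k. f i)"
      by (rule sums_finite) (auto simp: f_def)
    have "modular M p (\<lambda>t. nakano_fun ?y t / l) \<le> (\<Sum>i. ennreal (\<bar>coord (tail k w) i\<bar> / l + f i))"
      unfolding modular_nakano by (intro suminf_le summableI coord_bound)
    also have "\<dots> = ennreal (\<Sum>i. \<bar>coord (tail k w) i\<bar> / l + f i)"
      using f0 l sums_summable[OF fs] by (intro suminf_ennreal2 summable_add sw) (auto simp del: coord_tail)
    also have "(\<Sum>i. \<bar>coord (tail k w) i\<bar> / l + f i) = norm (tail k w) / l + (\<Sum>i<k. f i)"
      using suminf_add[OF sw sums_summable[OF fs]] sums_unique[OF fs] suminf_divide[OF summable_coord, of "tail k w" l]
      by (simp add: norm_l1_eq del: coord_tail)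
    also have "\<dots> \<le> ennreal 1"
    proof (rule ennreal_leI)
      have "(\<Sum>i<k. f i) = (t / l) * (b * (\<Sum>i<k. (t * b / c) powr \<delta> i))"
        by (simp add: f_def sum_distrib_left mult.assoc)
      also have "\<dots> \<le> (t / l) * \<theta>" using t l by (intro mult_left_mono) auto
      finally have "norm (tail k w) / l + (\<Sum>i<k. f i) \<le> a / l + (t / l) * \<theta>"
        using a l by (intro add_mono divide_right_mono) auto
      also have "\<dots> = 1" using l by (simp add: l_def add_divide_distrib[symmetric] mult.commute)
      finally show "norm (tail k w) / l + (\<Sum>i<k. f i) \<le> 1" .
    qed
    finally have "modular M p (\<lambda>t. nakano_fun ?y t / l) \<le> 1" by simp
    then show ?thesis unfolding nakano_norm_def l_def[symmetric] by (rule luxemburg_le[OF l(1)])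
  qed
  then show ?thesis using t by (intro exI[of _ t]) auto
qed

lemma nakano_fun_linear:
  "nakano_fun (x + y) = (\<lambda>t. nakano_fun x t + nakano_fun y t)"
  "nakano_fun (r *\<^sub>R x) = (\<lambda>t. r * nakano_fun x t)"
proof -
  have eqs: "coord (x + y) = (\<lambda>n. coord x n + coord y n)" "coord (r *\<^sub>R x) = (\<lambda>n. r * coord x n)"
    by (simp_all add: fun_eq_iff)
  show "nakano_fun (x + y) = (\<lambda>t. nakano_fun x t + nakano_fun y t)"
    "nakano_fun (r *\<^sub>R x) = (\<lambda>t. r * nakano_fun x t)"
    by (rule ext, simp only: nakano_fun_def eqs spread_linear distrib_right mult.assoc)+
qed

lemma l1_renorming_nakano: "l1_renorming nakano_norm (\<lambda>k. 2 * (1/2) ^ k)"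
proof
  show "nakano_norm (x + y) \<le> nakano_norm x + nakano_norm y" for x y
    unfolding nakano_norm_def nakano_fun_linear by (intro luxemburg_triangle nakano_fun_Lvar)
  show "nakano_norm (r *\<^sub>R x) = \<bar>r\<bar> * nakano_norm x" for r x
    unfolding nakano_norm_def nakano_fun_linear by (intro luxemburg_scale nakano_fun_Lvar)
  show "nakano_norm x \<le> norm x" for x
  proof (rule field_le_epsilon)
    fix e :: real assume "0 < e"
    then have p: "0 < norm x + e" by (simp add: add_nonneg_pos)
    have "modular M p (\<lambda>t. nakano_fun x t / (norm x + e)) \<le> ennreal (norm x / (norm x + e))"
      by (rule modular_nakano_le) (use p \<open>0 < e\<close> in auto)
    also have "\<dots> \<le> 1" using p \<open>0 < e\<close> by (simp add: pos_divide_le_eq)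
    finally show "nakano_norm x \<le> norm x + e" unfolding nakano_norm_def by (rule luxemburg_le[OF p])
  qed
  show "nakano_norm (tail k x) \<le> nakano_norm x" for k x
    unfolding nakano_norm_def
    by (rule luxemburg_mono[OF _ nakano_fun_Lvar])
      (auto simp: nakano_fun_def spread_def abs_mult)
  show "norm (tail k x) \<le> (1 + 2 * (1/2) ^ k) * nakano_norm (tail k x)" for k x
  proof (rule field_le_epsilon)
    fix e :: real assume e: "0 < e"
    let ?K = "1 + 2 * (1/2::real) ^ k"
    have K: "0 < ?K" by (simp add: add_pos_pos)
    define \<alpha> where "\<alpha> = nakano_norm (tail k x) + e / ?K"
    have \<alpha>: "nakano_norm (tail k x) < \<alpha>" using e K by (simp add: \<alpha>_def)
    then have "0 < \<alpha>" using luxemburg_nonneg[OF nakano_fun_Lvar[of "tail k x"]] by (simp add: nakano_norm_def)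
    moreover have "modular M p (\<lambda>t. nakano_fun (tail k x) t / \<alpha>) \<le> 1"
      using modular_le_1[OF nakano_fun_Lvar] \<alpha> by (simp add: nakano_norm_def)
    ultimately have "norm (tail k x) \<le> ?K * \<alpha>" by (rule norm_le_if_modular_le_1) simp
    also have "\<dots> = ?K * nakano_norm (tail k x) + e" using K by (simp add: \<alpha>_def distrib_left)
    finally show "norm (tail k x) \<le> ?K * nakano_norm (tail k x) + e" .
  qed
  have "(\<lambda>k. 2 * (1/2::real) ^ k) \<longlonglongrightarrow> 2 * 0" by (intro tendsto_intros LIMSEQ_realpow_zero) auto
  then show "(\<lambda>k. 2 * (1/2::real) ^ k) \<longlonglongrightarrow> 0" by simp
qed (simp, rule nakano_flat)

lemma contains_nakano: "contains_isometric_copy (Lvar M p) (renormed_l1 nakano_norm)"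
  by (rule contains_isometric_copyI[of _ nakano_fun])
    (auto simp: nakano_fun_Lvar nakano_fun_linear nakano_norm_def)

end

theorem contains_renormed_l1_if_expo_near_1:
  assumes small: "\<And>e. 0 < e \<Longrightarrow> 0 < emeasure M {t \<in> fin_part. 0 < expo t - 1 \<and> expo t - 1 < e}"
  shows "\<exists>N \<tau>. l1_renorming N \<tau> \<and> contains_isometric_copy (Lvar M p) (renormed_l1 N)"
proof -
  have me: "(\<lambda>t. expo t - 1) \<in> borel_measurable M" by measurable
  obtain A \<delta> where *: "\<And>n. A n \<in> sets M" "\<And>n. A n \<subseteq> fin_part" "\<And>n. 0 < measure M (A n)"
    "\<And>n. emeasure M (A n) = ennreal (measure M (A n))" "disjoint_family A" "\<And>n. 0 < \<delta> n"
    "\<And>n t. t \<in> A n \<Longrightarrow> \<delta> n \<le> expo t - 1 \<and> expo t - 1 < (1/2) ^ n"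
    by (rule disjoint_sets_small_values[of "\<lambda>t. expo t - 1" fin_part "\<lambda>n. (1/2) ^ n",
          OF me parts_measurable(1)]) (erule small, simp, rule that)
  show ?thesis
    using l1_renorming_nakano[OF *] contains_nakano[OF *] by blast
qed

end

section \<open>Signed set functions with a density\<close>

definition pos_var :: "'a measure \<Rightarrow> ('a set \<Rightarrow> real) \<Rightarrow> 'a set \<Rightarrow> real" where
  "pos_var M \<nu> E = Sup (\<nu> ` {B \<in> sets M. B \<subseteq> E})"

text \<open>The bound and the continuity of \<open>\<nu>\<close> pass to its positive variation, which is therefore a finite measure
  that is absolutely continuous. The integrals of \<open>h\<close> over sets serve as a finite control measure.\<close>

lemma (in sigma_finite_measure) pos_var_density:
  fixes \<nu> :: "'a set \<Rightarrow> real" and h :: "'a \<Rightarrow> ennreal"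
  assumes h [measurable]: "h \<in> borel_measurable M" and h_fin: "integral\<^sup>N M h \<noteq> \<infinity>"
    and add: "\<And>A B. A \<in> sets M \<Longrightarrow> B \<in> sets M \<Longrightarrow> A \<inter> B = {} \<Longrightarrow> \<nu> (A \<union> B) = \<nu> A + \<nu> B"
    and bnd: "\<And>A. A \<in> sets M \<Longrightarrow> \<bar>\<nu> A\<bar> \<le> C"
    and cont: "\<And>e. 0 < e \<Longrightarrow> \<exists>d>0. \<forall>A\<in>sets M. (\<integral>\<^sup>+t\<in>A. h t \<partial>M) < d \<longrightarrow> \<bar>\<nu> A\<bar> \<le> e"
  shows "\<exists>f. integrable M f \<and> (\<forall>E\<in>sets M. (\<integral>t. indicator E t * f t \<partial>M) = pos_var M \<nu> E)"
proof -
  let ?p = "pos_var M \<nu>"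
  have bdd: "bdd_above (\<nu> ` {B \<in> sets M. B \<subseteq> E})" for E
    using bnd by (intro bdd_aboveI2[of _ _ C]) (auto intro: order_trans[OF abs_ge_self])
  have upper: "\<nu> B \<le> ?p E" if "B \<in> sets M" "B \<subseteq> E" for B E
    unfolding pos_var_def using that by (intro cSUP_upper bdd) auto
  have least: "?p E \<le> c" if "\<And>B. B \<in> sets M \<Longrightarrow> B \<subseteq> E \<Longrightarrow> \<nu> B \<le> c" for c E
    unfolding pos_var_def using that by (intro cSUP_least) auto
  have \<nu>0: "\<nu> {} = 0" using add[of "{}" "{}"] by simp
  have nonneg: "0 \<le> ?p E" for E using upper[of "{}" E] \<nu>0 by simp
  have p0: "?p {} = 0" using nonneg[of "{}"] least[of "{}" 0] \<nu>0 by (force intro: antisym)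
  have padd: "?p (E \<union> F) = ?p E + ?p F" if EF: "E \<in> sets M" "F \<in> sets M" "E \<inter> F = {}" for E F
  proof (rule antisym)
    show "?p (E \<union> F) \<le> ?p E + ?p F"
    proof (rule least)
      fix B assume B: "B \<in> sets M" "B \<subseteq> E \<union> F"
      then have "\<nu> B = \<nu> (B \<inter> E) + \<nu> (B \<inter> F)"
        using EF by (subst add[symmetric]) (auto intro!: arg_cong[where f=\<nu>])
      also have "\<dots> \<le> ?p E + ?p F" using B EF by (intro add_mono upper) auto
      finally show "\<nu> B \<le> ?p E + ?p F" .
    qed
    have "?p F \<le> ?p (E \<union> F) - ?p E"
    proof (rule least)
      fix B assume B: "B \<in> sets M" "B \<subseteq> F"
      have "?p E \<le> ?p (E \<union> F) - \<nu> B"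
      proof (rule least)
        fix A assume A: "A \<in> sets M" "A \<subseteq> E"
        have "\<nu> A + \<nu> B = \<nu> (A \<union> B)" using A B EF by (subst add) auto
        also have "\<dots> \<le> ?p (E \<union> F)" using A B by (intro upper) auto
        finally show "\<nu> A \<le> ?p (E \<union> F) - \<nu> B" by simp
      qed
      then show "\<nu> B \<le> ?p (E \<union> F) - ?p E" by simp
    qed
    then show "?p E + ?p F \<le> ?p (E \<union> F)" by simp
  qed
  have small: "?p E \<le> e" if "\<And>A. A \<in> sets M \<Longrightarrow> (\<integral>\<^sup>+t\<in>A. h t \<partial>M) < d \<Longrightarrow> \<bar>\<nu> A\<bar> \<le> e"
    "(\<integral>\<^sup>+t\<in>E. h t \<partial>M) < d" for E d e
  proof (rule least)
    fix B assume B: "B \<in> sets M" "B \<subseteq> E"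
    have "(\<integral>\<^sup>+t\<in>B. h t \<partial>M) \<le> (\<integral>\<^sup>+t\<in>E. h t \<partial>M)"
      using B by (intro nn_integral_mono) (auto simp: indicator_def)
    then have "\<bar>\<nu> B\<bar> \<le> e" using that B by (meson order.strict_trans1)
    then show "\<nu> B \<le> e" by simp
  qed
  have ca: "countably_additive (sets M) (\<lambda>E. ennreal (?p E))"
  proof (rule sets.empty_continuous_imp_countably_additive)
    show "positive (sets M) (\<lambda>E. ennreal (?p E))" by (simp add: positive_def p0)
    show "additive (sets M) (\<lambda>E. ennreal (?p E))" by (simp add: additive_def padd nonneg)
    fix A :: "nat \<Rightarrow> 'a set"
    assume A: "range A \<subseteq> sets M" "decseq A" "(\<Inter>i. A i) = {}"
    have Am [measurable]: "A i \<in> sets M" for i using A(1) by auto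
    have em: "emeasure (density M h) (A i) = (\<integral>\<^sup>+t\<in>A i. h t \<partial>M)" for i
      by (rule emeasure_density) auto
    have "(\<integral>\<^sup>+t\<in>A i. h t \<partial>M) \<noteq> \<infinity>" for i
    proof -
      have "(\<integral>\<^sup>+t\<in>A i. h t \<partial>M) \<le> integral\<^sup>N M h" by (intro nn_integral_mono) (auto simp: indicator_def)
      then show ?thesis using h_fin by (auto simp: top_unique)
    qed
    then have "(\<lambda>i. emeasure (density M h) (A i)) \<longlonglongrightarrow> emeasure (density M h) (\<Inter>i. A i)"
      using A by (intro Lim_emeasure_decseq) (auto simp: em)
    then have lim: "(\<lambda>i. (\<integral>\<^sup>+t\<in>A i. h t \<partial>M)) \<longlonglongrightarrow> 0" by (simp add: A(3) em)
    have "(\<lambda>i. ?p (A i)) \<longlonglongrightarrow> 0"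
    proof (rule LIMSEQ_I)
      fix r :: real assume "0 < r"
      then obtain d where d: "0 < d" "\<forall>A\<in>sets M. (\<integral>\<^sup>+t\<in>A. h t \<partial>M) < d \<longrightarrow> \<bar>\<nu> A\<bar> \<le> r/2"
        using cont[of "r/2"] by auto
      have "\<forall>\<^sub>F i in sequentially. (\<integral>\<^sup>+t\<in>A i. h t \<partial>M) < d" by (rule order_tendstoD(2)[OF lim d(1)])
      then obtain n where n: "\<And>i. i \<ge> n \<Longrightarrow> (\<integral>\<^sup>+t\<in>A i. h t \<partial>M) < d" by (auto simp: eventually_sequentially)
      have "norm (?p (A i) - 0) < r" if "i \<ge> n" for i
      proof -
        have "?p (A i) \<le> r/2" using d(2) n[OF that] by (intro small[of d]) auto
        then show ?thesis using nonneg[of "A i"] \<open>0 < r\<close> by simp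
      qed
      then show "\<exists>n. \<forall>i\<ge>n. norm (?p (A i) - 0) < r" by blast
    qed
    then show "(\<lambda>i. ennreal (?p (A i))) \<longlonglongrightarrow> 0" using tendsto_ennrealI by fastforce
  qed simp
  define N where "N = measure_of (space M) (sets M) (\<lambda>E. ennreal (?p E))"
  have sets_N [simp]: "sets N = sets M" by (simp add: N_def)
  have em_N: "emeasure N E = ennreal (?p E)" if "E \<in> sets M" for E
    unfolding N_def using that ca by (intro emeasure_measure_of_sigma) (auto simp: positive_def p0 sets.sigma_algebra_axioms)
  have "absolutely_continuous M N"
    unfolding absolutely_continuous_def
  proof
    fix E assume E: "E \<in> null_sets M"
    then have [measurable]: "E \<in> sets M" by auto
    have "(\<integral>\<^sup>+t\<in>E. h t \<partial>M) = 0" using E by (rule nn_integral_null_set)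
    have "?p E \<le> e" if e: "0 < e" for e
    proof -
      obtain d where d: "0 < d" "\<forall>A\<in>sets M. (\<integral>\<^sup>+t\<in>A. h t \<partial>M) < d \<longrightarrow> \<bar>\<nu> A\<bar> \<le> e"
        using cont[OF e] by auto
      then show ?thesis using \<open>(\<integral>\<^sup>+t\<in>E. h t \<partial>M) = 0\<close> by (intro small[of d]) auto
    qed
    then have "?p E \<le> 0" by (metis dense not_le)
    then show "E \<in> null_sets N" using nonneg[of E] em_N[of E] by (auto simp: null_sets_def)
  qed
  from Radon_Nikodym[OF this sets_N] obtain f where f [measurable]: "f \<in> borel_measurable M"
    and dens: "density M f = N" by blast
  have int_f: "(\<integral>\<^sup>+t\<in>E. f t \<partial>M) = ennreal (?p E)" if "E \<in> sets M" for E
    using emeasure_density[OF f that] em_N[OF that] by (simp add: dens)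
  have "(\<integral>\<^sup>+t. f t \<partial>M) = (\<integral>\<^sup>+t\<in>space M. f t \<partial>M)" by (intro nn_integral_cong) (auto simp: indicator_def)
  then have fin: "(\<integral>\<^sup>+t. f t \<partial>M) \<noteq> \<infinity>" using int_f[of "space M"] by simp
  have ae: "AE t in M. f t \<noteq> \<infinity>" by (rule nn_integral_PInf_AE[OF f fin])
  define g where "g t = enn2real (f t)" for t
  have [measurable]: "g \<in> borel_measurable M" unfolding g_def by measurable
  have ig: "(\<integral>\<^sup>+t. ennreal (indicator E t * g t) \<partial>M) = ennreal (?p E)" if [measurable]: "E \<in> sets M" for E
  proof -
    have "(\<integral>\<^sup>+t. ennreal (indicator E t * g t) \<partial>M) = (\<integral>\<^sup>+t\<in>E. f t \<partial>M)"
      using ae by (intro nn_integral_cong_AE) (auto simp: g_def indicator_def top.not_eq_extremum)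
    then show ?thesis by (simp add: int_f)
  qed
  have "integrable M g"
  proof (rule integrableI_nonneg)
    show "(\<integral>\<^sup>+t. ennreal (g t) \<partial>M) < \<infinity>"
    proof -
      have "(\<integral>\<^sup>+t. ennreal (g t) \<partial>M) \<le> integral\<^sup>N M f"
        by (intro nn_integral_mono) (auto simp: g_def ennreal_enn2real_if)
      then show ?thesis using fin by (simp add: less_top top_unique)
    qed
  qed (auto simp: g_def)
  moreover have "(\<integral>t. indicator E t * g t \<partial>M) = ?p E" if [measurable]: "E \<in> sets M" for E
    using ig[OF that] nonneg by (subst integral_eq_nn_integral) (auto simp: g_def)
  ultimately show ?thesis by blast
qed

text \<open>The positive variations of \<open>\<nu>\<close> and of \<open>- \<nu>\<close> differ by \<open>\<nu>\<close>.\<close>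

theorem (in sigma_finite_measure) signed_density:
  fixes \<nu> :: "'a set \<Rightarrow> real" and h :: "'a \<Rightarrow> ennreal"
  assumes h: "h \<in> borel_measurable M" "integral\<^sup>N M h \<noteq> \<infinity>"
    and add: "\<And>A B. A \<in> sets M \<Longrightarrow> B \<in> sets M \<Longrightarrow> A \<inter> B = {} \<Longrightarrow> \<nu> (A \<union> B) = \<nu> A + \<nu> B"
    and bnd: "\<And>A. A \<in> sets M \<Longrightarrow> \<bar>\<nu> A\<bar> \<le> C"
    and cont: "\<And>e. 0 < e \<Longrightarrow> \<exists>d>0. \<forall>A\<in>sets M. (\<integral>\<^sup>+t\<in>A. h t \<partial>M) < d \<longrightarrow> \<bar>\<nu> A\<bar> \<le> e"
  shows "\<exists>g. integrable M g \<and> (\<forall>E\<in>sets M. (\<integral>t. indicator E t * g t \<partial>M) = \<nu> E)"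
proof -
  obtain f1 where f1: "integrable M f1" "\<And>E. E \<in> sets M \<Longrightarrow> (\<integral>t. indicator E t * f1 t \<partial>M) = pos_var M \<nu> E"
    using pos_var_density[OF assms] by blast
  obtain f2 where f2: "integrable M f2"
    "\<And>E. E \<in> sets M \<Longrightarrow> (\<integral>t. indicator E t * f2 t \<partial>M) = pos_var M (\<lambda>E. - \<nu> E) E"
    using pos_var_density[of h "\<lambda>E. - \<nu> E" C] assms by auto
  have half: "pos_var M \<nu> E \<le> \<nu> E + pos_var M (\<lambda>E. - \<nu> E) E" if E: "E \<in> sets M"
    and add: "\<And>A B. A \<in> sets M \<Longrightarrow> B \<in> sets M \<Longrightarrow> A \<inter> B = {} \<Longrightarrow> \<nu> (A \<union> B) = \<nu> A + \<nu> B"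
    and bnd: "\<And>A. A \<in> sets M \<Longrightarrow> \<bar>\<nu> A\<bar> \<le> C" for \<nu> :: "'a set \<Rightarrow> real" and E
    unfolding pos_var_def[of M \<nu>]
  proof (rule cSUP_least)
    fix B assume "B \<in> {B \<in> sets M. B \<subseteq> E}"
    then have B: "B \<in> sets M" "B \<subseteq> E" by auto
    have "\<nu> E = \<nu> B + \<nu> (E - B)"
      using add[of B "E - B"] B E by (simp add: Un_absorb1)
    moreover have "- \<nu> (E - B) \<le> pos_var M (\<lambda>E. - \<nu> E) E"
      unfolding pos_var_def
    proof (rule cSUP_upper)
      show "bdd_above ((\<lambda>E. - \<nu> E) ` {B \<in> sets M. B \<subseteq> E})"
        by (rule bdd_aboveI2[of _ _ C]) (use bnd in \<open>force simp: abs_le_iff\<close>)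
    qed (use B E in auto)
    ultimately show "\<nu> B \<le> \<nu> E + pos_var M (\<lambda>E. - \<nu> E) E" by simp
  qed auto
  have "pos_var M \<nu> E - pos_var M (\<lambda>E. - \<nu> E) E = \<nu> E" if E: "E \<in> sets M" for E
  proof -
    have "pos_var M \<nu> E \<le> \<nu> E + pos_var M (\<lambda>E. - \<nu> E) E" by (rule half[OF E add bnd])
    moreover have "pos_var M (\<lambda>E. - \<nu> E) E \<le> - \<nu> E + pos_var M (\<lambda>E. - (- \<nu> E)) E"
      by (rule half[OF E]) (use add bnd in auto)
    ultimately show ?thesis by simp
  qed
  moreover have "(\<integral>t. indicator E t * (f1 t - f2 t) \<partial>M)
      = (\<integral>t. indicator E t * f1 t \<partial>M) - (\<integral>t. indicator E t * f2 t \<partial>M)" if "E \<in> sets M" for E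
    using that f1(1) f2(1)
    by (subst Bochner_Integration.integral_diff[symmetric])
      (auto simp: algebra_simps intro: integrable_real_mult_indicator)
  ultimately show ?thesis
    using f1 f2 by (intro exI[of _ "\<lambda>t. f1 t - f2 t"]) auto
qed

section \<open>Functionals for a bounded exponent\<close>

definition power_modular :: "'a measure \<Rightarrow> ('a \<Rightarrow> real) \<Rightarrow> ('a \<Rightarrow> real) \<Rightarrow> ennreal" where
  "power_modular M P u = (\<integral>\<^sup>+t. ennreal (\<bar>u t\<bar> powr P t) \<partial>M)"

definition Lpow :: "'a measure \<Rightarrow> ('a \<Rightarrow> real) \<Rightarrow> ('a \<Rightarrow> real) set" where
  "Lpow M P = {u \<in> borel_measurable M. power_modular M P u < \<infinity>}"

text \<open>With an exponent between two bounds in \<open>]1, \<infinity>[\<close> the Luxemburg norm can be avoided: the space is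
  where the modular is finite, and bounded functionals are those that are bounded where the modular
  is at most 1.\<close>

locale bounded_exponent = sigma_finite_measure M for M :: "'a measure" +
  fixes P :: "'a \<Rightarrow> real" and a b :: real
  assumes P_measurable [measurable]: "P \<in> borel_measurable M"
    and a_gt_1: "1 < a" and a_le_b: "a \<le> b"
    and P_bounds: "t \<in> space M \<Longrightarrow> a \<le> P t \<and> P t \<le> b"
begin

abbreviation conj_exp :: "'a \<Rightarrow> real" where "conj_exp t \<equiv> P t / (P t - 1)"

lemma Lpow_measurable: "u \<in> Lpow M P \<Longrightarrow> u \<in> borel_measurable M"
  by (simp add: Lpow_def)

lemma P_gt_1: "t \<in> space M \<Longrightarrow> 1 < P t"
  using P_bounds[of t] a_gt_1 by linarith

lemma powr_scale_le:
  assumes t: "t \<in> space M" and c: "0 < c"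
  shows "\<bar>c * x\<bar> powr P t \<le> max (c powr a) (c powr b) * \<bar>x\<bar> powr P t"
proof -
  have "c powr P t \<le> max (c powr a) (c powr b)"
  proof (cases "1 \<le> c")
    case True
    then have "c powr P t \<le> c powr b" using P_bounds[OF t] by (intro powr_mono) auto
    then show ?thesis by simp
  next
    case False
    then have "c powr P t \<le> c powr a" using P_bounds[OF t] c by (intro powr_mono') auto
    then show ?thesis by simp
  qed
  then show ?thesis using c by (simp add: abs_mult powr_mult mult_right_mono)
qed

lemma power_modular_scale_le:
  assumes [measurable]: "u \<in> borel_measurable M" and c: "0 < c"
  shows "power_modular M P (\<lambda>t. c * u t) \<le> ennreal (max (c powr a) (c powr b)) * power_modular M P u"
proof -
  have "power_modular M P (\<lambda>t. c * u t) \<le> (\<integral>\<^sup>+t. ennreal (max (c powr a) (c powr b)) * ennreal (\<bar>u t\<bar> powr P t) \<partial>M)"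
    unfolding power_modular_def
  proof (rule nn_integral_mono)
    fix t assume t: "t \<in> space M"
    have "ennreal (\<bar>c * u t\<bar> powr P t) \<le> ennreal (max (c powr a) (c powr b) * \<bar>u t\<bar> powr P t)"
      using powr_scale_le[OF t c] by (rule ennreal_leI)
    then show "ennreal (\<bar>c * u t\<bar> powr P t) \<le> ennreal (max (c powr a) (c powr b)) * ennreal (\<bar>u t\<bar> powr P t)"
      by (simp add: ennreal_mult' max_def split: if_splits)
  qed
  then show ?thesis by (simp add: nn_integral_cmult power_modular_def)
qed

lemma power_modular_mono:
  assumes "AE t in M. \<bar>u t\<bar> \<le> \<bar>v t\<bar>"
  shows "power_modular M P u \<le> power_modular M P v"
  unfolding power_modular_def
proof (rule nn_integral_mono_AE)
  show "AE t in M. ennreal (\<bar>u t\<bar> powr P t) \<le> ennreal (\<bar>v t\<bar> powr P t)"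
    using assms AE_space
    by eventually_elim (auto intro!: ennreal_leI powr_mono2 dest: P_gt_1)
qed

lemma Lpow_mono:
  assumes "u \<in> borel_measurable M" "v \<in> Lpow M P" "AE t in M. \<bar>u t\<bar> \<le> \<bar>v t\<bar>"
  shows "u \<in> Lpow M P"
  using assms power_modular_mono[OF assms(3)] by (auto simp: Lpow_def intro: order.strict_trans1)

lemma Lpow_scale: "u \<in> Lpow M P \<Longrightarrow> (\<lambda>t. c * u t) \<in> Lpow M P"
proof -
  assume u: "u \<in> Lpow M P"
  then have [measurable]: "u \<in> borel_measurable M" by (rule Lpow_measurable)
  have "power_modular M P (\<lambda>t. (\<bar>c\<bar> + 1) * u t)
      \<le> ennreal (max ((\<bar>c\<bar> + 1) powr a) ((\<bar>c\<bar> + 1) powr b)) * power_modular M P u"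
    by (rule power_modular_scale_le) auto
  also have "\<dots> < \<infinity>" using u by (simp add: Lpow_def ennreal_mult_less_top)
  finally have "(\<lambda>t. (\<bar>c\<bar> + 1) * u t) \<in> Lpow M P" by (simp add: Lpow_def)
  then show ?thesis
    by (rule Lpow_mono[rotated]) (auto simp: abs_mult intro!: mult_right_mono)
qed

lemma Lpow_add:
  assumes "u \<in> Lpow M P" "v \<in> Lpow M P"
  shows "(\<lambda>t. u t + v t) \<in> Lpow M P"
proof -
  have [measurable]: "u \<in> borel_measurable M" "v \<in> borel_measurable M" using assms by (auto simp: Lpow_def)
  have 2: "(\<lambda>t. 2 * u t) \<in> Lpow M P" "(\<lambda>t. 2 * v t) \<in> Lpow M P" using assms by (auto intro: Lpow_scale)
  have "power_modular M P (\<lambda>t. u t + v t)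
      \<le> (\<integral>\<^sup>+t. ennreal (\<bar>2 * u t\<bar> powr P t) + ennreal (\<bar>2 * v t\<bar> powr P t) \<partial>M)"
    unfolding power_modular_def
  proof (rule nn_integral_mono)
    fix t assume t: "t \<in> space M"
    have "\<bar>u t + v t\<bar> \<le> max \<bar>2 * u t\<bar> \<bar>2 * v t\<bar>" by linarith
    then have "\<bar>u t + v t\<bar> powr P t \<le> max \<bar>2 * u t\<bar> \<bar>2 * v t\<bar> powr P t"
      using P_gt_1[OF t] by (intro powr_mono2) auto
    also have "\<dots> \<le> \<bar>2 * u t\<bar> powr P t + \<bar>2 * v t\<bar> powr P t" by (simp add: max_def)
    finally show "ennreal (\<bar>u t + v t\<bar> powr P t) \<le> ennreal (\<bar>2 * u t\<bar> powr P t) + ennreal (\<bar>2 * v t\<bar> powr P t)"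
      by (simp add: ennreal_leI flip: ennreal_plus)
  qed
  also have "\<dots> = power_modular M P (\<lambda>t. 2 * u t) + power_modular M P (\<lambda>t. 2 * v t)"
    by (simp add: nn_integral_add power_modular_def)
  also have "\<dots> < \<infinity>" using 2 by (simp add: Lpow_def)
  finally show ?thesis by (simp add: Lpow_def)
qed

lemma Lpow_diff: "u \<in> Lpow M P \<Longrightarrow> v \<in> Lpow M P \<Longrightarrow> (\<lambda>t. u t - v t) \<in> Lpow M P"
  using Lpow_add[OF _ Lpow_scale, of u v "-1"] by simp

lemma Lpow_zero: "(\<lambda>_. 0) \<in> Lpow M P"
  by (simp add: Lpow_def power_modular_def)

lemma conj_exp_bounds:
  assumes "t \<in> space M"
  shows "b / (b - 1) \<le> conj_exp t" "conj_exp t \<le> a / (a - 1)"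
  using P_bounds[OF assms] a_gt_1 by (auto simp: divide_simps) (auto simp: algebra_simps)

lemma conj_bounded_exponent: "bounded_exponent M conj_exp (b / (b - 1)) (a / (a - 1))"
proof
  show "1 < b / (b - 1)" "b / (b - 1) \<le> a / (a - 1)"
    using a_gt_1 a_le_b by (auto simp: divide_simps) (auto simp: algebra_simps)
qed (use conj_exp_bounds in auto)

lemma conj_conj_exp: "t \<in> space M \<Longrightarrow> conj_exp t / (conj_exp t - 1) = P t"
  using P_gt_1[of t] by (simp add: divide_simps)

lemma mult_le_powr_conj:
  assumes "t \<in> space M"
  shows "\<bar>x * y\<bar> \<le> \<bar>x\<bar> powr P t + \<bar>y\<bar> powr conj_exp t"
proof -
  have P: "1 < P t" by (rule P_gt_1[OF assms])
  have Q: "1 < conj_exp t" "1 / P t + 1 / conj_exp t = 1" using P by (auto simp: divide_simps)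
  have "\<bar>x\<bar> * \<bar>y\<bar> \<le> \<bar>x\<bar> powr P t / P t + \<bar>y\<bar> powr conj_exp t / conj_exp t"
    using P Q by (intro Youngs_inequality) auto
  also have "\<dots> \<le> \<bar>x\<bar> powr P t / 1 + \<bar>y\<bar> powr conj_exp t / 1"
    using P Q by (intro add_mono divide_left_mono) auto
  finally show ?thesis by (simp add: abs_mult)
qed

lemma pairing_le:
  assumes [measurable]: "u \<in> borel_measurable M" "g \<in> borel_measurable M"
  shows "(\<integral>\<^sup>+t. ennreal \<bar>u t * g t\<bar> \<partial>M) \<le> power_modular M P u + power_modular M conj_exp g"
proof -
  have "(\<integral>\<^sup>+t. ennreal \<bar>u t * g t\<bar> \<partial>M) \<le> (\<integral>\<^sup>+t. ennreal (\<bar>u t\<bar> powr P t) + ennreal (\<bar>g t\<bar> powr conj_exp t) \<partial>M)"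
  proof (rule nn_integral_mono)
    fix t assume t: "t \<in> space M"
    show "ennreal \<bar>u t * g t\<bar> \<le> ennreal (\<bar>u t\<bar> powr P t) + ennreal (\<bar>g t\<bar> powr conj_exp t)"
      using ennreal_leI[OF mult_le_powr_conj[OF t, of "u t" "g t"]] by simp
  qed
  also have "\<dots> = power_modular M P u + power_modular M conj_exp g"
    by (simp add: nn_integral_add power_modular_def)
  finally show ?thesis .
qed

lemma pairing_integrable:
  assumes u: "u \<in> Lpow M P" and g: "g \<in> Lpow M conj_exp"
  shows "integrable M (\<lambda>t. u t * g t)"
proof (rule integrableI_bounded)
  have [measurable]: "u \<in> borel_measurable M" "g \<in> borel_measurable M" using assms by (auto simp: Lpow_def)
  show "(\<lambda>t. u t * g t) \<in> borel_measurable M" by measurable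
  have "(\<integral>\<^sup>+t. ennreal (norm (u t * g t)) \<partial>M) \<le> power_modular M P u + power_modular M conj_exp g"
    using pairing_le[of u g] by simp
  also have "\<dots> < \<infinity>" using assms by (simp add: Lpow_def)
  finally show "(\<integral>\<^sup>+t. ennreal (norm (u t * g t)) \<partial>M) < \<infinity>" .
qed

lemma pairing_bound:
  assumes u: "u \<in> Lpow M P" and g: "g \<in> Lpow M conj_exp"
  shows "\<bar>\<integral>t. u t * g t \<partial>M\<bar> \<le> enn2real (power_modular M P u) + enn2real (power_modular M conj_exp g)"
proof -
  have [measurable]: "u \<in> borel_measurable M" "g \<in> borel_measurable M" using assms by (auto simp: Lpow_def)
  have fin: "power_modular M P u < top" "power_modular M conj_exp g < top" using assms by (auto simp: Lpow_def)
  have "\<bar>\<integral>t. u t * g t \<partial>M\<bar> \<le> (\<integral>t. \<bar>u t * g t\<bar> \<partial>M)" by (rule integral_abs_bound)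
  also have "\<dots> = enn2real (\<integral>\<^sup>+t. ennreal \<bar>u t * g t\<bar> \<partial>M)"
    by (rule integral_eq_nn_integral) auto
  also have "\<dots> \<le> enn2real (power_modular M P u + power_modular M conj_exp g)"
    by (rule enn2real_mono[OF pairing_le]) (use fin in auto)
  also have "\<dots> = enn2real (power_modular M P u) + enn2real (power_modular M conj_exp g)"
    using fin by (simp add: enn2real_plus)
  finally show ?thesis .
qed

context
  fixes F :: "('a \<Rightarrow> real) \<Rightarrow> real" and B :: real
  assumes F_add: "\<And>u v. u \<in> Lpow M P \<Longrightarrow> v \<in> Lpow M P \<Longrightarrow> F (\<lambda>t. u t + v t) = F u + F v"
    and F_scale: "\<And>u c. u \<in> Lpow M P \<Longrightarrow> F (\<lambda>t. c * u t) = c * F u"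
    and F_bound: "\<And>u. u \<in> Lpow M P \<Longrightarrow> power_modular M P u \<le> 1 \<Longrightarrow> \<bar>F u\<bar> \<le> B"
begin

lemma B_nonneg: "0 \<le> B"
  using F_bound[OF Lpow_zero] by (simp add: power_modular_def)

lemma F_zero: "F (\<lambda>_. 0) = 0"
  using F_scale[OF Lpow_zero, of 0] by simp

lemma F_diff: "u \<in> Lpow M P \<Longrightarrow> v \<in> Lpow M P \<Longrightarrow> F (\<lambda>t. u t - v t) = F u - F v"
  using F_add[OF _ Lpow_scale, of u v "-1"] F_scale[of v "-1"] by simp

lemma F_bound_scaled:
  assumes u: "u \<in> Lpow M P" and c: "0 < c" and le: "power_modular M P u \<le> ennreal r" "0 \<le> r"
    and small: "max ((1/c) powr a) ((1/c) powr b) * r \<le> 1"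
  shows "\<bar>F u\<bar> \<le> B * c"
proof -
  have [measurable]: "u \<in> borel_measurable M" using u by (rule Lpow_measurable)
  have mx: "0 \<le> max ((1/c) powr a) ((1/c) powr b)" by (simp add: le_max_iff_disj)
  have "power_modular M P (\<lambda>t. 1/c * u t) \<le> ennreal (max ((1/c) powr a) ((1/c) powr b)) * power_modular M P u"
    by (rule power_modular_scale_le) (use c in auto)
  also have "\<dots> \<le> ennreal (max ((1/c) powr a) ((1/c) powr b)) * ennreal r" by (rule mult_left_mono[OF le(1)]) simp
  also have "\<dots> = ennreal (max ((1/c) powr a) ((1/c) powr b) * r)" using mx le(2) by (rule ennreal_mult[symmetric])
  also have "\<dots> \<le> 1" using small by simp
  finally have "\<bar>F (\<lambda>t. 1/c * u t)\<bar> \<le> B" by (rule F_bound[OF Lpow_scale[OF u]])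
  then have "\<bar>F u\<bar> / c \<le> B" using F_scale[OF u, of "1/c"] c by (simp add: abs_mult)
  then show ?thesis using c by (simp add: pos_divide_le_eq)
qed

text \<open>Functionals are bounded by a power of the modular: with exponent \<open>1/a < 1\<close> for large modulars, which gives
  the a priori bound for the representing density, and with exponent \<open>1/b\<close> for small ones, which
  gives continuity.\<close>

lemma F_bound_large:
  assumes u: "u \<in> Lpow M P" and le: "power_modular M P u \<le> ennreal r" "1 \<le> r"
  shows "\<bar>F u\<bar> \<le> B * r powr (1/a)"
proof (rule F_bound_scaled[OF u _ le(1)])
  let ?c = "r powr (1/a)"
  have c: "1 \<le> ?c" using le(2) a_gt_1 by (simp add: ge_one_powr_ge_zero)
  then show "0 < ?c" by linarith
  have "(1/?c) powr b \<le> (1/?c) powr a" using c a_le_b by (intro powr_mono') (auto simp: divide_le_eq)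
  then have "max ((1/?c) powr a) ((1/?c) powr b) = (1/?c) powr a" by simp
  also have "\<dots> = 1 / r" using le(2) a_gt_1 by (simp add: powr_divide powr_powr)
  finally show "max ((1/?c) powr a) ((1/?c) powr b) * r \<le> 1" using le(2) by simp
qed (use le in simp)

lemma F_bound_small:
  assumes u: "u \<in> Lpow M P" and le: "power_modular M P u \<le> ennreal r" "0 < r" "r \<le> 1"
  shows "\<bar>F u\<bar> \<le> B * r powr (1/b)"
proof (rule F_bound_scaled[OF u _ le(1)])
  let ?c = "r powr (1/b)"
  have b: "1 < b" using a_gt_1 a_le_b by linarith
  show c0: "0 < ?c" using le by simp
  have "?c \<le> 1" using le b by (simp add: powr_le1)
  then have "1 \<le> 1/?c" using c0 by simp
  then have "(1/?c) powr a \<le> (1/?c) powr b" using a_le_b by (intro powr_mono) auto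
  then have "max ((1/?c) powr a) ((1/?c) powr b) = (1/?c) powr b" by simp
  also have "\<dots> = 1 / r" using le b by (simp add: powr_divide powr_powr)
  finally show "max ((1/?c) powr a) ((1/?c) powr b) * r \<le> 1" using le(2) by simp
qed (use le in simp)

lemma F_small:
  assumes "0 < e"
  obtains r where "0 < r" "r \<le> 1" "\<And>u. u \<in> Lpow M P \<Longrightarrow> power_modular M P u \<le> ennreal r \<Longrightarrow> \<bar>F u\<bar> \<le> e"
proof -
  have b: "1 < b" using a_gt_1 a_le_b by linarith
  define q where "q = min 1 (e / (B + 1))"
  have q: "0 < q" "q \<le> 1" using assms B_nonneg by (auto simp: q_def)
  have "B * q \<le> (B + 1) * (e / (B + 1))" using q B_nonneg assms by (intro mult_mono) (auto simp: q_def)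
  then have Bq: "B * q \<le> e" using B_nonneg by simp
  have r: "0 < q powr b" "q powr b \<le> 1" using q b by (auto simp: powr_le1)
  have "\<bar>F u\<bar> \<le> e" if "u \<in> Lpow M P" "power_modular M P u \<le> ennreal (q powr b)" for u
    using F_bound_small[OF that r] q b Bq by (simp add: powr_powr)
  with r that show thesis by blast
qed

lemma F_continuous:
  assumes [measurable]: "\<And>n. u n \<in> borel_measurable M" "v \<in> borel_measurable M" and w: "w \<in> Lpow M P"
    and lim: "\<And>t. t \<in> space M \<Longrightarrow> (\<lambda>n. u n t) \<longlonglongrightarrow> v t" and dom: "\<And>n t. t \<in> space M \<Longrightarrow> \<bar>u n t\<bar> \<le> \<bar>w t\<bar>"
  shows "(\<lambda>n. F (u n)) \<longlonglongrightarrow> F v"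
proof -
  have [measurable]: "w \<in> borel_measurable M" using w by (rule Lpow_measurable)
  have vw: "\<bar>v t\<bar> \<le> \<bar>w t\<bar>" if "t \<in> space M" for t
    by (rule LIMSEQ_le_const2[OF tendsto_rabs[OF lim[OF that]]]) (use dom that in auto)
  have un: "u n \<in> Lpow M P" for n by (rule Lpow_mono[OF _ w]) (use dom in auto)
  have v: "v \<in> Lpow M P" by (rule Lpow_mono[OF _ w]) (use vw in auto)
  have "(\<lambda>n. power_modular M P (\<lambda>t. u n t - v t)) \<longlonglongrightarrow> (\<integral>\<^sup>+t. 0 \<partial>M)"
    unfolding power_modular_def
  proof (rule nn_integral_dominated_convergence)
    show "(\<integral>\<^sup>+t. ennreal (\<bar>2 * w t\<bar> powr P t) \<partial>M) < \<infinity>"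
      using Lpow_scale[OF w, of 2] by (simp add: Lpow_def power_modular_def)
    show "AE t in M. ennreal (\<bar>u n t - v t\<bar> powr P t) \<le> ennreal (\<bar>2 * w t\<bar> powr P t)" for n
    proof (rule AE_I2)
      fix t assume t: "t \<in> space M"
      have "\<bar>u n t - v t\<bar> \<le> \<bar>2 * w t\<bar>" using dom[OF t, of n] vw[OF t] by linarith
      then show "ennreal (\<bar>u n t - v t\<bar> powr P t) \<le> ennreal (\<bar>2 * w t\<bar> powr P t)"
        using P_gt_1[OF t] by (intro ennreal_leI powr_mono2) auto
    qed
    show "AE t in M. (\<lambda>n. ennreal (\<bar>u n t - v t\<bar> powr P t)) \<longlonglongrightarrow> 0"
    proof (rule AE_I2)
      fix t assume t: "t \<in> space M"
      have "(\<lambda>n. \<bar>u n t - v t\<bar>) \<longlonglongrightarrow> 0"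
        using tendsto_rabs_zero[OF LIM_zero[OF lim[OF t]]] .
      then have "(\<lambda>n. \<bar>u n t - v t\<bar> powr P t) \<longlonglongrightarrow> 0 powr P t"
        using P_gt_1[OF t] by (intro tendsto_powr' tendsto_const) auto
      then show "(\<lambda>n. ennreal (\<bar>u n t - v t\<bar> powr P t)) \<longlonglongrightarrow> 0"
        using P_gt_1[OF t] tendsto_ennrealI by fastforce
    qed
  qed measurable
  then have lim0: "(\<lambda>n. power_modular M P (\<lambda>t. u n t - v t)) \<longlonglongrightarrow> 0" by simp
  show ?thesis
  proof (rule LIMSEQ_I)
    fix e :: real assume "0 < e"
    then obtain r where r: "0 < r" "\<And>u. u \<in> Lpow M P \<Longrightarrow> power_modular M P u \<le> ennreal r \<Longrightarrow> \<bar>F u\<bar> \<le> e/2"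
      using F_small[of "e/2"] by (metis half_gt_zero)
    have "\<forall>\<^sub>F n in sequentially. power_modular M P (\<lambda>t. u n t - v t) < ennreal r"
      by (rule order_tendstoD(2)[OF lim0]) (use r in simp)
    then obtain N where N: "\<And>n. n \<ge> N \<Longrightarrow> power_modular M P (\<lambda>t. u n t - v t) < ennreal r"
      by (auto simp: eventually_sequentially)
    have "norm (F (u n) - F v) < e" if "n \<ge> N" for n
      using r(2)[OF Lpow_diff[OF un v] less_imp_le[OF N[OF that]]] F_diff[OF un v, of n] \<open>0 < e\<close> by simp
    then show "\<exists>N. \<forall>n\<ge>N. norm (F (u n) - F v) < e" by blast
  qed
qed

text \<open>Choose a strictly positive \<open>w\<close> of finite modular. The set function that takes \<open>E\<close> to the value of \<open>F\<close> at
  the restriction of \<open>w\<close> to \<open>E\<close> has a density \<open>G\<close>, and \<open>g = G / w\<close> represents \<open>F\<close> on all bounded multiples of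
  \<open>w\<close>. Testing \<open>F\<close> with truncations of the function \<open>sgn g * \<bar>g\<bar> powr (Q - 1)\<close>, where \<open>Q\<close> is the
  conjugate exponent, bounds their modulars \<open>R\<close> by \<open>R \<le> B * R powr (1/a)\<close> once \<open>R \<ge> 1\<close>; hence \<open>g\<close> has finite
  modular for \<open>Q\<close>, and truncation extends the representation to the whole space.\<close>

theorem functional_representation:
  "\<exists>g\<in>Lpow M conj_exp. \<forall>u\<in>Lpow M P. F u = (\<integral>t. u t * g t \<partial>M)"
proof -
  obtain h where [measurable]: "h \<in> borel_measurable M" and h_fin: "integral\<^sup>N M h \<noteq> \<infinity>"
    and h_pos: "\<And>t. t \<in> space M \<Longrightarrow> 0 < h t \<and> h t < \<infinity>"
    using Ex_finite_integrable_function by blast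
  define w where "w t = enn2real (h t) powr (1 / P t)" for t
  have [measurable]: "w \<in> borel_measurable M" unfolding w_def[abs_def] by measurable
  have w_pos: "0 < w t" if "t \<in> space M" for t
    using h_pos[OF that] by (auto simp: w_def enn2real_eq_0_iff)
  have w_powr: "ennreal (\<bar>w t\<bar> powr P t) = h t" if "t \<in> space M" for t
    using h_pos[OF that] P_gt_1[OF that] by (simp add: w_def powr_powr)
  have mod_ind: "power_modular M P (\<lambda>t. indicator E t * w t) = (\<integral>\<^sup>+t\<in>E. h t \<partial>M)" for E
    unfolding power_modular_def
    by (intro nn_integral_cong) (simp add: indicator_def w_powr split: if_splits)
  have w: "w \<in> Lpow M P"
  proof -
    have "power_modular M P w = integral\<^sup>N M h"
      unfolding power_modular_def by (intro nn_integral_cong w_powr)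
    then show ?thesis using h_fin by (simp add: Lpow_def top.not_eq_extremum)
  qed
  have ind: "(\<lambda>t. indicator E t * w t) \<in> Lpow M P" if [measurable]: "E \<in> sets M" for E
    by (rule Lpow_mono[OF _ w]) (auto simp: indicator_def)
  have "\<exists>G. integrable M G \<and> (\<forall>E\<in>sets M. (\<integral>t. indicator E t * G t \<partial>M) = F (\<lambda>t. indicator E t * w t))"
  proof (rule signed_density[where h=h])
    show "F (\<lambda>t. indicator (A \<union> D) t * w t) = F (\<lambda>t. indicator A t * w t) + F (\<lambda>t. indicator D t * w t)"
      if "A \<in> sets M" "D \<in> sets M" "A \<inter> D = {}" for A D
    proof -
      have "(\<lambda>t. indicator (A \<union> D) t * w t) = (\<lambda>t. indicator A t * w t + indicator D t * w t)"
        using that(3) by (auto simp: fun_eq_iff indicator_def)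
      then show ?thesis using F_add[OF ind[OF that(1)] ind[OF that(2)]] by simp
    qed
    define r where "r = max 1 (enn2real (integral\<^sup>N M h))"
    show "\<bar>F (\<lambda>t. indicator A t * w t)\<bar> \<le> B * r powr (1/a)" if "A \<in> sets M" for A
    proof (rule F_bound_large[OF ind[OF that]])
      have "(\<integral>\<^sup>+t\<in>A. h t \<partial>M) \<le> integral\<^sup>N M h" by (intro nn_integral_mono) (auto simp: indicator_def)
      also have "\<dots> = ennreal (enn2real (integral\<^sup>N M h))" using h_fin by (simp add: top.not_eq_extremum)
      also have "\<dots> \<le> ennreal r" by (intro ennreal_leI) (simp add: r_def)
      finally show "power_modular M P (\<lambda>t. indicator A t * w t) \<le> ennreal r" by (simp add: mod_ind)
    qed (simp add: r_def)
    show "\<exists>d>0. \<forall>A\<in>sets M. (\<integral>\<^sup>+t\<in>A. h t \<partial>M) < d \<longrightarrow> \<bar>F (\<lambda>t. indicator A t * w t)\<bar> \<le> e" if e: "0 < e" for e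
    proof -
      obtain r where r: "0 < r" "\<And>u. u \<in> Lpow M P \<Longrightarrow> power_modular M P u \<le> ennreal r \<Longrightarrow> \<bar>F u\<bar> \<le> e"
        using F_small[OF e] by blast
      then show ?thesis using ind by (intro exI[of _ "ennreal r"]) (auto simp: mod_ind)
    qed
  qed (use h_fin in auto)
  then obtain G where G: "integrable M G"
    "\<And>E. E \<in> sets M \<Longrightarrow> F (\<lambda>t. indicator E t * w t) = (\<integral>t. indicator E t * G t \<partial>M)" by auto
  have [measurable]: "G \<in> borel_measurable M" using G(1) by simp
  have sG: "integrable M (\<lambda>t. s t * G t)"
    if [measurable]: "s \<in> borel_measurable M" and K: "\<And>t. t \<in> space M \<Longrightarrow> \<bar>s t\<bar> \<le> K" for s K
  proof (rule Bochner_Integration.integrable_bound)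
    show "integrable M (\<lambda>t. K * G t)" using G(1) by simp
    show "AE t in M. norm (s t * G t) \<le> norm (K * G t)"
      using K by (intro AE_I2) (force simp: abs_mult intro!: mult_right_mono)
  qed measurable
  have sw: "(\<lambda>t. s t * w t) \<in> Lpow M P"
    if [measurable]: "s \<in> borel_measurable M" and K: "\<And>t. t \<in> space M \<Longrightarrow> \<bar>s t\<bar> \<le> K" for s K
    by (rule Lpow_mono[OF _ Lpow_scale[OF w, of K]])
      (use K in \<open>force simp: abs_mult intro!: AE_I2 mult_right_mono\<close>)+
  have nonneg_case: "(\<forall>t\<in>space M. s t \<le> K) \<longrightarrow> F (\<lambda>t. s t * w t) = (\<integral>t. s t * G t \<partial>M)"
    if "s \<in> borel_measurable M" "\<And>t. 0 \<le> s t" for s K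
    using that
  proof (induction arbitrary: K rule: borel_measurable_induct_real)
    case (set A)
    then show ?case using G(2) by simp
  next
    case (mult u c)
    show ?case
    proof (cases "c = 0")
      case True
      then show ?thesis by (simp add: F_zero)
    next
      case False
      show ?thesis
      proof
        assume "\<forall>t\<in>space M. c * u t \<le> K"
        then have K: "u t \<le> K / c" if "t \<in> space M" for t
          using that False mult.hyps(1) by (simp add: pos_le_divide_eq mult.commute)
        then have "(\<lambda>t. u t * w t) \<in> Lpow M P" using mult.hyps by (intro sw[of u "K / c"]) auto
        then have "F (\<lambda>t. c * (u t * w t)) = c * F (\<lambda>t. u t * w t)" by (rule F_scale)
        then show "F (\<lambda>t. c * u t * w t) = (\<integral>t. c * u t * G t \<partial>M)"
          using mult.IH[of "K / c"] K by (simp add: mult.assoc)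
      qed
    qed
  next
    case (add u v)
    show ?case
    proof
      assume "\<forall>t\<in>space M. v t + u t \<le> K"
      then have K: "u t \<le> K" "v t \<le> K" if "t \<in> space M" for t
      proof -
        have "v t + u t \<le> K" "0 \<le> u t" "0 \<le> v t"
          using \<open>\<forall>t\<in>space M. v t + u t \<le> K\<close> that add.hyps by auto
        then show "u t \<le> K" "v t \<le> K" by linarith+
      qed
      have m: "(\<lambda>t. u t * w t) \<in> Lpow M P" "(\<lambda>t. v t * w t) \<in> Lpow M P"
        "integrable M (\<lambda>t. u t * G t)" "integrable M (\<lambda>t. v t * G t)"
        using add.hyps K by (auto intro!: sw[of _ K] sG[of _ K])
      have "F (\<lambda>t. v t * w t + u t * w t) = (\<integral>t. v t * G t \<partial>M) + (\<integral>t. u t * G t \<partial>M)"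
        using F_add[OF m(2,1)] add.IH[of K] K by simp
      then show "F (\<lambda>t. (v t + u t) * w t) = (\<integral>t. (v t + u t) * G t \<partial>M)"
        using m by (simp add: distrib_right)
    qed
  next
    case (seq U)
    show ?case
    proof
      assume K: "\<forall>t\<in>space M. s t \<le> K"
      have UK: "\<bar>U n t\<bar> \<le> K" if "t \<in> space M" for n t
      proof -
        have "incseq (\<lambda>n. U n t)" using seq.hyps(3) by (auto simp: incseq_def le_fun_def)
        then have "U n t \<le> s t" using seq.hyps(4)[OF that] by (rule incseq_le)
        then show ?thesis using K that seq.hyps(2)[of n t] by fastforce
      qed
      have "(\<lambda>n. F (\<lambda>t. U n t * w t)) \<longlonglongrightarrow> F (\<lambda>t. s t * w t)"
      proof (rule F_continuous)
        show "(\<lambda>t. K * w t) \<in> Lpow M P" by (rule Lpow_scale[OF w])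
        show "\<bar>U n t * w t\<bar> \<le> \<bar>K * w t\<bar>" if "t \<in> space M" for n t
          using UK[OF that, of n] by (force simp: abs_mult intro!: mult_right_mono)
        show "(\<lambda>n. U n t * w t) \<longlonglongrightarrow> s t * w t" if "t \<in> space M" for t
          by (intro tendsto_mult seq.hyps(4) that tendsto_const)
      qed (use seq.hyps(1) that(1) in measurable)
      moreover have "(\<lambda>n. \<integral>t. U n t * G t \<partial>M) \<longlonglongrightarrow> (\<integral>t. s t * G t \<partial>M)"
      proof (rule integral_dominated_convergence[where w="\<lambda>t. \<bar>K\<bar> * \<bar>G t\<bar>"])
        show "AE t in M. (\<lambda>n. U n t * G t) \<longlonglongrightarrow> s t * G t"
          by (intro AE_I2 tendsto_mult seq.hyps(4) tendsto_const)
        show "AE t in M. norm (U n t * G t) \<le> \<bar>K\<bar> * \<bar>G t\<bar>" for n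
        proof (rule AE_I2)
          fix t assume "t \<in> space M"
          then have "\<bar>U n t\<bar> \<le> \<bar>K\<bar>" using UK[of t n] by linarith
          then show "norm (U n t * G t) \<le> \<bar>K\<bar> * \<bar>G t\<bar>" by (simp add: abs_mult mult_right_mono)
        qed
      qed (use seq.hyps(1) that(1) G(1) in auto)
      moreover have "F (\<lambda>t. U n t * w t) = (\<integral>t. U n t * G t \<partial>M)" for n
        using seq.IH[of n K] UK[of _ n] by (simp add: abs_le_iff)
      ultimately show "F (\<lambda>t. s t * w t) = (\<integral>t. s t * G t \<partial>M)" by (simp add: LIMSEQ_unique)
    qed
  qed
  have F_sw: "F (\<lambda>t. s t * w t) = (\<integral>t. s t * G t \<partial>M)"
    if [measurable]: "s \<in> borel_measurable M" and K: "\<And>t. t \<in> space M \<Longrightarrow> \<bar>s t\<bar> \<le> K" for s K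
  proof -
    let ?p = "\<lambda>t. max (s t) 0" and ?n = "\<lambda>t. max (- s t) 0"
    have bd: "\<bar>?p t\<bar> \<le> K" "\<bar>?n t\<bar> \<le> K" if "t \<in> space M" for t using K[OF that] by auto
    have mem: "(\<lambda>t. ?p t * w t) \<in> Lpow M P" "(\<lambda>t. ?n t * w t) \<in> Lpow M P"
      "integrable M (\<lambda>t. ?p t * G t)" "integrable M (\<lambda>t. ?n t * G t)"
      by (rule sw sG; use bd in \<open>auto\<close>)+
    have split: "s t = ?p t - ?n t" for t by auto
    have "F (\<lambda>t. s t * w t) = F (\<lambda>t. ?p t * w t - ?n t * w t)" by (simp only: left_diff_distrib[symmetric] split[symmetric])
    also have "\<dots> = (\<integral>t. ?p t * G t \<partial>M) - (\<integral>t. ?n t * G t \<partial>M)"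
      using F_diff[OF mem(1,2)] nonneg_case[of ?p K] nonneg_case[of ?n K] bd by (simp add: abs_le_iff)
    also have "\<dots> = (\<integral>t. ?p t * G t - ?n t * G t \<partial>M)"
      using mem(3,4) by (rule Bochner_Integration.integral_diff[symmetric])
    also have "\<dots> = (\<integral>t. s t * G t \<partial>M)" by (simp only: left_diff_distrib[symmetric] split[symmetric])
    finally show ?thesis .
  qed
  define g where "g t = G t / w t" for t
  have [measurable]: "g \<in> borel_measurable M" unfolding g_def[abs_def] by measurable
  have gw: "G t = g t * w t" if "t \<in> space M" for t using w_pos[OF that] by (simp add: g_def)
  have g: "g \<in> Lpow M conj_exp"
  proof -
    define S where "S n = {t \<in> space M. \<bar>g t\<bar> powr (conj_exp t - 1) \<le> real n * w t}" for n
    have [measurable]: "S n \<in> sets M" for n unfolding S_def by measurable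
    define s where "s n t = indicator (S n) t * (sgn (g t) * \<bar>g t\<bar> powr (conj_exp t - 1) / w t)" for n t
    define R where "R n = (\<integral>\<^sup>+t. ennreal (indicator (S n) t * \<bar>g t\<bar> powr conj_exp t) \<partial>M)" for n
    have [measurable]: "s n \<in> borel_measurable M" for n unfolding s_def[abs_def] by measurable
    have sn: "\<bar>s n t\<bar> \<le> real n" if "t \<in> space M" for n t
      using w_pos[OF that] by (auto simp: s_def S_def indicator_def abs_mult abs_sgn_eq pos_divide_le_eq)
    have q: "(conj_exp t - 1) * P t = conj_exp t" if "t \<in> space M" for t
      using P_gt_1[OF that] by (simp add: divide_simps)
    have smod: "power_modular M P (\<lambda>t. s n t * w t) = R n" for n
      unfolding power_modular_def R_def
    proof (rule nn_integral_cong)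
      fix t assume t: "t \<in> space M"
      have "\<bar>s n t * w t\<bar> = indicator (S n) t * \<bar>g t\<bar> powr (conj_exp t - 1)"
        using w_pos[OF t] by (auto simp: s_def indicator_def abs_mult abs_sgn_eq)
      then have "\<bar>s n t * w t\<bar> powr P t = indicator (S n) t * \<bar>g t\<bar> powr ((conj_exp t - 1) * P t)"
        by (simp add: indicator_def powr_powr)
      then show "ennreal (\<bar>s n t * w t\<bar> powr P t) = ennreal (indicator (S n) t * \<bar>g t\<bar> powr conj_exp t)"
        by (simp only: q[OF t])
    qed
    have Rfin: "R n < \<infinity>" for n
      using sw[of "s n" "real n"] sn by (simp add: Lpow_def smod)
    have FR: "F (\<lambda>t. s n t * w t) = enn2real (R n)" for n
    proof -
      have "F (\<lambda>t. s n t * w t) = (\<integral>t. s n t * G t \<partial>M)" by (rule F_sw) (auto intro: sn)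
      also have "\<dots> = (\<integral>t. indicator (S n) t * \<bar>g t\<bar> powr conj_exp t \<partial>M)"
      proof (rule Bochner_Integration.integral_cong[OF refl])
        fix t assume t: "t \<in> space M"
        have "\<bar>g t\<bar> powr conj_exp t = \<bar>g t\<bar> powr (conj_exp t - 1) * \<bar>g t\<bar>"
          using powr_add[of "\<bar>g t\<bar>" "conj_exp t - 1" 1] by simp
        also have "\<dots> = \<bar>g t\<bar> powr (conj_exp t - 1) * (sgn (g t) * g t)"
          by (simp add: abs_sgn mult.commute)
        finally show "s n t * G t = indicator (S n) t * \<bar>g t\<bar> powr conj_exp t"
          using w_pos[OF t] by (simp add: s_def gw[OF t])
      qed
      also have "\<dots> = enn2real (R n)"
        unfolding R_def by (rule integral_eq_nn_integral) auto
      finally show ?thesis .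
    qed
    define K where "K = max 1 (B powr (a / (a - 1)))"
    have RK: "R n \<le> ennreal K" for n
    proof -
      define r where "r = enn2real (R n)"
      have Rr: "R n = ennreal r" using Rfin[of n] by (simp add: r_def)
      have "r \<le> K"
      proof (cases "1 \<le> r")
        case True
        have mem: "(\<lambda>t. s n t * w t) \<in> Lpow M P" by (rule sw) (auto intro: sn)
        have "\<bar>F (\<lambda>t. s n t * w t)\<bar> \<le> B * r powr (1/a)"
          by (rule F_bound_large[OF mem _ True]) (simp add: smod Rr)
        then have le: "r \<le> B * r powr (1/a)" using True by (simp add: FR flip: r_def)
        have "r = r powr (1 - 1/a) * r powr (1/a)" using True by (simp flip: powr_add)
        then have "r powr (1 - 1/a) * r powr (1/a) \<le> B * r powr (1/a)" using le by simp
        then have rB: "r powr (1 - 1/a) \<le> B" using True by (simp add: mult_le_cancel_right)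
        have ex: "(1 - 1/a) * (a / (a - 1)) = 1" using a_gt_1 by (simp add: divide_simps)
        have "r = (r powr (1 - 1/a)) powr (a / (a - 1))" unfolding powr_powr ex using True by simp
        also have "\<dots> \<le> B powr (a / (a - 1))" using rB a_gt_1 by (intro powr_mono2) auto
        finally show ?thesis by (simp add: K_def)
      qed (simp add: K_def)
      then show ?thesis by (simp add: Rr ennreal_leI)
    qed
    have "power_modular M conj_exp g = (\<integral>\<^sup>+t. liminf (\<lambda>n. ennreal (indicator (S n) t * \<bar>g t\<bar> powr conj_exp t)) \<partial>M)"
      unfolding power_modular_def
    proof (rule nn_integral_cong)
      fix t assume t: "t \<in> space M"
      obtain N :: nat where N: "\<bar>g t\<bar> powr (conj_exp t - 1) / w t \<le> real N" using real_arch_simple by blast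
      have "t \<in> S n" if "n \<ge> N" for n
      proof -
        have "\<bar>g t\<bar> powr (conj_exp t - 1) / w t \<le> real n" using N that by linarith
        then show ?thesis using w_pos[OF t] t by (simp add: S_def pos_divide_le_eq)
      qed
      then have "\<forall>\<^sub>F n in sequentially. ennreal (indicator (S n) t * \<bar>g t\<bar> powr conj_exp t) = ennreal (\<bar>g t\<bar> powr conj_exp t)"
        by (intro eventually_sequentiallyI[of N]) simp
      then have "(\<lambda>n. ennreal (indicator (S n) t * \<bar>g t\<bar> powr conj_exp t)) \<longlonglongrightarrow> ennreal (\<bar>g t\<bar> powr conj_exp t)"
        by (rule tendsto_eventually)
      then show "ennreal (\<bar>g t\<bar> powr conj_exp t) = liminf (\<lambda>n. ennreal (indicator (S n) t * \<bar>g t\<bar> powr conj_exp t))"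
        by (intro lim_imp_Liminf[symmetric]) auto
    qed
    also have "\<dots> \<le> liminf R"
      unfolding R_def by (rule nn_integral_liminf) measurable
    also have "\<dots> \<le> liminf (\<lambda>n. ennreal K)" by (rule Liminf_mono) (use RK in auto)
    also have "\<dots> = ennreal K" by (rule Liminf_const) simp
    also have "\<dots> < \<infinity>" by simp
    finally show ?thesis by (simp add: Lpow_def)
  qed
  have "F u = (\<integral>t. u t * g t \<partial>M)" if u: "u \<in> Lpow M P" for u
  proof -
    have [measurable]: "u \<in> borel_measurable M" using u by (rule Lpow_measurable)
    define S where "S n = {t \<in> space M. \<bar>u t\<bar> \<le> real n * w t}" for n
    have [measurable]: "S n \<in> sets M" for n unfolding S_def by measurable
    define s where "s n t = indicator (S n) t * (u t / w t)" for n t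
    have [measurable]: "s n \<in> borel_measurable M" for n unfolding s_def[abs_def] by measurable
    have sn: "\<bar>s n t\<bar> \<le> real n" if "t \<in> space M" for n t
      using w_pos[OF that] by (auto simp: s_def S_def indicator_def abs_divide pos_divide_le_eq)
    have swu: "s n t * w t = indicator (S n) t * u t" if "t \<in> space M" for n t
      using w_pos[OF that] by (simp add: s_def)
    have conv: "(\<lambda>n. s n t * w t) \<longlonglongrightarrow> u t" if t: "t \<in> space M" for t
    proof -
      obtain N :: nat where N: "\<bar>u t\<bar> / w t \<le> real N" using real_arch_simple by blast
      have "t \<in> S n" if "n \<ge> N" for n
      proof -
        have "\<bar>u t\<bar> / w t \<le> real n" using N that by linarith
        then show ?thesis using w_pos[OF t] t by (simp add: S_def pos_divide_le_eq)
      qed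
      then have "\<forall>\<^sub>F n in sequentially. s n t * w t = u t"
        by (intro eventually_sequentiallyI[of N]) (simp add: swu[OF t])
      then show ?thesis by (rule tendsto_eventually)
    qed
    have "(\<lambda>n. F (\<lambda>t. s n t * w t)) \<longlonglongrightarrow> F u"
      by (rule F_continuous[OF _ _ u conv]) (auto simp: swu indicator_def)
    moreover have "(\<lambda>n. \<integral>t. s n t * G t \<partial>M) \<longlonglongrightarrow> (\<integral>t. u t * g t \<partial>M)"
    proof (rule integral_dominated_convergence[where w="\<lambda>t. \<bar>u t * g t\<bar>"])
      show "integrable M (\<lambda>t. \<bar>u t * g t\<bar>)" using pairing_integrable[OF u g] by simp
      show "AE t in M. (\<lambda>n. s n t * G t) \<longlonglongrightarrow> u t * g t"
      proof (rule AE_I2)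
        fix t assume t: "t \<in> space M"
        have "(\<lambda>n. s n t * w t * g t) \<longlonglongrightarrow> u t * g t" by (intro tendsto_mult conv t tendsto_const)
        then show "(\<lambda>n. s n t * G t) \<longlonglongrightarrow> u t * g t" by (simp add: gw[OF t] ac_simps)
      qed
      show "AE t in M. norm (s n t * G t) \<le> \<bar>u t * g t\<bar>" for n
      proof (rule AE_I2)
        fix t assume t: "t \<in> space M"
        have "s n t * G t = indicator (S n) t * (u t * g t)"
          using swu[OF t, of n] by (simp add: gw[OF t] mult.assoc[symmetric] mult.commute[of "g t"])
        then show "norm (s n t * G t) \<le> \<bar>u t * g t\<bar>" by (simp add: indicator_def)
      qed
    qed measurable
    moreover have "F (\<lambda>t. s n t * w t) = (\<integral>t. s n t * G t \<partial>M)" for n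
      by (rule F_sw) (auto intro: sn)
    ultimately show ?thesis by (simp add: LIMSEQ_unique)
  qed
  with g show ?thesis by blast
qed

end

end

section \<open>Reflexivity for bounded exponents\<close>

lemma le_mult_if_le_mult_greater:
  fixes r D N :: real
  assumes "0 \<le> D" "\<And>\<alpha>. N < \<alpha> \<Longrightarrow> r \<le> D * \<alpha>"
  shows "r \<le> D * N"
proof (rule field_le_epsilon)
  fix e :: real assume "0 < e"
  then have "r \<le> D * (N + e / (D + 1))" using assms by simp
  also have "\<dots> = D * N + e * (D / (D + 1))" by (simp add: distrib_left)
  also have "\<dots> \<le> D * N + e * 1" using assms(1) \<open>0 < e\<close> by (intro add_mono mult_left_mono) auto
  finally show "r \<le> D * N + e" by simp
qed

context variable_exponent
begin

lemma nnorm_nonneg: "x \<in> pts (Lvar M p) \<Longrightarrow> 0 \<le> nnorm (Lvar M p) x"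
  by (auto simp: pts_Lvar nnorm_cls Lvar_fun_measurable luxemburg_nonneg)

lemma pts_Lvar_closed:
  "x \<in> pts (Lvar M p) \<Longrightarrow> y \<in> pts (Lvar M p) \<Longrightarrow> nadd (Lvar M p) x y \<in> pts (Lvar M p)"
  "x \<in> pts (Lvar M p) \<Longrightarrow> nscale (Lvar M p) c x \<in> pts (Lvar M p)"
  by (auto simp: pts_Lvar nadd_cls nscale_cls Lvar_fun_measurable Lvar_fun_add Lvar_fun_scale)

lemma canonical_embedding_in_bidual:
  assumes x: "x \<in> pts (Lvar M p)"
  shows "canonical_embedding (Lvar M p) x \<in> pts (dual (dual (Lvar M p)))"
proof -
  let ?X = "Lvar M p"
  obtain u where u: "u \<in> Lvar_fun M p" "x = cls u" using x by (auto simp: pts_Lvar)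
  have [measurable]: "u \<in> borel_measurable M" using u by (auto simp: Lvar_fun_def)
  have "\<bar>f x\<bar> \<le> nnorm ?X x * nnorm (dual ?X) f" if f: "f \<in> pts (dual ?X)" for f
  proof -
    have nn: "0 \<le> nnorm (dual ?X) f"
      using le_dual_norm[OF f, of "cls (\<lambda>_. 0)"] Lvar_fun_scale[OF u(1), of 0] luxemburg_scale[OF u(1), of 0] nnorm_nonneg
      by (force simp: pts_Lvar nnorm_cls simp del: dual_simps)
    have "\<bar>f x\<bar> \<le> nnorm (dual ?X) f * luxemburg M p u"
    proof (rule le_mult_if_le_mult_greater[OF nn])
      fix \<alpha> assume \<alpha>: "luxemburg M p u < \<alpha>"
      then have pos: "0 < \<alpha>" using luxemburg_nonneg[OF u(1)] by linarith
      have sc: "nscale ?X (1/\<alpha>) x \<in> pts ?X" using x by (rule pts_Lvar_closed)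
      have "nnorm ?X (nscale ?X (1/\<alpha>) x) = \<bar>1/\<alpha>\<bar> * luxemburg M p u"
        unfolding u(2) using luxemburg_scale[OF u(1), of "1/\<alpha>"] by (simp add: nscale_cls nnorm_cls)
      also have "\<dots> \<le> 1" using pos \<alpha> by (simp add: abs_divide)
      finally have "\<bar>f (nscale ?X (1/\<alpha>) x)\<bar> \<le> nnorm (dual ?X) f"
        by (rule le_dual_norm[OF f sc _ nnorm_nonneg])
      moreover have "f (nscale ?X (1/\<alpha>) x) = 1/\<alpha> * f x" using f x by (auto simp: mem_dual_iff)
      ultimately have "\<bar>f x\<bar> / \<alpha> \<le> nnorm (dual ?X) f" using pos by (simp add: abs_mult)
      then show "\<bar>f x\<bar> \<le> nnorm (dual ?X) f * \<alpha>" using pos by (simp add: pos_divide_le_eq)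
    qed
    then show ?thesis using u by (simp add: nnorm_cls mult.commute)
  qed
  then show ?thesis
    unfolding mem_dual_iff[of _ "dual ?X"]
    using dual_closed[of ?X, OF pts_Lvar_closed] x
    by (auto simp: canonical_embedding_def simp del: dual_simps(3) intro!: exI[of _ "nnorm ?X x"])
qed

text \<open>An element of the bidual is a functional of the densities \<open>g\<close>, which form the space for the conjugate
  exponent. Its own representation by a density \<open>u\<close> is evaluation at the class of \<open>u\<close>. The exponent
  \<open>P\<close> need not be \<open>p\<close>: reflexivity only depends on the norm up to equivalence.\<close>

theorem reflexive_if_norm_equivalent:
  assumes "bounded_exponent M P a b"
    and V: "Lvar_fun M p = Lpow M P"
    and K1: "\<And>u. u \<in> Lpow M P \<Longrightarrow> luxemburg M p u \<le> 1 \<Longrightarrow> power_modular M P u \<le> ennreal K"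
    and K2: "\<And>u. u \<in> Lpow M P \<Longrightarrow> power_modular M P u \<le> 1 \<Longrightarrow> luxemburg M p u \<le> K"
  shows "reflexive (Lvar M p)"
proof -
  interpret be: bounded_exponent M P a b by fact
  let ?Q = "\<lambda>t. P t / (P t - 1)"
  interpret ce: bounded_exponent M ?Q "b / (b - 1)" "a / (a - 1)" by (rule be.conj_bounded_exponent)
  let ?X = "Lvar M p"
  have ptsX: "pts ?X = cls ` Lpow M P" by (simp add: pts_Lvar V)
  have VQ: "Lpow M (\<lambda>t. ?Q t / (?Q t - 1)) = Lpow M P"
  proof -
    have "power_modular M (\<lambda>t. ?Q t / (?Q t - 1)) u = power_modular M P u" for u
      unfolding power_modular_def by (intro nn_integral_cong) (simp only: be.conj_conj_exp)
    then show ?thesis by (simp add: Lpow_def)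
  qed
  have K0: "0 \<le> K"
    using K2[OF be.Lpow_zero] luxemburg_nonneg[of "\<lambda>_. 0"] be.Lpow_zero V by (simp add: power_modular_def)
  define rep where "rep x = (SOME u. u \<in> Lpow M P \<and> x = cls u)" for x
  define \<phi> where "\<phi> g = (\<lambda>x\<in>pts ?X. \<integral>t. rep x t * g t \<partial>M)" for g
  have \<phi>_cls: "\<phi> g (cls u) = (\<integral>t. u t * g t \<partial>M)" if u: "u \<in> Lpow M P" and g: "g \<in> Lpow M ?Q" for u g
  proof -
    have r: "rep (cls u) \<in> Lpow M P \<and> cls u = cls (rep (cls u))"
      using someI_ex[of "\<lambda>v. v \<in> Lpow M P \<and> cls u = cls v"] u unfolding rep_def by blast
    have [measurable]: "u \<in> borel_measurable M" "rep (cls u) \<in> borel_measurable M" "g \<in> borel_measurable M"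
      using u r g by (auto simp: Lpow_def)
    have "AE t in M. u t = rep (cls u) t" using r by (subst (asm) cls_eq_iff) auto
    then have "(\<integral>t. rep (cls u) t * g t \<partial>M) = (\<integral>t. u t * g t \<partial>M)"
      by (intro integral_cong_AE) auto
    then show ?thesis using u by (simp add: \<phi>_def ptsX)
  qed
  have \<phi>_ext: "\<phi> g = f" if f: "f \<in> extensional (pts ?X)" and "g \<in> Lpow M ?Q"
    and "\<And>u. u \<in> Lpow M P \<Longrightarrow> f (cls u) = (\<integral>t. u t * g t \<partial>M)" for f g
  proof (rule extensionalityI[of _ "pts ?X"])
    show "\<phi> g \<in> extensional (pts ?X)" by (simp add: \<phi>_def)
    show "\<phi> g x = f x" if "x \<in> pts ?X" for x
      using that \<open>g \<in> Lpow M ?Q\<close> \<open>\<And>u. u \<in> Lpow M P \<Longrightarrow> f (cls u) = (\<integral>t. u t * g t \<partial>M)\<close>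
      by (auto simp: ptsX \<phi>_cls)
  qed (rule f)
  have meas: "u \<in> Lpow M R \<Longrightarrow> u \<in> borel_measurable M" for u R by (simp add: Lpow_def)
  have pair: "\<bar>\<integral>t. u t * g t \<partial>M\<bar> \<le> K + enn2real (power_modular M ?Q g)"
    if u: "u \<in> Lpow M P" "luxemburg M p u \<le> 1" and g: "g \<in> Lpow M ?Q" for u g
  proof -
    have "enn2real (power_modular M P u) \<le> K"
      using K1[OF u] K0 by (intro enn2real_leI) auto
    then show ?thesis using be.pairing_bound[OF u(1) g] by linarith
  qed
  have \<phi>_dual: "\<phi> g \<in> pts (dual ?X)" if g: "g \<in> Lpow M ?Q" for g
    unfolding mem_dual_iff
  proof (intro conjI ballI allI)
    show "\<phi> g \<in> extensional (pts ?X)" by (simp add: \<phi>_def)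
    show "\<phi> g (nadd ?X x y) = \<phi> g x + \<phi> g y" if xy: "x \<in> pts ?X" "y \<in> pts ?X" for x y
    proof -
      obtain u v where uv: "x = cls u" "y = cls v" "u \<in> Lpow M P" "v \<in> Lpow M P" using xy by (auto simp: ptsX)
      show ?thesis
        using be.pairing_integrable[OF uv(3) g] be.pairing_integrable[OF uv(4) g] uv
        by (simp add: nadd_cls meas \<phi>_cls g be.Lpow_add distrib_right)
    qed
    show "\<phi> g (nscale ?X c x) = c * \<phi> g x" if "x \<in> pts ?X" for c x
    proof -
      obtain u where u: "x = cls u" "u \<in> Lpow M P" using \<open>x \<in> pts ?X\<close> by (auto simp: ptsX)
      then show ?thesis by (simp add: nscale_cls meas \<phi>_cls g be.Lpow_scale mult.assoc)
    qed
    let ?D = "K + enn2real (power_modular M ?Q g)"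
    have "\<bar>\<phi> g x\<bar> \<le> ?D * nnorm ?X x" if x: "x \<in> pts ?X" for x
    proof -
      obtain u where u: "x = cls u" "u \<in> Lpow M P" using x by (auto simp: ptsX)
      have uL: "u \<in> Lvar_fun M p" using u V by simp
      have "\<bar>\<integral>t. u t * g t \<partial>M\<bar> \<le> ?D * luxemburg M p u"
      proof (rule le_mult_if_le_mult_greater)
        show "0 \<le> ?D" using K0 by simp
        fix \<alpha> assume \<alpha>: "luxemburg M p u < \<alpha>"
        then have pos: "0 < \<alpha>" using luxemburg_nonneg[OF uL] by linarith
        have "luxemburg M p (\<lambda>t. 1/\<alpha> * u t) \<le> 1"
          unfolding luxemburg_scale[OF uL] using pos \<alpha> by (simp add: abs_divide)
        then have "\<bar>\<integral>t. 1/\<alpha> * u t * g t \<partial>M\<bar> \<le> ?D"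
          by (rule pair[OF be.Lpow_scale[OF u(2)] _ g])
        moreover have "(\<integral>t. 1/\<alpha> * u t * g t \<partial>M) = 1/\<alpha> * (\<integral>t. u t * g t \<partial>M)"
          by (simp only: mult.assoc integral_mult_right_zero)
        ultimately have "\<bar>\<integral>t. u t * g t \<partial>M\<bar> / \<alpha> \<le> ?D" using pos by (simp add: abs_mult)
        then show "\<bar>\<integral>t. u t * g t \<partial>M\<bar> \<le> ?D * \<alpha>" using pos by (simp add: pos_divide_le_eq)
      qed
      then show ?thesis using u by (simp add: \<phi>_cls g nnorm_cls meas)
    qed
    then show "\<exists>B. \<forall>x\<in>pts ?X. \<bar>\<phi> g x\<bar> \<le> B * nnorm ?X x" by blast
  qed
  have dual_eq: "\<exists>g\<in>Lpow M ?Q. f = \<phi> g" if f: "f \<in> pts (dual ?X)" for f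
  proof -
    obtain B where B: "\<And>x. x \<in> pts ?X \<Longrightarrow> \<bar>f x\<bar> \<le> B * nnorm ?X x"
      using f unfolding mem_dual_iff by blast
    have f_add: "f (nadd ?X x y) = f x + f y" and f_scale: "f (nscale ?X c x) = c * f x"
      if "x \<in> pts ?X" "y \<in> pts ?X" for x y c
      using f that unfolding mem_dual_iff by blast+
    have "\<exists>g\<in>Lpow M ?Q. \<forall>u\<in>Lpow M P. f (cls u) = (\<integral>t. u t * g t \<partial>M)"
    proof (rule be.functional_representation)
      show "f (cls (\<lambda>t. u t + v t)) = f (cls u) + f (cls v)" if "u \<in> Lpow M P" "v \<in> Lpow M P" for u v
        using f_add[of "cls u" "cls v"] that nadd_cls[OF meas meas, OF that] by (simp add: ptsX)
      show "f (cls (\<lambda>t. c * u t)) = c * f (cls u)" if "u \<in> Lpow M P" for u c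
        using f_scale[of "cls u" "cls u" c] that nscale_cls[OF meas, OF that, of c] by (simp add: ptsX)
      show "\<bar>f (cls u)\<bar> \<le> \<bar>B\<bar> * K" if u: "u \<in> Lpow M P" "power_modular M P u \<le> 1" for u
      proof -
        have "\<bar>f (cls u)\<bar> \<le> B * luxemburg M p u" using B[of "cls u"] u by (simp add: ptsX nnorm_cls meas)
        also have "\<dots> \<le> \<bar>B\<bar> * K"
          using K2[OF u] luxemburg_nonneg[of u] u(1) V by (intro mult_mono) auto
        finally show ?thesis .
      qed
    qed
    then obtain g where g: "g \<in> Lpow M ?Q" "\<And>u. u \<in> Lpow M P \<Longrightarrow> f (cls u) = (\<integral>t. u t * g t \<partial>M)" by blast
    have "f \<in> extensional (pts ?X)" using f by (simp add: mem_dual_iff)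
    from \<phi>_ext[OF this g] g(1) show ?thesis by blast
  qed
  have "\<exists>x\<in>pts ?X. \<Phi> = canonical_embedding ?X x" if \<Phi>: "\<Phi> \<in> pts (dual (dual ?X))" for \<Phi>
  proof -
    obtain B where B: "\<And>f. f \<in> pts (dual ?X) \<Longrightarrow> \<bar>\<Phi> f\<bar> \<le> B * nnorm (dual ?X) f"
      using \<Phi> unfolding mem_dual_iff[of _ "dual ?X"] by blast
    have \<Phi>_add: "\<Phi> (nadd (dual ?X) f f') = \<Phi> f + \<Phi> f'" and \<Phi>_scale: "\<Phi> (nscale (dual ?X) c f) = c * \<Phi> f"
      if "f \<in> pts (dual ?X)" "f' \<in> pts (dual ?X)" for f f' c
      using \<Phi> that unfolding mem_dual_iff[of _ "dual ?X"] by blast+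
    have "\<exists>u\<in>Lpow M (\<lambda>t. ?Q t / (?Q t - 1)). \<forall>g\<in>Lpow M ?Q. \<Phi> (\<phi> g) = (\<integral>t. g t * u t \<partial>M)"
    proof (rule ce.functional_representation)
      show "\<Phi> (\<phi> (\<lambda>t. g t + g' t)) = \<Phi> (\<phi> g) + \<Phi> (\<phi> g')" if g: "g \<in> Lpow M ?Q" "g' \<in> Lpow M ?Q" for g g'
      proof -
        have "\<phi> (\<lambda>t. g t + g' t) = nadd (dual ?X) (\<phi> g) (\<phi> g')"
        proof (rule \<phi>_ext[OF _ ce.Lpow_add[OF g]])
          show "nadd (dual ?X) (\<phi> g) (\<phi> g') (cls u) = (\<integral>t. u t * (g t + g' t) \<partial>M)" if "u \<in> Lpow M P" for u
            using that g be.pairing_integrable[OF that] by (simp add: ptsX \<phi>_cls distrib_left)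
        qed simp
        then show ?thesis using \<Phi>_add[OF \<phi>_dual \<phi>_dual, OF g] by simp
      qed
      show "\<Phi> (\<phi> (\<lambda>t. c * g t)) = c * \<Phi> (\<phi> g)" if g: "g \<in> Lpow M ?Q" for g c
      proof -
        have "\<phi> (\<lambda>t. c * g t) = nscale (dual ?X) c (\<phi> g)"
        proof (rule \<phi>_ext[OF _ ce.Lpow_scale[OF g]])
          show "nscale (dual ?X) c (\<phi> g) (cls u) = (\<integral>t. u t * (c * g t) \<partial>M)" if "u \<in> Lpow M P" for u
            using that g by (simp add: ptsX \<phi>_cls mult.left_commute)
        qed simp
        then show ?thesis using \<Phi>_scale[OF \<phi>_dual \<phi>_dual, OF g g] by simp
      qed
      show "\<bar>\<Phi> (\<phi> g)\<bar> \<le> \<bar>B\<bar> * (K + 1)" if g: "g \<in> Lpow M ?Q" "power_modular M ?Q g \<le> 1" for g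
      proof -
        have zero: "cls (\<lambda>_. 0) \<in> {x \<in> pts ?X. nnorm ?X x \<le> 1}"
          using be.Lpow_zero luxemburg_scale[of "\<lambda>_. 0" 0] V by (auto simp: ptsX nnorm_cls)
        have "nnorm (dual ?X) (\<phi> g) \<le> K + 1"
          unfolding dual_simps
        proof (rule cSUP_least)
          show "{x \<in> pts ?X. nnorm ?X x \<le> 1} \<noteq> {}" using zero by blast
          fix x assume "x \<in> {x \<in> pts ?X. nnorm ?X x \<le> 1}"
          then obtain u where u: "x = cls u" "u \<in> Lpow M P" "nnorm ?X (cls u) \<le> 1" by (auto simp: ptsX)
          have "luxemburg M p u \<le> 1" using u nnorm_cls[OF meas[OF u(2)]] by simp
          moreover have "enn2real (power_modular M ?Q g) \<le> 1" using g(2) by (intro enn2real_leI) auto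
          ultimately show "\<bar>\<phi> g x\<bar> \<le> K + 1" using pair[OF u(2) _ g(1)] u by (simp add: \<phi>_cls g(1))
        qed
        moreover have "0 \<le> nnorm (dual ?X) (\<phi> g)"
          using le_dual_norm[OF \<phi>_dual[OF g(1)], of "cls (\<lambda>_. 0)"] zero nnorm_nonneg
          by (force simp del: dual_simps)
        ultimately have "\<bar>B\<bar> * nnorm (dual ?X) (\<phi> g) \<le> \<bar>B\<bar> * (K + 1)" "B * nnorm (dual ?X) (\<phi> g) \<le> \<bar>B\<bar> * nnorm (dual ?X) (\<phi> g)"
          by (auto intro!: mult_left_mono mult_right_mono simp del: dual_simps)
        then show ?thesis using B[OF \<phi>_dual[OF g(1)]] by linarith
      qed
    qed
    then obtain u where u: "u \<in> Lpow M P" and rep_u: "\<And>g. g \<in> Lpow M ?Q \<Longrightarrow> \<Phi> (\<phi> g) = (\<integral>t. g t * u t \<partial>M)"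
      unfolding VQ by blast
    have "\<Phi> = canonical_embedding ?X (cls u)"
    proof (rule extensionalityI[of _ "pts (dual ?X)"])
      show "\<Phi> \<in> extensional (pts (dual ?X))" using \<Phi> unfolding mem_dual_iff[of _ "dual ?X"] by blast
      show "canonical_embedding ?X (cls u) \<in> extensional (pts (dual ?X))" by (simp add: canonical_embedding_def)
      fix f assume f: "f \<in> pts (dual ?X)"
      then obtain g where g: "g \<in> Lpow M ?Q" "f = \<phi> g" using dual_eq by blast
      have "\<Phi> f = (\<integral>t. u t * g t \<partial>M)" using rep_u[OF g(1)] g(2) by (simp add: mult.commute)
      also have "\<dots> = f (cls u)" using u g by (simp add: \<phi>_cls)
      finally show "\<Phi> f = canonical_embedding ?X (cls u) f" using f by (simp add: canonical_embedding_def)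
    qed
    then show ?thesis using u ptsX by blast
  qed
  then show ?thesis
    unfolding reflexive_def using canonical_embedding_in_bidual by blast
qed

end

section \<open>Exceptional exponents on finitely many atoms\<close>

context sigma_finite_measure
begin

lemma atom_finite:
  assumes A: "atom M A"
  shows "emeasure M A = ennreal (measure M A)" and "0 < measure M A"
proof -
  have A': "A \<in> sets M" "0 < emeasure M A" using A by (auto simp: atom_def)
  obtain B where B: "B \<in> sets M" "B \<subseteq> A" "0 < emeasure M B" "emeasure M B < \<infinity>"
    by (rule finite_positive_subset[OF A'])
  then have "emeasure M A < \<infinity>" using A unfolding atom_def by (metis less_irrefl)
  then show em: "emeasure M A = ennreal (measure M A)" by (intro emeasure_eq_ennreal_measure) auto
  show "0 < measure M A" using A'(2) unfolding em by simp
qed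

text \<open>On an atom a Chebyshev estimate becomes a pointwise bound: a superlevel set is either null
  or the whole atom.\<close>

lemma AE_le_on_atom:
  assumes A: "atom M A" and [measurable]: "u \<in> borel_measurable M" and r: "1 \<le> r"
    and int: "(\<integral>\<^sup>+t\<in>A. ennreal (\<bar>u t\<bar> powr r) \<partial>M) \<le> 1"
  shows "AE t in M. t \<in> A \<longrightarrow> \<bar>u t\<bar> \<le> max 1 (2 / measure M A)"
proof -
  let ?K = "max 1 (2 / measure M A)"
  have [measurable]: "A \<in> sets M" using A by (simp add: atom_def)
  define S where "S = A \<inter> {t \<in> space M. ?K < \<bar>u t\<bar>}"
  have S [measurable]: "S \<in> sets M" unfolding S_def by measurable
  have "emeasure M S \<noteq> emeasure M A"
  proof
    assume eq: "emeasure M S = emeasure M A"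
    have "2 \<le> ?K * measure M A"
      using mult_right_mono[of "2 / measure M A" ?K "measure M A"] atom_finite(2)[OF A] by simp
    then have "ennreal 2 \<le> ennreal (?K * measure M A)" by (rule ennreal_leI)
    also have "\<dots> = ennreal ?K * emeasure M S"
      unfolding eq atom_finite(1)[OF A] by (rule ennreal_mult) auto
    also have "\<dots> = (\<integral>\<^sup>+t\<in>S. ennreal ?K \<partial>M)" by (rule nn_integral_cmult_indicator[symmetric]) (rule S)
    also have "\<dots> \<le> (\<integral>\<^sup>+t\<in>A. ennreal (\<bar>u t\<bar> powr r) \<partial>M)"
    proof (rule nn_integral_mono)
      fix t
      have "?K \<le> \<bar>u t\<bar> powr r" if "t \<in> S"
      proof -
        have "?K < \<bar>u t\<bar>" using that by (simp add: S_def)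
        then have "1 \<le> \<bar>u t\<bar>" by simp
        then have "\<bar>u t\<bar> powr 1 \<le> \<bar>u t\<bar> powr r" using r by (intro powr_mono) auto
        then show ?thesis using \<open>?K < \<bar>u t\<bar>\<close> \<open>1 \<le> \<bar>u t\<bar>\<close> by simp
      qed
      then show "ennreal ?K * indicator S t \<le> ennreal (\<bar>u t\<bar> powr r) * indicator A t"
        by (auto simp: indicator_def S_def intro: ennreal_leI)
    qed
    also have "\<dots> \<le> 1" by (rule int)
    finally have "ennreal 2 \<le> ennreal 1" by simp
    then show False by (subst (asm) ennreal_le_iff) auto
  qed
  then have "S \<in> null_sets M" using A S unfolding atom_def by (auto simp: S_def null_sets_def)
  then have "AE t in M. t \<notin> S" by (rule AE_not_in)
  then show ?thesis using AE_space by eventually_elim (auto simp: S_def not_less)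
qed

text \<open>On finitely many atoms the norms for all exponents are equivalent to the essential supremum, by this
  bound and the finiteness of the measure.\<close>

lemma ess_finitely_many_atoms_bound:
  assumes S [measurable]: "S \<in> sets M" and fin: "ess_finitely_many_atoms M S"
  obtains K where "1 \<le> K" "emeasure M S \<le> ennreal K"
    "\<And>u r. u \<in> borel_measurable M \<Longrightarrow> 1 \<le> r \<Longrightarrow> (\<integral>\<^sup>+t\<in>S. ennreal (\<bar>u t\<bar> powr r) \<partial>M) \<le> 1 \<Longrightarrow>
      AE t in M. t \<in> S \<longrightarrow> \<bar>u t\<bar> \<le> K"
proof -
  obtain \<A> where \<A>: "finite \<A>" "\<And>A. A \<in> \<A> \<Longrightarrow> atom M A" "sym_diff S (\<Union>\<A>) \<in> null_sets M"
    using fin by (auto simp: ess_finitely_many_atoms_def)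
  have Am: "A \<in> sets M" if "A \<in> \<A>" for A using \<A>(2)[OF that] by (simp add: atom_def)
  have null: "AE t in M. t \<in> S \<longleftrightarrow> t \<in> \<Union>\<A>"
    using AE_not_in[OF \<A>(3)] by eventually_elim auto
  define K where "K = 1 + (\<Sum>A\<in>\<A>. max 1 (2 / measure M A) + measure M A)"
  have nn: "0 \<le> max 1 (2 / measure M A) + measure M A" for A by (intro add_nonneg_nonneg) auto
  have K_ge: "max 1 (2 / measure M A) \<le> K" if "A \<in> \<A>" for A
  proof -
    have "max 1 (2 / measure M A) + measure M A \<le> (\<Sum>A\<in>\<A>. max 1 (2 / measure M A) + measure M A)"
      by (rule member_le_sum[OF that nn \<A>(1)])
    then show ?thesis unfolding K_def using measure_nonneg[of M A] by linarith
  qed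
  show thesis
  proof
    have "0 \<le> (\<Sum>A\<in>\<A>. max 1 (2 / measure M A) + measure M A)" by (rule sum_nonneg) (rule nn)
    then show "1 \<le> K" by (simp add: K_def)
    have "emeasure M S = emeasure M (\<Union>\<A>)"
      by (rule emeasure_eq_AE[OF null]) (use Am \<A>(1) in \<open>auto intro: sets.finite_Union\<close>)
    also have "\<dots> \<le> (\<Sum>A\<in>\<A>. emeasure M A)"
      using emeasure_subadditive_finite[OF \<A>(1), of "\<lambda>A. A" M] Am by auto
    also have "\<dots> = (\<Sum>A\<in>\<A>. ennreal (measure M A))" using atom_finite(1) \<A>(2) by (intro sum.cong) auto
    also have "\<dots> = ennreal (\<Sum>A\<in>\<A>. measure M A)" by (rule sum_ennreal) simp
    also have "\<dots> \<le> ennreal K"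
    proof (rule ennreal_leI)
      have "(\<Sum>A\<in>\<A>. measure M A) \<le> (\<Sum>A\<in>\<A>. max 1 (2 / measure M A) + measure M A)"
        by (rule sum_mono) auto
      then show "(\<Sum>A\<in>\<A>. measure M A) \<le> K" by (simp add: K_def)
    qed
    finally show "emeasure M S \<le> ennreal K" .
    fix u :: "'a \<Rightarrow> real" and r :: real
    assume u: "u \<in> borel_measurable M" and r: "1 \<le> r" and int: "(\<integral>\<^sup>+t\<in>S. ennreal (\<bar>u t\<bar> powr r) \<partial>M) \<le> 1"
    have "AE t in M. t \<in> A \<longrightarrow> \<bar>u t\<bar> \<le> K" if A: "A \<in> \<A>" for A
    proof -
      have "(\<integral>\<^sup>+t\<in>A. ennreal (\<bar>u t\<bar> powr r) \<partial>M) \<le> (\<integral>\<^sup>+t\<in>S. ennreal (\<bar>u t\<bar> powr r) \<partial>M)"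
        using null by (intro nn_integral_mono_AE, eventually_elim) (use A in \<open>auto simp: indicator_def\<close>)
      then have "(\<integral>\<^sup>+t\<in>A. ennreal (\<bar>u t\<bar> powr r) \<partial>M) \<le> 1" using int by (rule order_trans)
      from AE_le_on_atom[OF \<A>(2)[OF A] u r this] show ?thesis
        by eventually_elim (use K_ge[OF A] in auto)
    qed
    then have "AE t in M. \<forall>A\<in>\<A>. t \<in> A \<longrightarrow> \<bar>u t\<bar> \<le> K" using \<A>(1) by (subst AE_finite_all) auto
    then show "AE t in M. t \<in> S \<longrightarrow> \<bar>u t\<bar> \<le> K" using null by eventually_elim auto
  qed
qed

end

context variable_exponent
begin

text \<open>On the exceptional atoms, where \<open>p\<close> is 1 or infinite, and on a null set, \<open>p\<close> is replaced by the exponent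
  2. By \<open>ess_finitely_many_atoms_bound\<close> each of the two modulars is bounded where the other
  is at most 1, so the norm changes to an equivalent one.\<close>

theorem reflexive_if_exponent_bounded:
  assumes one: "ess_finitely_many_atoms M {t \<in> space M. p t = 1}"
    and inf: "ess_finitely_many_atoms M inf_part"
    and low: "0 < d" "emeasure M {t \<in> fin_part. 0 < expo t - 1 \<and> expo t - 1 < d} = 0"
    and up: "emeasure M {t \<in> fin_part. real k < expo t} = 0"
  shows "reflexive (Lvar M p)"
proof -
  define S where "S = {t \<in> space M. p t = 1}"
  have S [measurable]: "S \<in> sets M" unfolding S_def by measurable
  have SpF: "t \<in> space M" if "t \<in> fin_part" for t using that by (simp add: fin_part_def)
  have expo_S: "t \<in> fin_part" "expo t = 1" if "t \<in> S" for t using that by (auto simp: S_def fin_part_def)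
  define a where "a = 1 + min d 1"
  define b where "b = max (real k) 2"
  have ab: "1 < a" "a \<le> 2" "2 \<le> b" using low by (auto simp: a_def b_def)
  define good where "good = {t \<in> fin_part. a \<le> expo t \<and> expo t \<le> b}"
  have good_eq: "good = fin_part \<inter> {t \<in> space M. a \<le> expo t \<and> expo t \<le> b}" using SpF by (auto simp: good_def)
  have [measurable]: "good \<in> sets M" unfolding good_eq by measurable
  define P where "P t = (if t \<in> good then expo t else 2)" for t
  have [measurable]: "P \<in> borel_measurable M" unfolding P_def[abs_def] by measurable
  have be: "bounded_exponent M P a b"
    by unfold_locales (use ab in \<open>auto simp: P_def good_def\<close>)
  interpret be: bounded_exponent M P a b by (rule be)
  have disj: "t \<notin> good" if "t \<in> S \<or> t \<in> inf_part" for t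
    using that ab expo_S[of t] by (auto simp: good_def inf_part_def fin_part_def)
  have cover: "AE t in M. t \<in> good \<or> t \<in> S \<or> t \<in> inf_part"
  proof -
    let ?A1 = "{t \<in> fin_part. 0 < expo t - 1 \<and> expo t - 1 < d}" and ?A2 = "{t \<in> fin_part. real k < expo t}"
    have "?A1 = fin_part \<inter> {t \<in> space M. 0 < expo t - 1 \<and> expo t - 1 < d}"
      "?A2 = fin_part \<inter> {t \<in> space M. real k < expo t}" using SpF by blast+
    then have "?A1 \<in> sets M" "?A2 \<in> sets M" by simp_all
    then have "?A1 \<in> null_sets M" "?A2 \<in> null_sets M" using low up by (auto simp: null_sets_def)
    then have "AE t in M. t \<notin> ?A1" "AE t in M. t \<notin> ?A2" by - (rule AE_not_in, assumption)+
    then show ?thesis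
      using AE_space
    proof eventually_elim
      case (elim t)
      show ?case
      proof (cases "t \<in> fin_part")
        case True
        then have q: "1 \<le> expo t" by (rule expo_ge_1)
        have "p t < top" using True by (simp add: fin_part_def)
        then have "expo t = 1 \<Longrightarrow> p t = 1" by (metis ennreal_1 ennreal_enn2real)
        then show ?thesis using elim True q SpF[OF True] by (auto simp: good_def S_def a_def b_def)
      next
        case False
        then show ?thesis using elim by (auto simp: fin_part_def inf_part_def top.not_eq_extremum)
      qed
    qed
  qed
  obtain K1 where K1: "1 \<le> K1" "emeasure M S \<le> ennreal K1"
    "\<And>u r. u \<in> borel_measurable M \<Longrightarrow> 1 \<le> r \<Longrightarrow> (\<integral>\<^sup>+t\<in>S. ennreal (\<bar>u t\<bar> powr r) \<partial>M) \<le> 1 \<Longrightarrow>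
      AE t in M. t \<in> S \<longrightarrow> \<bar>u t\<bar> \<le> K1"
    using ess_finitely_many_atoms_bound[OF S] one unfolding S_def by blast
  obtain K2 where K2: "1 \<le> K2" "emeasure M inf_part \<le> ennreal K2"
    "\<And>u r. u \<in> borel_measurable M \<Longrightarrow> 1 \<le> r \<Longrightarrow> (\<integral>\<^sup>+t\<in>inf_part. ennreal (\<bar>u t\<bar> powr r) \<partial>M) \<le> 1 \<Longrightarrow>
      AE t in M. t \<in> inf_part \<longrightarrow> \<bar>u t\<bar> \<le> K2"
    using ess_finitely_many_atoms_bound[OF parts_measurable(2) inf] by blast
  define K where "K = 1 + K1 ^ 2 * K1 + K2 ^ 2 * K2"
  have K_ge_1: "1 \<le> K" using K1(1) K2(1) by (simp add: K_def)
  have const: "(\<integral>\<^sup>+t\<in>E. ennreal c \<partial>M) \<le> ennreal (c * r)"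
    if "E \<in> sets M" "emeasure M E \<le> ennreal r" "0 \<le> c" "0 \<le> r" for E c r
  proof -
    have "(\<integral>\<^sup>+t\<in>E. ennreal c \<partial>M) = ennreal c * emeasure M E"
      by (rule nn_integral_cmult_indicator) (rule that)
    also have "\<dots> \<le> ennreal c * ennreal r" by (rule mult_left_mono) (use that in auto)
    also have "\<dots> = ennreal (c * r)" using that(3,4) by (rule ennreal_mult[symmetric])
    finally show ?thesis .
  qed
  have to_P: "power_modular M P u \<le> ennreal K"
    if u [measurable]: "u \<in> borel_measurable M" and m: "modular M p u \<le> 1" for u
  proof -
    let ?f = "\<lambda>t. ennreal (\<bar>u t\<bar> powr expo t) * indicator fin_part t"
    have int: "(\<integral>\<^sup>+t. ?f t \<partial>M) \<le> 1"
      using m unfolding modular_eq by (rule order_trans[rotated]) simp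
    have "(\<integral>\<^sup>+t\<in>S. ennreal (\<bar>u t\<bar> powr 1) \<partial>M) \<le> (\<integral>\<^sup>+t. ?f t \<partial>M)"
      by (intro nn_integral_mono) (auto simp: indicator_def expo_S)
    then have uS: "AE t in M. t \<in> S \<longrightarrow> \<bar>u t\<bar> \<le> K1"
      using int by (intro K1(3)[OF u, of 1]) auto
    have "ess_inf_part u \<le> 1" using m unfolding modular_eq by (rule order_trans[rotated]) simp
    then have uI: "AE t in M. t \<in> inf_part \<longrightarrow> ennreal \<bar>u t\<bar> \<le> 1" by (simp add: ess_inf_part_le_iff[OF u])
    have "power_modular M P u \<le> (\<integral>\<^sup>+t. ?f t + (ennreal (K1 ^ 2) * indicator S t + ennreal (K2 ^ 2) * indicator inf_part t) \<partial>M)"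
      unfolding power_modular_def
    proof (rule nn_integral_mono_AE)
      show "AE t in M. ennreal (\<bar>u t\<bar> powr P t)
          \<le> ?f t + (ennreal (K1 ^ 2) * indicator S t + ennreal (K2 ^ 2) * indicator inf_part t)"
        using cover uS uI
      proof eventually_elim
        case (elim t)
        then consider "t \<in> good" | "t \<in> S" "t \<notin> good" | "t \<in> inf_part" "t \<notin> good" by blast
        then show ?case
        proof cases
          case 1
          then show ?thesis by (simp add: P_def good_def)
        next
          case 2
          have "\<bar>u t\<bar> powr 2 \<le> K1 powr 2" using elim 2 by (intro powr_mono2) auto
          then have "ennreal (\<bar>u t\<bar> powr P t) \<le> ennreal (K1 ^ 2)"
            using 2 K1(1) by (intro ennreal_leI) (simp add: P_def)
          then show ?thesis using 2 by (simp add: add_increasing add_increasing2)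
        next
          case 3
          have "\<bar>u t\<bar> \<le> K2" using elim 3 K2(1) by simp
          then have "\<bar>u t\<bar> powr 2 \<le> K2 powr 2" by (intro powr_mono2) auto
          then have "ennreal (\<bar>u t\<bar> powr P t) \<le> ennreal (K2 ^ 2)"
            using 3 K2(1) by (intro ennreal_leI) (simp add: P_def)
          then show ?thesis using 3 by (simp add: add_increasing)
        qed
      qed
    qed
    also have "\<dots> = (\<integral>\<^sup>+t. ?f t \<partial>M) + ((\<integral>\<^sup>+t\<in>S. ennreal (K1 ^ 2) \<partial>M) + (\<integral>\<^sup>+t\<in>inf_part. ennreal (K2 ^ 2) \<partial>M))"
      by (simp add: nn_integral_add)
    also have "\<dots> \<le> ennreal 1 + (ennreal (K1 ^ 2 * K1) + ennreal (K2 ^ 2 * K2))"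
      using int K1(1,2) K2(1,2) by (intro add_mono const) auto
    also have "\<dots> = ennreal K" using K1(1) K2(1) by (simp add: K_def add.assoc)
    finally show ?thesis .
  qed
  define L where "L = 1 + K1 * K1 + K2"
  have L_ge_1: "1 \<le> L" using K1(1) K2(1) by (simp add: L_def)
  have from_P: "modular M p u \<le> ennreal L"
    if u [measurable]: "u \<in> borel_measurable M" and m: "power_modular M P u \<le> 1" for u
  proof -
    have sub: "(\<integral>\<^sup>+t\<in>E. ennreal (\<bar>u t\<bar> powr 2) \<partial>M) \<le> 1" if "\<And>t. t \<in> E \<Longrightarrow> t \<notin> good" for E
    proof -
      have "(\<integral>\<^sup>+t\<in>E. ennreal (\<bar>u t\<bar> powr 2) \<partial>M) \<le> power_modular M P u"
        unfolding power_modular_def by (intro nn_integral_mono) (use that in \<open>auto simp: indicator_def P_def\<close>)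
      then show ?thesis using m by (rule order_trans)
    qed
    have uS: "AE t in M. t \<in> S \<longrightarrow> \<bar>u t\<bar> \<le> K1"
      by (rule K1(3)[OF u, of 2]) (use sub[of S] disj in auto)
    have uI: "AE t in M. t \<in> inf_part \<longrightarrow> \<bar>u t\<bar> \<le> K2"
      by (rule K2(3)[OF u, of 2]) (use sub[of inf_part] disj in auto)
    have "(\<integral>\<^sup>+t. ennreal (\<bar>u t\<bar> powr expo t) * indicator fin_part t \<partial>M)
        \<le> (\<integral>\<^sup>+t. ennreal (\<bar>u t\<bar> powr P t) + ennreal K1 * indicator S t \<partial>M)"
    proof (rule nn_integral_mono_AE)
      show "AE t in M. ennreal (\<bar>u t\<bar> powr expo t) * indicator fin_part t
          \<le> ennreal (\<bar>u t\<bar> powr P t) + ennreal K1 * indicator S t"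
        using cover uS
      proof eventually_elim
        case (elim t)
        then consider "t \<in> good" | "t \<in> S" | "t \<in> inf_part" by blast
        then show ?case
        proof cases
          case 1
          then show ?thesis by (simp add: P_def indicator_def)
        next
          case 2
          then have "ennreal \<bar>u t\<bar> \<le> ennreal K1" using elim by (intro ennreal_leI) auto
          then show ?thesis using 2 expo_S[OF 2] by (simp add: add_increasing)
        next
          case 3
          then show ?thesis by (simp add: inf_part_def fin_part_def)
        qed
      qed
    qed
    also have "\<dots> = power_modular M P u + (\<integral>\<^sup>+t\<in>S. ennreal K1 \<partial>M)"
      by (simp add: nn_integral_add power_modular_def)
    also have "\<dots> \<le> ennreal 1 + ennreal (K1 * K1)"
      using m K1(1,2) by (intro add_mono const) auto
    finally have I: "(\<integral>\<^sup>+t. ennreal (\<bar>u t\<bar> powr expo t) * indicator fin_part t \<partial>M) \<le> ennreal 1 + ennreal (K1 * K1)" .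
    have E: "ess_inf_part u \<le> ennreal K2"
      unfolding ess_inf_part_le_iff[OF u] using uI by eventually_elim (auto intro: ennreal_leI)
    have "modular M p u \<le> (ennreal 1 + ennreal (K1 * K1)) + ennreal K2"
      unfolding modular_eq by (rule add_mono[OF I E])
    also have "\<dots> = ennreal L" using K1(1) K2(1) by (simp add: L_def add.assoc)
    finally show ?thesis .
  qed
  have modular_L: "modular M p (\<lambda>t. u t / L) \<le> 1"
    if u: "u \<in> borel_measurable M" and m: "power_modular M P u \<le> 1" for u
  proof -
    have "modular M p (\<lambda>t. 1 / L * u t) \<le> ennreal (1 / L) * modular M p u"
      by (rule modular_scale_le[OF u]) (use L_ge_1 in auto)
    also have "\<dots> \<le> ennreal (1 / L) * ennreal L" by (rule mult_left_mono[OF from_P[OF u m]]) simp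
    also have "\<dots> = 1" using L_ge_1 by (simp flip: ennreal_mult)
    finally show ?thesis by simp
  qed
  have V: "Lvar_fun M p = Lpow M P"
  proof (intro equalityI subsetI)
    fix u assume u: "u \<in> Lvar_fun M p"
    then have [measurable]: "u \<in> borel_measurable M" by (rule Lvar_fun_measurable)
    obtain \<alpha> where \<alpha>: "0 < \<alpha>" "modular M p (\<lambda>t. u t / \<alpha>) \<le> 1" using luxemburg_set_nonempty[OF u] by blast
    have "power_modular M P (\<lambda>t. u t / \<alpha>) \<le> ennreal K" by (rule to_P) (use \<alpha> in auto)
    also have "\<dots> < \<infinity>" by simp
    finally have "(\<lambda>t. u t / \<alpha>) \<in> Lpow M P" by (simp add: Lpow_def)
    then show "u \<in> Lpow M P" using be.Lpow_scale[of "\<lambda>t. u t / \<alpha>" \<alpha>] \<alpha> by simp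
  next
    fix u assume u: "u \<in> Lpow M P"
    then have [measurable]: "u \<in> borel_measurable M" by (simp add: Lpow_def)
    define r where "r = enn2real (power_modular M P u)"
    have r: "power_modular M P u = ennreal r" "0 \<le> r" using u by (auto simp: r_def Lpow_def)
    define c where "c = max 1 r"
    have c: "1 \<le> c" "r \<le> c" by (auto simp: c_def)
    have le: "(1/c) powr q \<le> 1/c" if "1 \<le> q" for q
      using powr_mono'[of 1 q "1/c"] that c by simp
    have "power_modular M P (\<lambda>t. 1/c * u t) \<le> ennreal (max ((1/c) powr a) ((1/c) powr b)) * power_modular M P u"
      by (rule be.power_modular_scale_le) (use c in auto)
    also have "\<dots> \<le> ennreal (1/c) * ennreal r"
      unfolding r(1) using le ab by (intro mult_right_mono ennreal_leI) auto
    also have "\<dots> = ennreal (1/c * r)" using c r by (intro ennreal_mult[symmetric]) auto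
    also have "\<dots> \<le> 1" using c by simp
    finally have "modular M p (\<lambda>t. 1/c * u t / L) \<le> 1" by (intro modular_L) auto
    then have "(\<lambda>t. 1/c * u t) \<in> Lvar_fun M p" using L_ge_1 by (intro Lvar_funI[of _ L]) auto
    then show "u \<in> Lvar_fun M p" using Lvar_fun_scale[of "\<lambda>t. 1/c * u t" c] c by simp
  qed
  define K' where "K' = max (2 powr b * K) L"
  show ?thesis
  proof (rule reflexive_if_norm_equivalent[OF be V, of K'])
    fix u assume u: "u \<in> Lpow M P"
    then have um [measurable]: "u \<in> borel_measurable M" by (simp add: Lpow_def)
    show "power_modular M P u \<le> ennreal K'" if lux: "luxemburg M p u \<le> 1"
    proof -
      have "modular M p (\<lambda>t. u t / 2) \<le> 1" by (rule modular_le_1) (use u V lux in auto)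
      then have m: "power_modular M P (\<lambda>t. u t / 2) \<le> ennreal K" by (intro to_P) auto
      have "power_modular M P u = power_modular M P (\<lambda>t. 2 * (u t / 2))" by simp
      also have "\<dots> \<le> ennreal (max (2 powr a) (2 powr b)) * power_modular M P (\<lambda>t. u t / 2)"
        by (rule be.power_modular_scale_le) auto
      also have "\<dots> \<le> ennreal (2 powr b) * ennreal K"
        using ab m by (intro mult_mono ennreal_leI) (auto intro: powr_mono)
      also have "\<dots> = ennreal (2 powr b * K)" using K_ge_1 by (intro ennreal_mult[symmetric]) auto
      also have "\<dots> \<le> ennreal K'" by (intro ennreal_leI) (simp add: K'_def)
      finally show ?thesis .
    qed
    show "luxemburg M p u \<le> K'" if "power_modular M P u \<le> 1"
    proof -
      have "luxemburg M p u \<le> L" using modular_L[OF um that] L_ge_1 by (intro luxemburg_le) auto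
      then show ?thesis by (simp add: K'_def)
    qed
  qed
qed

end

section \<open>Nonreflexive subspaces with the fixed point property\<close>

theorem corollary4p8:
  fixes M :: "'a measure" and p :: "'a \<Rightarrow> ennreal"
  assumes "complete_measure M" and "sigma_finite_measure M"
    and "p \<in> borel_measurable M" and "\<And>t. t \<in> space M \<Longrightarrow> 1 \<le> p t"
    and "\<not> reflexive (Lvar M p)"
    and "contains_isometric_copy (Lvar M p) ell_infty \<or>
         ess_finitely_many_atoms M {t \<in> space M. p t = 1} \<or>
         \<not> contains_isometric_copy (Lvar M p) ell1"
  shows "\<exists>Y. closed_subspace (Lvar M p) Y \<and>
             \<not> reflexive (restrict_nspace (Lvar M p) Y) \<and>
             FPP (restrict_nspace (Lvar M p) Y)"
proof -
  interpret variable_exponent M p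
    using assms(2-4) by (simp add: variable_exponent_def variable_exponent_axioms_def)
  have copy: ?thesis if "l1_renorming N \<tau>" "contains_isometric_copy (Lvar M p) (renormed_l1 N)" for N \<tau>
    using l1_renorming.nonreflexive_FPP_subspace_if_copy[OF that(1) Metric_space_Lvar nscale_0_Lvar that(2)] .
  show ?thesis
  proof (cases "contains_isometric_copy (Lvar M p) ell_infty")
    case True
    then show ?thesis
      using copy[OF lin.l1_renorming_axioms] contains_isometric_copy_trans ell_infty_contains_renormed_l1 by blast
  next
    case False
    then have one: "ess_finitely_many_atoms M {t \<in> space M. p t = 1}"
      using assms(6) contains_ell1 by blast
    have inf: "ess_finitely_many_atoms M inf_part" using False contains_ell_infty_inf_part by blast
    obtain k :: nat where k: "emeasure M {t \<in> fin_part. real k < expo t} = 0"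
      using False contains_ell_infty_unbounded by (metis zero_less_iff_neq_zero)
    show ?thesis
    proof (cases "\<forall>e>0. 0 < emeasure M {t \<in> fin_part. 0 < expo t - 1 \<and> expo t - 1 < e}")
      case True
      then show ?thesis using contains_renormed_l1_if_expo_near_1 copy by blast
    next
      case False
      then obtain d where "0 < d" "emeasure M {t \<in> fin_part. 0 < expo t - 1 \<and> expo t - 1 < d} = 0"
        by (auto simp: zero_less_iff_neq_zero)
      then have "reflexive (Lvar M p)" using reflexive_if_exponent_bounded[OF one inf] k by blast
      then show ?thesis using assms(5) by blast
    qed
  qed
qed

end
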